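(* Let $X$ and $Y$ be based, connected, countable CW complexes with non-degenerate basepoints, and let $f \colon X \to Y$ be a map. Let $A \colon G \times Y \to Y$ be a homotopy-associative action of a group-like space $G$ on $Y$. Let $\gamma \colon X \to G$ be any based map, and let $\gamma\cdot f\colon X\to Y$ be the map $(\gamma\cdot f)(x)=A(\gamma(x),f(x))$. Then: (A) The path components $\mathrm{map}(X,Y;f)$ and $\mathrm{map}(X,Y;\gamma\cdot f)$ have the same homotopy type. (B) If $X$ is a finite complex, then $\mathrm{map}(X,Y;f)$ and $\mathrm{map}(X,Y;\gamma\cdot f)$ (with basepoints $f$ and $\gamma\cdot f$) have the same based homotopy type. (C) If $X$ is a finite complex and the action is strictly unital, then the evaluation fibrations $\omega_f \colon \mathrm{map}(X, Y;f) \to Y$ and $\omega_{\gamma \cdot f} \colon \mathrm{map}(X, Y; \gamma \cdot f)\to Y$ are fibre-homotopy equivalent.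
   Context: $\mathrm{map}(X,Y)$ is the space of all continuous (not necessarily based) maps with the compact-open topology, and $\mathrm{map}(X,Y;f)$ is its path component containing $f$, regarded as a based space with basepoint $f$. With $x_0\in X$ the basepoint, $\omega_f\colon \mathrm{map}(X,Y;f)\to Y$ is the evaluation $\omega_f(h)=h(x_0)$, which is a Hurewicz fibration. $\sim_*$ denotes based homotopy. An H-space is a based space $G$ with a based map $m \colon G\times G\to G$ such that $m\circ J\sim_*\nabla\colon G\vee G\to G$, where $J\colon G\vee G\to G\times G$ is the inclusion and $\nabla$ is the folding map. It is homotopy-associative if $m\circ(m\times 1)\sim_* m\circ(1\times m)$. A group-like space is a homotopy-associative H-space $G$ together with a based map $\iota\colon G\to G$ such that $m\circ(\iota\times 1)\circ\Delta\sim_* 0$ and $m\circ(1\times\iota)\circ\Delta\sim_* 0$, where $\Delta$ is the diagonal map and $0$ is the constant map. A homotopy-associative action of $G$ on a based space $Y$ is a based map $A\colon G\times Y\to Y$ such that $A\circ i_2\sim_* 1_Y$ and $A\circ(1\times A)\sim_* A\circ(m\times 1)\colon G\times G\times Y\to Y$, where $i_2\colon Y\to G\times Y$ is the inclusion $y\mapsto (e,y)$, with $e$ the basepoint of $G$. It is strictly unital if $A\circ i_2=1_Y$. Fibrations $p_1\colon E_1\to B$ and $p_2\colon E_2\to B$ are fibre-homotopy equivalent if there are based maps $h\colon E_1\to E_2$ and $k\colon E_2\to E_1$ over $B$ (that is, $p_2 h=p_1$ and $p_1k=p_2$) such that $k\circ h$ and $h\circ k$ are homotopic to the respective identities by based homotopies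 $F$ and $H$ satisfying $p_1F(x,t)=p_1(x)$ and $p_2H(y,t)=p_2(y)$ for all $x \in E_1$, $y\in E_2$, $t\in [0,1]$. *)

theory Defs
  imports "HOL-Analysis.Analysis"
begin

text \<open>Spaces are abstract topologies; a based space is a topology together with a point of it.\<close>

section \<open>CW complexes\<close>

text \<open>
  A CW complex is a Hausdorff space \<open>X\<close> with a family \<open>\<E>\<close> of pairwise disjoint open cells that
  cover it, \<open>d e\<close> being the dimension of the cell \<open>e\<close>. Each cell has a characteristic map from the
  closed disc, every closed cell lies in finitely many open cells, and \<open>X\<close> carries the
  weak topology. The complex is finite (countable) if \<open>\<E>\<close> is. For \<open>n = 0\<close> the disc below is a
  single point, equal to its interior, with empty boundary sphere.
\<close>

definition closed_disc :: "nat \<Rightarrow> (nat \<Rightarrow> real) topology" where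
  "closed_disc n = subtopology (Euclidean_space n) {x. (\<Sum>i<n. (x i)\<^sup>2) \<le> 1}"

definition open_disc :: "nat \<Rightarrow> (nat \<Rightarrow> real) topology" where
  "open_disc n = subtopology (Euclidean_space n) {x. (\<Sum>i<n. (x i)\<^sup>2) < 1}"

definition characteristic_map ::
    "'a topology \<Rightarrow> 'a set set \<Rightarrow> ('a set \<Rightarrow> nat) \<Rightarrow> 'a set \<Rightarrow> ((nat \<Rightarrow> real) \<Rightarrow> 'a) \<Rightarrow> bool" where
  "characteristic_map X \<E> d e \<phi> \<longleftrightarrow>
     continuous_map (closed_disc (d e)) X \<phi> \<and>
     homeomorphic_map (open_disc (d e)) (subtopology X e) \<phi> \<and>
     \<phi> ` (topspace (closed_disc (d e)) - topspace (open_disc (d e))) \<subseteq> \<Union>{e' \<in> \<E>. d e' < d e}"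

definition cw_complex :: "'a topology \<Rightarrow> 'a set set \<Rightarrow> ('a set \<Rightarrow> nat) \<Rightarrow> bool" where
  "cw_complex X \<E> d \<longleftrightarrow>
     Hausdorff_space X \<and>
     pairwise disjnt \<E> \<and> \<Union>\<E> = topspace X \<and>
     (\<forall>e\<in>\<E>. \<exists>\<phi>. characteristic_map X \<E> d e \<phi>) \<and>
     (\<forall>e\<in>\<E>. \<exists>\<F>\<subseteq>\<E>. finite \<F> \<and> X closure_of e \<subseteq> \<Union>\<F>) \<and>
     (\<forall>C\<subseteq>topspace X. (\<forall>e\<in>\<E>. closedin X (C \<inter> X closure_of e)) \<longrightarrow> closedin X C)"

text \<open>
  Non-degeneracy of the basepoint: \<open>(X, {x\<^sub>0})\<close> is an NDR pair in the sense of Steenrod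
  (equivalently, \<open>{x\<^sub>0}\<close> is closed and its inclusion into \<open>X\<close> is a cofibration).
\<close>

definition nondegenerate_basepoint :: "'a topology \<Rightarrow> 'a \<Rightarrow> bool" where
  "nondegenerate_basepoint X x\<^sub>0 \<longleftrightarrow>
     x\<^sub>0 \<in> topspace X \<and>
     (\<exists>u h. continuous_map X (top_of_set {0..1::real}) u \<and>
            continuous_map (prod_topology (top_of_set {0..1::real}) X) X h \<and>
            {x \<in> topspace X. u x = 0} = {x\<^sub>0} \<and>
            (\<forall>x\<in>topspace X. h (0, x) = x) \<and>
            (\<forall>t\<in>{0..1}. h (t, x\<^sub>0) = x\<^sub>0) \<and>
            (\<forall>x\<in>topspace X. u x < 1 \<longrightarrow> h (1, x) = x\<^sub>0))"


section \<open>Based maps and based homotopy\<close>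

definition based_map :: "'a topology \<Rightarrow> 'a \<Rightarrow> 'b topology \<Rightarrow> 'b \<Rightarrow> ('a \<Rightarrow> 'b) \<Rightarrow> bool" where
  "based_map X x\<^sub>0 Y y\<^sub>0 f \<longleftrightarrow> continuous_map X Y f \<and> f x\<^sub>0 = y\<^sub>0"

definition based_homotopic ::
    "'a topology \<Rightarrow> 'a \<Rightarrow> 'b topology \<Rightarrow> 'b \<Rightarrow> ('a \<Rightarrow> 'b) \<Rightarrow> ('a \<Rightarrow> 'b) \<Rightarrow> bool" where
  "based_homotopic X x\<^sub>0 Y y\<^sub>0 f g \<longleftrightarrow> homotopic_with (\<lambda>k. k x\<^sub>0 = y\<^sub>0) X Y f g"

definition based_homotopy_equivalent ::
    "'a topology \<Rightarrow> 'a \<Rightarrow> 'b topology \<Rightarrow> 'b \<Rightarrow> bool" where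
  "based_homotopy_equivalent X x\<^sub>0 Y y\<^sub>0 \<longleftrightarrow>
     (\<exists>h k. based_map X x\<^sub>0 Y y\<^sub>0 h \<and> based_map Y y\<^sub>0 X x\<^sub>0 k \<and>
            based_homotopic X x\<^sub>0 X x\<^sub>0 (k \<circ> h) id \<and>
            based_homotopic Y y\<^sub>0 Y y\<^sub>0 (h \<circ> k) id)"

text \<open>
  Fibre-homotopy equivalence of \<open>p\<^sub>1 : E\<^sub>1 \<rightarrow> B\<close> and \<open>p\<^sub>2 : E\<^sub>2 \<rightarrow> B\<close> by based maps and based homotopies
  over \<open>B\<close>; the relation is intended for fibrations but makes sense for arbitrary maps.
\<close>

definition fibre_homotopy_equivalent ::
    "'b topology \<Rightarrow> 'e topology \<Rightarrow> 'e \<Rightarrow> ('e \<Rightarrow> 'b) \<Rightarrow> 'f topology \<Rightarrow> 'f \<Rightarrow> ('f \<Rightarrow> 'b) \<Rightarrow> bool" where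
  "fibre_homotopy_equivalent B E\<^sub>1 e\<^sub>1 p\<^sub>1 E\<^sub>2 e\<^sub>2 p\<^sub>2 \<longleftrightarrow>
     continuous_map E\<^sub>1 B p\<^sub>1 \<and> continuous_map E\<^sub>2 B p\<^sub>2 \<and>
     (\<exists>h k. based_map E\<^sub>1 e\<^sub>1 E\<^sub>2 e\<^sub>2 h \<and> based_map E\<^sub>2 e\<^sub>2 E\<^sub>1 e\<^sub>1 k \<and>
            (\<forall>x\<in>topspace E\<^sub>1. p\<^sub>2 (h x) = p\<^sub>1 x) \<and>
            (\<forall>y\<in>topspace E\<^sub>2. p\<^sub>1 (k y) = p\<^sub>2 y) \<and>
            homotopic_with (\<lambda>F. F e\<^sub>1 = e\<^sub>1 \<and> (\<forall>x\<in>topspace E\<^sub>1. p\<^sub>1 (F x) = p\<^sub>1 x)) E\<^sub>1 E\<^sub>1 (k \<circ> h) id \<and>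
            homotopic_with (\<lambda>H. H e\<^sub>2 = e\<^sub>2 \<and> (\<forall>y\<in>topspace E\<^sub>2. p\<^sub>2 (H y) = p\<^sub>2 y)) E\<^sub>2 E\<^sub>2 (h \<circ> k) id)"


section \<open>Mapping spaces\<close>

text \<open>
  A point of the mapping space is a continuous map, made \<open>undefined\<close> off \<open>topspace X\<close> so that
  functions agreeing on \<open>X\<close> are the same point.
\<close>

definition continuous_maps :: "'a topology \<Rightarrow> 'b topology \<Rightarrow> ('a \<Rightarrow> 'b) set" where
  "continuous_maps X Y = {f \<in> extensional (topspace X). continuous_map X Y f}"

definition compact_open_topology :: "'a topology \<Rightarrow> 'b topology \<Rightarrow> ('a \<Rightarrow> 'b) topology" where
  "compact_open_topology X Y =
     topology_generated_by
       {{f \<in> continuous_maps X Y. f ` K \<subseteq> U} | K U. compactin X K \<and> openin Y U}"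

lemma topspace_compact_open_topology: "topspace (compact_open_topology X Y) = continuous_maps X Y"
proof -
  have "continuous_maps X Y \<in>
      {{f \<in> continuous_maps X Y. f ` K \<subseteq> U} | K U. compactin X K \<and> openin Y U}"
    by (rule CollectI, rule exI[of _ "{}"], rule exI[of _ "{}"]) auto
  then show ?thesis
    unfolding compact_open_topology_def topology_generated_by_topspace by blast
qed

definition map_component :: "'a topology \<Rightarrow> 'b topology \<Rightarrow> ('a \<Rightarrow> 'b) \<Rightarrow> ('a \<Rightarrow> 'b) topology" where
  "map_component X Y f =
     subtopology (compact_open_topology X Y) (path_component_of_set (compact_open_topology X Y) f)"


section \<open>Group-like spaces and their actions\<close>

text \<open>
  The wedge \<open>G \<or> G\<close> is the union of the two axes in \<open>G \<times> G\<close>. The canonical map \<open>J\<close> from the one-point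
  union of two copies of \<open>G\<close> is a homeomorphism onto that subspace, so \<open>J\<close> becomes the inclusion.
\<close>

definition wedge :: "'g topology \<Rightarrow> 'g \<Rightarrow> ('g \<times> 'g) topology" where
  "wedge G e = subtopology (prod_topology G G) {(a, b). a = e \<or> b = e}"

definition folding_map :: "'g \<Rightarrow> 'g \<times> 'g \<Rightarrow> 'g" where
  "folding_map e = (\<lambda>(a, b). if b = e then a else b)"

definition H_space :: "'g topology \<Rightarrow> 'g \<Rightarrow> ('g \<times> 'g \<Rightarrow> 'g) \<Rightarrow> bool" where
  "H_space G e m \<longleftrightarrow>
     e \<in> topspace G \<and>
     based_map (prod_topology G G) (e, e) G e m \<and>
     based_homotopic (wedge G e) (e, e) G e m (folding_map e)"

definition homotopy_associative :: "'g topology \<Rightarrow> 'g \<Rightarrow> ('g \<times> 'g \<Rightarrow> 'g) \<Rightarrow> bool" where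
  "homotopy_associative G e m \<longleftrightarrow>
     based_homotopic (prod_topology G (prod_topology G G)) (e, e, e) G e
       (\<lambda>(a, b, c). m (m (a, b), c)) (\<lambda>(a, b, c). m (a, m (b, c)))"

definition group_like_space ::
    "'g topology \<Rightarrow> 'g \<Rightarrow> ('g \<times> 'g \<Rightarrow> 'g) \<Rightarrow> ('g \<Rightarrow> 'g) \<Rightarrow> bool" where
  "group_like_space G e m \<iota> \<longleftrightarrow>
     H_space G e m \<and> homotopy_associative G e m \<and>
     based_map G e G e \<iota> \<and>
     based_homotopic G e G e (\<lambda>g. m (\<iota> g, g)) (\<lambda>g. e) \<and>
     based_homotopic G e G e (\<lambda>g. m (g, \<iota> g)) (\<lambda>g. e)"

definition homotopy_associative_action ::
    "'g topology \<Rightarrow> 'g \<Rightarrow> ('g \<times> 'g \<Rightarrow> 'g) \<Rightarrow> 'y topology \<Rightarrow> 'y \<Rightarrow> ('g \<times> 'y \<Rightarrow> 'y) \<Rightarrow> bool" where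
  "homotopy_associative_action G e m Y y\<^sub>0 A \<longleftrightarrow>
     based_map (prod_topology G Y) (e, y\<^sub>0) Y y\<^sub>0 A \<and>
     based_homotopic Y y\<^sub>0 Y y\<^sub>0 (\<lambda>y. A (e, y)) id \<and>
     based_homotopic (prod_topology G (prod_topology G Y)) (e, e, y\<^sub>0) Y y\<^sub>0
       (\<lambda>(a, b, y). A (a, A (b, y))) (\<lambda>(a, b, y). A (m (a, b), y))"

definition strictly_unital :: "'g \<Rightarrow> 'y topology \<Rightarrow> ('g \<times> 'y \<Rightarrow> 'y) \<Rightarrow> bool" where
  "strictly_unital e Y A \<longleftrightarrow> (\<forall>y\<in>topspace Y. A (e, y) = y)"

definition translate_map ::
    "'x topology \<Rightarrow> ('g \<times> 'y \<Rightarrow> 'y) \<Rightarrow> ('x \<Rightarrow> 'g) \<Rightarrow> ('x \<Rightarrow> 'y) \<Rightarrow> 'x \<Rightarrow> 'y" where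
  "translate_map X A \<gamma> f = (\<lambda>x\<in>topspace X. A (\<gamma> x, f x))"

end

theory Submission
  imports Defs
begin

text \<open>
  The maps \<open>\<phi> (x, y) = \<gamma>(x) \<cdot> y\<close> and \<open>\<psi> (x, y) = \<gamma>(x)\<^sup>-\<^sup>1 \<cdot> y\<close> are inverse to each other up to a homotopy of
  maps \<open>X \<times> Y \<rightarrow> Y\<close>, and such maps act on \<open>map(X, Y)\<close> by \<open>h \<mapsto> (x \<mapsto> \<phi> (x, h x))\<close>; this gives (A). The based
  and the fibrewise statement amount to correcting \<open>\<psi>\<close> and the homotopies so that they respect a
  subspace \<open>C\<close> of \<open>X \<times> Y\<close>: the graph of \<open>f\<close> for (B), and the union of this graph with \<open>{x\<^sub>0} \<times> Y\<close> for (C).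
  As in Dold's theorem, this is possible when \<open>C \<subseteq> X \<times> Y\<close> is a cofibration. That the graph is a
  cofibration follows from the local equiconnectivity of \<open>Y\<close>: for a finite complex the diagonal is a
  cofibration by induction over the cells, and \<open>f\<close> maps the compact space \<open>X\<close> into a finite subcomplex,
  whose inclusion into the countable complex \<open>Y\<close> is a cofibration.
\<close>

section \<open>NDR pairs and homotopy extension\<close>

text \<open>Under \<open>\<psi>\<close> the translate of \<open>f\<close> returns only to a map
  homotopic to \<open>f\<close>, and the homotopies of the action move \<open>f\<close> as well. So
  \<open>\<psi>\<close> has to be replaced by a map that on the translated subspace is a prescribed
  strict inverse of \<open>\<phi>\<close>, with homotopies stationary on the subspaces. All this is
  done for maps over \<open>X\<close>, because a map \<open>(x, y) \<mapsto> (x, a (x, y))\<close>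
  acts pointwise on functions: function spaces enter only at the very end, through a continuity
  statement for Hausdorff \<open>X\<close>, and no exponential law is invoked. For (C) the subspace
  contains the fibre over the basepoint because homotopies stationary there preserve evaluation. For
  (A) the subspace is empty, and neither compactness nor cofibrations enter. Only a finite
  subcomplex of \<open>Y\<close> is paired with itself in the diagonal argument. Thus no product of
  two infinite complexes has to carry a weak topology; only the product with the interval
  does.\<close>

abbreviation I01 :: "real topology" where
  "I01 \<equiv> top_of_set {0..1}"

section \<open>Tube lemma, reparametrised homotopies and homotopy extension\<close>

lemma compact_space_I01: "compact_space I01"
  by (simp add: compact_space_subtopology)

lemma continuous_map_comp:
  "continuous_map X Y f \<Longrightarrow> continuous_map Y Z g \<Longrightarrow> continuous_map X Z (\<lambda>x. g (f x))"
  using continuous_map_compose[of X Y f Z g] by (simp add: o_def)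

text \<open>Projection along a compact factor is a closed map, and the complement of the set in
  question is the projection of a closed set. This is the tube lemma in the form used
  throughout.\<close>

lemma openin_forall_compact:
  assumes "compact_space K" and "openin (prod_topology K W) U"
  shows "openin W {w \<in> topspace W. \<forall>s\<in>topspace K. (s, w) \<in> U}"
proof -
  have "closedin W (snd ` (topspace (prod_topology K W) - U))"
    using closed_map_snd[OF assms(1)] closedin_diff[OF closedin_topspace assms(2)]
    unfolding closed_map_def by blast
  moreover have "{w \<in> topspace W. \<forall>s\<in>topspace K. (s, w) \<in> U}
      = topspace W - snd ` (topspace (prod_topology K W) - U)"
    by force
  ultimately show ?thesis by auto
qed

text \<open>
  The reparametrisation \<open>\<rho>\<close> may be discontinuous on the closed set \<open>S\<close>, as happens for a quotient
  of the form \<open>0/0\<close>: there \<open>\<Theta>\<close> does not depend on the parameter, and the tube lemma applies.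
\<close>

lemma continuous_map_reparametrise:
  assumes \<Theta>: "continuous_map (prod_topology I01 W) Y (\<lambda>p. \<Theta> (fst p) (snd p))"
    and \<rho>: "continuous_map (subtopology W (topspace W - S)) euclideanreal \<rho>"
    and S: "closedin W S"
    and \<rho>01: "\<And>w. w \<in> topspace W \<Longrightarrow> \<rho> w \<in> {0..1}"
    and const: "\<And>s w. s \<in> {0..1} \<Longrightarrow> w \<in> S \<Longrightarrow> \<Theta> s w = \<Theta> 0 w"
  shows "continuous_map W Y (\<lambda>w. \<Theta> (\<rho> w) w)"
  unfolding continuous_map_def
proof (intro conjI allI impI)
  show "(\<lambda>w. \<Theta> (\<rho> w) w) \<in> topspace W \<rightarrow> topspace Y"
    using continuous_map_funspace[OF \<Theta>] \<rho>01 by (force simp: Pi_iff)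
next
  fix V assume V: "openin Y V"
  define U where "U = {p \<in> topspace (prod_topology I01 W). \<Theta> (fst p) (snd p) \<in> V}"
  have "openin (prod_topology I01 W) U"
    unfolding U_def using \<Theta> V openin_continuous_map_preimage by fastforce
  then have 1: "openin W {w \<in> topspace W. \<forall>s\<in>topspace I01. (s, w) \<in> U}"
    by (rule openin_forall_compact[OF compact_space_I01])
  have "continuous_map (subtopology W (topspace W - S)) (prod_topology I01 W) (\<lambda>w. (\<rho> w, w))"
    using \<rho> \<rho>01 by (auto simp: continuous_map_paired continuous_map_in_subtopology)
  then have "continuous_map (subtopology W (topspace W - S)) Y (\<lambda>w. \<Theta> (\<rho> w) w)"
    using continuous_map_comp[OF _ \<Theta>] by fastforce
  then have "openin (subtopology W (topspace W - S))
      {w \<in> topspace (subtopology W (topspace W - S)). \<Theta> (\<rho> w) w \<in> V}"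
    using V openin_continuous_map_preimage by blast
  then have 2: "openin W {w \<in> topspace (subtopology W (topspace W - S)). \<Theta> (\<rho> w) w \<in> V}"
    by (rule openin_trans_full[OF _ openin_diff[OF openin_topspace S]])
  have "{w \<in> topspace W. \<Theta> (\<rho> w) w \<in> V} = {w \<in> topspace W. \<forall>s\<in>topspace I01. (s, w) \<in> U}
      \<union> {w \<in> topspace (subtopology W (topspace W - S)). \<Theta> (\<rho> w) w \<in> V}"
    (is "?L = ?A \<union> ?B")
  proof -
    have "?A \<subseteq> ?L" using \<rho>01 by (auto simp: U_def)
    moreover have "w \<in> ?A" if "w \<in> ?L" "w \<in> S" for w
    proof -
      have "\<Theta> s w = \<Theta> (\<rho> w) w" if "s \<in> {0..1}" for s
        using const[OF that \<open>w \<in> S\<close>] const[OF \<rho>01 \<open>w \<in> S\<close>] \<open>w \<in> ?L\<close> by simp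
      then show ?thesis using \<open>w \<in> ?L\<close> by (auto simp: U_def)
    qed
    ultimately show ?thesis by auto
  qed
  then show "openin W {w \<in> topspace W. \<Theta> (\<rho> w) w \<in> V}"
    using 1 2 by auto
qed

text \<open>Homotopy extension quantifies over target spaces of every type, whereas the data
  \<open>v\<close> and \<open>D\<close> live on \<open>Z\<close> alone. Hence a cofibration is
  encoded by the latter, and homotopy extension is derived from it.\<close>

definition ndr_pair :: "'a topology \<Rightarrow> 'a set \<Rightarrow> bool" where
  "ndr_pair Z C \<longleftrightarrow>
     (\<exists>v D. continuous_map Z I01 v \<and> continuous_map (prod_topology I01 Z) Z D \<and>
            C = {z \<in> topspace Z. v z = 0} \<and>
            (\<forall>z\<in>topspace Z. D (0, z) = z) \<and>
            (\<forall>t\<in>{0..1}. \<forall>z\<in>C. D (t, z) = z) \<and>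
            (\<forall>z\<in>topspace Z. v z < 1 \<longrightarrow> D (1, z) \<in> C))"

lemma ndr_pairE:
  assumes "ndr_pair Z C"
  obtains v D where "continuous_map Z I01 v" and "continuous_map (prod_topology I01 Z) Z D"
    and "C = {z \<in> topspace Z. v z = 0}" and "\<And>z. z \<in> topspace Z \<Longrightarrow> D (0, z) = z"
    and "\<And>t z. t \<in> {0..1} \<Longrightarrow> z \<in> C \<Longrightarrow> D (t, z) = z"
    and "\<And>z. z \<in> topspace Z \<Longrightarrow> v z < 1 \<Longrightarrow> D (1, z) \<in> C"
  using assms unfolding ndr_pair_def by (elim exE conjE) blast

lemma nondegenerate_imp_ndr_pair: "nondegenerate_basepoint X x\<^sub>0 \<Longrightarrow> ndr_pair X {x\<^sub>0}"
  unfolding nondegenerate_basepoint_def ndr_pair_def by force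

lemma closedin_level: "continuous_map Z I01 v \<Longrightarrow> closedin Z {z \<in> topspace Z. v z = (c::real)}"
proof -
  assume "continuous_map Z I01 v"
  then have "continuous_map Z euclideanreal v" by (simp add: continuous_map_in_subtopology)
  from closedin_continuous_map_preimage[OF this, of "{c}"] show ?thesis by simp
qed

lemma ndr_pair_closedin: "ndr_pair Z C \<Longrightarrow> closedin Z C"
  unfolding ndr_pair_def using closedin_level by blast

lemma ndr_pair_subset: "ndr_pair Z C \<Longrightarrow> C \<subseteq> topspace Z"
  using ndr_pair_closedin closedin_subset by blast

lemma ndr_pair_prod:
  assumes "ndr_pair Z C"
  shows "ndr_pair (prod_topology W Z) (topspace W \<times> C)"
proof -
  obtain v D where v: "continuous_map Z I01 v" and D: "continuous_map (prod_topology I01 Z) Z D"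
    and C: "C = {z \<in> topspace Z. v z = 0}" and 0: "\<And>z. z \<in> topspace Z \<Longrightarrow> D (0, z) = z"
    and fix_C: "\<And>t z. t \<in> {0..1} \<Longrightarrow> z \<in> C \<Longrightarrow> D (t, z) = z"
    and 1: "\<And>z. z \<in> topspace Z \<Longrightarrow> v z < 1 \<Longrightarrow> D (1, z) \<in> C"
    by (rule ndr_pairE[OF assms]) (rule that; assumption)
  have "continuous_map (prod_topology W Z) I01 (\<lambda>p. v (snd p))"
    using continuous_map_comp[OF continuous_map_snd v] .
  moreover have "continuous_map (prod_topology I01 (prod_topology W Z)) (prod_topology W Z)
      (\<lambda>q. (fst (snd q), D (fst q, snd (snd q))))"
    by (rule continuous_map_pairedI[OF continuous_map_comp[OF continuous_map_snd continuous_map_fst]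
          continuous_map_comp[OF continuous_map_pairedI[OF continuous_map_fst
            continuous_map_comp[OF continuous_map_snd continuous_map_snd]] D]])
  ultimately show ?thesis
    unfolding ndr_pair_def
    by (intro exI[of _ "\<lambda>p. v (snd p)"] exI[of _ "\<lambda>q. (fst (snd q), D (fst q, snd (snd q)))"])
      (use 0 fix_C 1 in \<open>auto simp: C\<close>)
qed

text \<open>Over a point \<open>z\<close> the extension first flows along \<open>D\<close> towards
  \<open>C\<close> and then runs \<open>H\<close> from the endpoint \<open>D (1, z)\<close>;
  comparing \<open>t * u z / 2\<close> with \<open>v z\<close> decides which stage has been reached.
  The factor \<open>u\<close> freezes the clock where \<open>u\<close> vanishes, which the union
  theorem needs; the constant \<open>u = 1\<close> gives ordinary homotopy extension.\<close>

lemma ndr_pair_extension_rel: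
  assumes ndr: "ndr_pair Z C" and u: "continuous_map Z I01 u" and F: "continuous_map Z W F"
    and H: "continuous_map (prod_topology I01 (subtopology Z C)) W H"
    and H0: "\<And>c. c \<in> C \<Longrightarrow> H (0, c) = F c"
    and Hu: "\<And>t c. t \<in> {0..1} \<Longrightarrow> c \<in> C \<Longrightarrow> u c = 0 \<Longrightarrow> H (t, c) = F c"
  obtains K where "continuous_map (prod_topology I01 Z) W K"
    and "\<And>z. z \<in> topspace Z \<Longrightarrow> K (0, z) = F z"
    and "\<And>t c. t \<in> {0..1} \<Longrightarrow> c \<in> C \<Longrightarrow> K (t, c) = H (t, c)"
    and "\<And>t z. t \<in> {0..1} \<Longrightarrow> z \<in> topspace Z \<Longrightarrow> u z = 0 \<Longrightarrow> K (t, z) = F z"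
proof -
  obtain v D where v: "continuous_map Z I01 v" and D: "continuous_map (prod_topology I01 Z) Z D"
    and C: "C = {z \<in> topspace Z. v z = 0}" and D0: "\<And>z. z \<in> topspace Z \<Longrightarrow> D (0, z) = z"
    and DC: "\<And>t z. t \<in> {0..1} \<Longrightarrow> z \<in> C \<Longrightarrow> D (t, z) = z"
    and D1: "\<And>z. z \<in> topspace Z \<Longrightarrow> v z < 1 \<Longrightarrow> D (1, z) \<in> C"
    by (rule ndr_pairE[OF ndr]) (rule that; assumption)
  have u01: "u z \<in> {0..1}" and v01: "v z \<in> {0..1}" if "z \<in> topspace Z" for z
    using u v that by (auto simp: continuous_map_def)
  define T where "T = prod_topology I01 Z"
  \<comment> \<open>Dividing by 2 gives \<open>v z \<le> 1/2 < 1\<close> wherever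
    \<open>q \<le> p\<close>, so \<open>D (1, z)\<close> lies in \<open>C\<close> when
    \<open>H\<close> is applied. The clock of \<open>H\<close> is \<open>t - 2 * v z / u z\<close>,
    which is 0 on the interface \<open>p = q > 0\<close> and \<open>t\<close> on
    \<open>C\<close>.\<close>
  define p where "p = (\<lambda>x. fst x * u (snd x) / 2)"
  define q where "q = (\<lambda>x::real \<times> 'a. v (snd x))"
  have vr: "continuous_map Z euclideanreal v" and ur: "continuous_map Z euclideanreal u"
    using u v by (auto simp: continuous_map_in_subtopology)
  have fstT: "continuous_map T euclideanreal fst" and sndT: "continuous_map T Z snd"
    unfolding T_def using continuous_map_fst[of I01 Z] continuous_map_snd[of I01 Z]
    by (auto simp: continuous_map_in_subtopology)
  have uT: "continuous_map T euclideanreal (\<lambda>x. u (snd x))"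
    and qT: "continuous_map T euclideanreal q"
    unfolding q_def using continuous_map_comp[OF sndT ur] continuous_map_comp[OF sndT vr] by auto
  have pT: "continuous_map T euclideanreal p"
    unfolding p_def by (intro continuous_intros fstT uT) auto
  have T: "topspace T = {0..1} \<times> topspace Z" by (simp add: T_def)
  have p_bounds: "0 \<le> p x" "p x \<le> 1/2" "p x \<le> fst x" if "x \<in> topspace T" for x
  proof -
    have "0 \<le> fst x" "fst x \<le> 1" "0 \<le> u (snd x)" "u (snd x) \<le> 1"
      using that u01[of "snd x"] by (auto simp: T)
    moreover from this have "fst x * u (snd x) \<le> fst x * 1" "0 \<le> fst x * u (snd x)"
      by (auto intro: mult_left_le)
    ultimately show "0 \<le> p x" "p x \<le> 1/2" "p x \<le> fst x" by (auto simp: p_def)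
  qed
  have q_bounds: "0 \<le> q x" "q x \<le> 1" if "x \<in> topspace T" for x
    using that v01[of "snd x"] by (auto simp: T q_def)
  define K where "K = (\<lambda>x. if p x \<le> q x then F (D (p x / q x, snd x))
                         else H (fst x - q x / (u (snd x) / 2), D (1, snd x)))"
  have "continuous_map T W K"
    unfolding K_def
  proof (rule continuous_map_cases_le[OF pT qT])
    let ?P = "subtopology T {x \<in> topspace T. p x \<le> q x}"
    have DP: "continuous_map (prod_topology I01 ?P) Z (\<lambda>y. D (fst y, snd (snd y)))"
    proof -
      have "continuous_map (prod_topology I01 ?P) Z (\<lambda>y. snd (snd y))"
        using continuous_map_comp[OF continuous_map_snd continuous_map_from_subtopology[OF sndT]] .
      then have "continuous_map (prod_topology I01 ?P) (prod_topology I01 Z) (\<lambda>y. (fst y, snd (snd y)))"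
        using continuous_map_pairedI[OF continuous_map_fst] by blast
      from continuous_map_comp[OF this D] show ?thesis .
    qed
    show "continuous_map ?P W (\<lambda>x. F (D (p x / q x, snd x)))"
    proof (rule continuous_map_reparametrise[where S = "{x \<in> topspace ?P. q x = 0}"
          and \<Theta> = "\<lambda>s x. F (D (s, snd x))"])
      show "continuous_map (prod_topology I01 ?P) W (\<lambda>y. F (D (fst y, snd (snd y))))"
        by (rule continuous_map_comp[OF DP F])
      show "continuous_map (subtopology ?P (topspace ?P - {x \<in> topspace ?P. q x = 0})) euclideanreal
          (\<lambda>x. p x / q x)"
        by (intro continuous_map_real_divide continuous_map_from_subtopology pT qT) auto
      show "closedin ?P {x \<in> topspace ?P. q x = 0}"
        using closedin_continuous_map_preimage[OF continuous_map_from_subtopology[OF qT, of "{x \<in> topspace T. p x \<le> q x}"], of "{0}"]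
        by auto
      show "p x / q x \<in> {0..1}" if "x \<in> topspace ?P" for x
        using that p_bounds[of x] q_bounds[of x] by (auto simp: divide_le_eq_1)
      show "F (D (s, snd x)) = F (D (0, snd x))"
        if "s \<in> {0..1}" "x \<in> {x \<in> topspace ?P. q x = 0}" for s x
        using that DC[of _ "snd x"] by (auto simp: C q_def T)
    qed
  next
    let ?N = "subtopology T {x \<in> topspace T. q x \<le> p x}"
    have DN: "continuous_map (prod_topology I01 ?N) (prod_topology I01 (subtopology Z C))
        (\<lambda>y. (fst y, D (1, snd (snd y))))"
    proof (rule continuous_map_pairedI[OF continuous_map_fst], rule continuous_map_into_subtopology)
      have "continuous_map (prod_topology I01 ?N) (prod_topology I01 Z) (\<lambda>y. (1, snd (snd y)))"
        by (rule continuous_map_pairedI[OF _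
            continuous_map_comp[OF continuous_map_snd continuous_map_from_subtopology[OF sndT]]])
          (auto simp: continuous_map_const)
      from continuous_map_comp[OF this D]
      show "continuous_map (prod_topology I01 ?N) Z (\<lambda>y. D (1, snd (snd y)))" .
      show "(\<lambda>y. D (1, snd (snd y))) \<in> topspace (prod_topology I01 ?N) \<rightarrow> C"
      proof
        fix y assume "y \<in> topspace (prod_topology I01 ?N)"
        then have "snd y \<in> topspace T" "q (snd y) \<le> p (snd y)" by auto
        then show "D (1, snd (snd y)) \<in> C"
          using p_bounds[of "snd y"] by (intro D1) (auto simp: T q_def)
      qed
    qed
    \<comment> \<open>Where \<open>u\<close> vanishes, \<open>q \<le> p = 0\<close> forces the point
      into \<open>C\<close>. There \<open>D (1, _)\<close> is the identity and \<open>H\<close> is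
      stationary by \<open>Hu\<close>, so the meaningless clock does no harm.\<close>
    show "continuous_map ?N W (\<lambda>x. H (fst x - q x / (u (snd x) / 2), D (1, snd x)))"
    proof (rule continuous_map_reparametrise[where S = "{x \<in> topspace ?N. u (snd x) = 0}"
          and \<Theta> = "\<lambda>s x. H (s, D (1, snd x))"])
      show "continuous_map (prod_topology I01 ?N) W (\<lambda>y. H (fst y, D (1, snd (snd y))))"
        using continuous_map_comp[OF DN H] .
      show "continuous_map (subtopology ?N (topspace ?N - {x \<in> topspace ?N. u (snd x) = 0}))
          euclideanreal (\<lambda>x. fst x - q x / (u (snd x) / 2))"
        by (intro continuous_intros continuous_map_from_subtopology fstT uT qT) auto
      show "closedin ?N {x \<in> topspace ?N. u (snd x) = 0}"
        using closedin_continuous_map_preimage[OF continuous_map_from_subtopology[OF uT, of "{x \<in> topspace T. q x \<le> p x}"], of "{0}"]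
        by auto
      show "fst x - q x / (u (snd x) / 2) \<in> {0..1}" if "x \<in> topspace ?N" for x
      proof -
        have x: "x \<in> topspace T" "q x \<le> p x" using that by auto
        then have "0 \<le> u (snd x)" "0 \<le> fst x" "fst x \<le> 1" using u01[of "snd x"] by (auto simp: T)
        then have "0 \<le> q x / (u (snd x) / 2)" "q x / (u (snd x) / 2) \<le> fst x"
          using x(2) q_bounds[OF x(1)]
          by (cases "u (snd x) = 0"; simp add: p_def pos_divide_le_eq less_le)+
        then show ?thesis using \<open>fst x \<le> 1\<close> by auto
      qed
      show "H (s, D (1, snd x)) = H (0, D (1, snd x))"
        if s: "s \<in> {0..1}" and x: "x \<in> {x \<in> topspace ?N. u (snd x) = 0}" for s x
      proof -
        have "q x \<le> 0" "0 \<le> q x" using x q_bounds[of x] by (auto simp: p_def)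
        then have "snd x \<in> C" using x by (auto simp: C q_def T)
        moreover have "D (1, snd x) = snd x" using calculation DC by auto
        ultimately show ?thesis using Hu[OF s] H0 x by auto
      qed
    qed
  next
    \<comment> \<open>If \<open>q = 0\<close>, the quotient 0/0 counts as 0, and
      \<open>p = 0\<close> means that \<open>t\<close> or \<open>u\<close> is 0; both formulas then
      give \<open>F (snd x)\<close>.\<close>
    fix x assume x: "x \<in> topspace T" "p x = q x"
    show "F (D (p x / q x, snd x)) = H (fst x - q x / (u (snd x) / 2), D (1, snd x))"
    proof (cases "q x = 0")
      case True
      then have c: "snd x \<in> C" "fst x \<in> {0..1}" using x by (auto simp: C q_def T)
      then have "D (0, snd x) = snd x" "D (1, snd x) = snd x" using DC by auto
      moreover have "u (snd x) = 0 \<or> fst x = 0" using True x by (auto simp: p_def)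
      then have "H (fst x, snd x) = F (snd x)"
        using Hu[OF c(2,1)] H0[OF c(1)] by (elim disjE) (simp_all del: prod.collapse)
      ultimately show ?thesis using True x by simp
    next
      case False
      then have "D (1, snd x) \<in> C" using x p_bounds[of x] by (intro D1) (auto simp: T q_def)
      moreover have "fst x - q x / (u (snd x) / 2) = 0"
        using False x(2)[symmetric] by (auto simp: p_def)
      ultimately show ?thesis using False x H0 by simp
    qed
  qed
  moreover have "K (0, z) = F z" if "z \<in> topspace Z" for z
    using that v01[of z] D0 by (auto simp: K_def p_def q_def)
  moreover have "K (t, c) = H (t, c)" if t: "t \<in> {0..1}" and c: "c \<in> C" for t c
  proof -
    have c': "c \<in> topspace Z" "v c = 0" using c by (auto simp: C)
    show ?thesis
    proof (cases "t * u c = 0")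
      case True
      then have "H (t, c) = F c" using t c H0 Hu by auto
      then show ?thesis using True c' D0 by (auto simp: K_def p_def q_def)
    next
      case False
      then have "t * u c > 0" using t u01[OF c'(1)] by (simp add: less_le)
      then show ?thesis using c' c DC by (simp add: K_def p_def q_def)
    qed
  qed
  moreover have "K (t, z) = F z" if "t \<in> {0..1}" "z \<in> topspace Z" "u z = 0" for t z
    using that v01[of z] D0 by (auto simp: K_def p_def q_def)
  ultimately show ?thesis using that unfolding T_def by blast
qed

lemma ndr_pair_extension:
  assumes "ndr_pair Z C" and "continuous_map Z W F"
    and "continuous_map (prod_topology I01 (subtopology Z C)) W H"
    and "\<And>c. c \<in> C \<Longrightarrow> H (0, c) = F c"
  obtains K where "continuous_map (prod_topology I01 Z) W K"
    and "\<And>z. z \<in> topspace Z \<Longrightarrow> K (0, z) = F z"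
    and "\<And>t c. t \<in> {0..1} \<Longrightarrow> c \<in> C \<Longrightarrow> K (t, c) = H (t, c)"
  by (rule ndr_pair_extension_rel[OF assms(1) _ assms(2-4), of "\<lambda>_. 1"])
    (auto simp: continuous_map_const)

section \<open>NDR pairs from retractions of the cylinder\<close>

lemma continuous_map_ident: "continuous_map X X (\<lambda>x. x)"
  using continuous_map_id[of X] by (simp add: id_def)

lemma continuous_map_prod_section:
  assumes "continuous_map (prod_topology W Z) Y f" and "z \<in> topspace Z"
  shows "continuous_map W Y (\<lambda>t. f (t, z))"
  using continuous_map_comp[OF continuous_map_pairedI[OF continuous_map_ident] assms(1)] assms(2)
  by (simp add: continuous_map_const)

lemma continuous_map_prod_section':
  assumes "continuous_map (prod_topology W Z) Y f" and "w \<in> topspace W"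
  shows "continuous_map Z Y (\<lambda>z. f (w, z))"
  using continuous_map_comp[OF continuous_map_pairedI[OF _ continuous_map_ident] assms(1)] assms(2)
  by (simp add: continuous_map_const)

text \<open>Lower semicontinuity holds because a supremum exceeds a bound as soon as one member
  does; upper semicontinuity is the tube lemma, the supremum being attained on the compact
  interval.\<close>

lemma continuous_map_SUP_I01:
  assumes f: "continuous_map (prod_topology I01 Z) euclideanreal f"
  shows "continuous_map Z euclideanreal (\<lambda>z. SUP t\<in>{0..1}. f (t, z))"
    and "\<And>z t. z \<in> topspace Z \<Longrightarrow> t \<in> {0..1} \<Longrightarrow> f (t, z) \<le> (SUP t\<in>{0..1}. f (t, z))"
    and "\<And>z. z \<in> topspace Z \<Longrightarrow> \<exists>t\<in>{0..1}. (SUP t\<in>{0..1}. f (t, z)) = f (t, z)"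
proof -
  define s where "s z = (SUP t\<in>{0..1}. f (t, z))" for z
  have att: "\<exists>t\<in>{0..1}. s z = f (t, z) \<and> (\<forall>t'\<in>{0..1}. f (t', z) \<le> f (t, z))"
    if z: "z \<in> topspace Z" for z
  proof -
    have "continuous_on {0..1} (\<lambda>t. f (t, z))"
      using continuous_map_prod_section[OF f z] by simp
    then obtain t where t: "t \<in> {0..1}" "\<forall>t'\<in>{0..1}. f (t', z) \<le> f (t, z)"
      using continuous_attains_sup[of "{0..1::real}" "\<lambda>t. f (t, z)"] by auto
    then have "s z = f (t, z)"
      unfolding s_def by (intro cSup_eq_maximum) auto
    with t show ?thesis by blast
  qed
  have "openin Z {z \<in> topspace Z. s z > a}" for a
  proof -
    have "{z \<in> topspace Z. s z > a} = (\<Union>t\<in>{0..1}. {z \<in> topspace Z. f (t, z) \<in> {a<..}})"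
      using att by force
    moreover have "openin Z {z \<in> topspace Z. f (t, z) \<in> {a<..}}" if "t \<in> {0..1}" for t
      using openin_continuous_map_preimage[OF continuous_map_prod_section'[OF f], of t "{a<..}"] that
      by auto
    ultimately show ?thesis by auto
  qed
  moreover have "openin Z {z \<in> topspace Z. s z < a}" for a
  proof -
    have "openin (prod_topology I01 Z) {p \<in> topspace (prod_topology I01 Z). f p \<in> {..<a}}"
      using openin_continuous_map_preimage[OF f, of "{..<a}"] by auto
    from openin_forall_compact[OF compact_space_I01 this]
    have "openin Z {z \<in> topspace Z. \<forall>t\<in>{0..1}. f (t, z) < a}"
      by (rule back_subst[where P = "openin Z"]) auto
    moreover have "{z \<in> topspace Z. \<forall>t\<in>{0..1}. f (t, z) < a} = {z \<in> topspace Z. s z < a}"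
      using att by (smt (verit) Collect_cong)
    ultimately show ?thesis by simp
  qed
  ultimately show "continuous_map Z euclideanreal (\<lambda>z. SUP t\<in>{0..1}. f (t, z))"
    unfolding s_def[symmetric] continuous_map_upper_lower_semicontinuous_lt by blast
  show "f (t, z) \<le> (SUP t\<in>{0..1}. f (t, z))" if "z \<in> topspace Z" "t \<in> {0..1}" for z t
    using att[OF that(1)] that(2) unfolding s_def by force
  show "\<exists>t\<in>{0..1}. (SUP t\<in>{0..1}. f (t, z)) = f (t, z)" if "z \<in> topspace Z" for z
    using att[OF that] unfolding s_def by blast
qed

text \<open>The bottom and the side of the cylinder, as a subspace. As a target it is universal:
  extending the tautological data into it is a retraction of the cylinder, and from such a
  retraction the NDR data can be read off.\<close>

definition extension_domain :: "'a topology \<Rightarrow> 'a set \<Rightarrow> (real \<times> 'a) topology" where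
  "extension_domain Z C = subtopology (prod_topology I01 Z) ({0} \<times> UNIV \<union> UNIV \<times> C)"

lemma continuous_map_extension_domain_bottom:
  "continuous_map Z (extension_domain Z C) (\<lambda>z. (0, z))"
  unfolding extension_domain_def
  by (rule continuous_map_into_subtopology[OF continuous_map_pairedI[OF _ continuous_map_ident]])
    (auto simp: continuous_map_const)

lemma continuous_map_extension_domain_side:
  assumes "C' \<subseteq> C"
  shows "continuous_map (prod_topology I01 (subtopology Z C')) (extension_domain Z C) (\<lambda>p. p)"
  unfolding extension_domain_def
  by (rule continuous_map_into_subtopology)
    (use assms in \<open>auto simp: prod_topology_subtopology intro: continuous_map_from_subtopology\<close>)

text \<open>Strom's construction: \<open>v z\<close> is the largest deviation of the time coordinate
  of \<open>K (t, z)\<close> from \<open>t\<close>, and the deformation is the space coordinate of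
  \<open>K\<close>. If \<open>v z = 0\<close>, then \<open>K (t, z)\<close> has positive time for
  \<open>t > 0\<close>, so its space coordinate is in \<open>C\<close>; letting \<open>t\<close>
  tend to 0, closedness of \<open>C\<close> puts \<open>z\<close> there too. If
  \<open>v z < 1\<close>, the time coordinate at \<open>t = 1\<close> is not 0, so the deformation
  ends in \<open>C\<close>.\<close>

lemma retraction_imp_ndr_pair:
  assumes C: "closedin Z C"
    and K: "continuous_map (prod_topology I01 Z) (extension_domain Z C) K"
    and K0: "\<And>z. z \<in> topspace Z \<Longrightarrow> K (0, z) = (0, z)"
    and KC: "\<And>t c. t \<in> {0..1} \<Longrightarrow> c \<in> C \<Longrightarrow> K (t, c) = (t, c)"
  shows "ndr_pair Z C"
proof -
  have K': "continuous_map (prod_topology I01 Z) (prod_topology I01 Z) K"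
    using K unfolding extension_domain_def continuous_map_in_subtopology by blast
  have Kim: "K p \<in> {0} \<times> UNIV \<union> UNIV \<times> C" if "p \<in> topspace (prod_topology I01 Z)" for p
    using K that unfolding extension_domain_def continuous_map_in_subtopology by blast
  have sndK: "continuous_map (prod_topology I01 Z) Z (\<lambda>p. snd (K p))"
    using continuous_map_comp[OF K' continuous_map_snd] .
  have fstK: "continuous_map (prod_topology I01 Z) I01 (\<lambda>p. fst (K p))"
    using continuous_map_comp[OF K' continuous_map_fst] .
  then have fstK01: "fst (K (t, z)) \<in> {0..1}" if "t \<in> {0..1}" "z \<in> topspace Z" for t z
    using that by (auto simp: continuous_map_def Pi_iff)
  define f where "f = (\<lambda>p. \<bar>fst p - fst (K p)\<bar>)"
  have f: "continuous_map (prod_topology I01 Z) euclideanreal f"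
  proof -
    have "continuous_map (prod_topology I01 Z) euclideanreal fst"
      "continuous_map (prod_topology I01 Z) euclideanreal (\<lambda>p. fst (K p))"
      using continuous_map_fst[of I01 Z] fstK by (auto simp: continuous_map_in_subtopology)
    then show ?thesis unfolding f_def by (intro continuous_map_real_abs continuous_map_diff)
  qed
  define v where "v = (\<lambda>z. SUP t\<in>{0..1}. f (t, z))"
  note v = continuous_map_SUP_I01[OF f, folded v_def]
  have v01: "v z \<in> {0..1}" if z: "z \<in> topspace Z" for z
  proof -
    obtain t where t: "t \<in> {0..1}" "v z = f (t, z)" using v(3)[OF z] unfolding v_def by blast
    then show ?thesis using fstK01[OF t(1) z] by (auto simp: f_def)
  qed
  have "z \<in> C" if z: "z \<in> topspace Z" and "v z = 0" for z
  proof -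
    have "snd (K (t, z)) \<in> C" if "t \<in> {0<..1}" for t
    proof -
      have "f (t, z) \<le> 0" using v(2)[OF z, of t] that \<open>v z = 0\<close> by (simp add: v_def)
      then have "fst (K (t, z)) = t" by (simp add: f_def)
      then show ?thesis using Kim[of "(t, z)"] z that by (cases "K (t, z)") auto
    qed
    moreover have "closedin I01 {t \<in> topspace I01. snd (K (t, z)) \<in> C}"
      using closedin_continuous_map_preimage[OF continuous_map_prod_section[OF sndK z] C] .
    then have "closed {t \<in> {0..1}. snd (K (t, z)) \<in> C}"
      by (simp add: closedin_closed_eq)
    ultimately have "closure {0<..1} \<subseteq> {t \<in> {0..1}. snd (K (t, z)) \<in> C}"
      by (intro closure_minimal) auto
    then have "0 \<in> {t \<in> {0..1}. snd (K (t, z)) \<in> C}" by (rule subsetD) simp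
    then have "snd (K (0, z)) \<in> C" by simp
    then show ?thesis using K0[OF z] by simp
  qed
  moreover have "v z = 0" if z: "z \<in> C" for z
  proof -
    obtain t where "t \<in> {0..1}" "v z = f (t, z)"
      using v(3)[of z] z closedin_subset[OF C] unfolding v_def by blast
    then show ?thesis using KC[OF _ z] by (simp add: f_def)
  qed
  ultimately have C_eq: "C = {z \<in> topspace Z. v z = 0}" using closedin_subset[OF C] by blast
  have "snd (K (1, z)) \<in> C" if z: "z \<in> topspace Z" and "v z < 1" for z
  proof -
    have "f (1, z) < 1" using v(2)[OF z, of 1] that by (simp add: v_def)
    then have "fst (K (1, z)) \<noteq> 0" by (auto simp: f_def)
    then show ?thesis using Kim[of "(1, z)"] z by (cases "K (1, z)") auto
  qed
  moreover have "continuous_map Z I01 v"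
    using v(1) v01 by (auto simp: v_def continuous_map_in_subtopology)
  ultimately show ?thesis
    unfolding ndr_pair_def
    by (intro exI[of _ v] exI[of _ "\<lambda>p. snd (K p)"] conjI sndK C_eq)
      (auto simp: K0 KC)
qed

text \<open>The tautological homotopy of \<open>C\<close> is extended first over \<open>B\<close>
  and then over \<open>Z\<close>; the result is a retraction of the cylinder, so the two sets of NDR
  data never have to be merged by formulas.\<close>

lemma ndr_pair_trans:
  assumes B: "ndr_pair Z B" and C: "ndr_pair (subtopology Z B) C"
  shows "ndr_pair Z C"
proof -
  have CB: "C \<subseteq> B" using ndr_pair_subset[OF C] by auto
  have cl: "closedin Z C"
    using ndr_pair_closedin[OF C] ndr_pair_closedin[OF B] closedin_trans_full by blast
  have "continuous_map (subtopology Z B) (extension_domain Z C) (\<lambda>z. (0, z))"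
    by (rule continuous_map_from_subtopology[OF continuous_map_extension_domain_bottom])
  moreover have "continuous_map (prod_topology I01 (subtopology (subtopology Z B) C))
      (extension_domain Z C) (\<lambda>p. p)"
    using continuous_map_extension_domain_side[of "B \<inter> C" C Z] by (simp add: subtopology_subtopology)
  ultimately obtain K where K: "continuous_map (prod_topology I01 (subtopology Z B)) (extension_domain Z C) K"
    "\<And>z. z \<in> topspace (subtopology Z B) \<Longrightarrow> K (0, z) = (0, z)"
    "\<And>t c. t \<in> {0..1} \<Longrightarrow> c \<in> C \<Longrightarrow> K (t, c) = (t, c)"
    using ndr_pair_extension[OF C] by (metis (no_types, lifting))
  obtain L where L: "continuous_map (prod_topology I01 Z) (extension_domain Z C) L"
    "\<And>z. z \<in> topspace Z \<Longrightarrow> L (0, z) = (0, z)"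
    "\<And>t c. t \<in> {0..1} \<Longrightarrow> c \<in> B \<Longrightarrow> L (t, c) = K (t, c)"
    by (rule ndr_pair_extension[OF B continuous_map_extension_domain_bottom K(1)])
      (use K(2) ndr_pair_subset[OF B] in auto)
  show ?thesis
    by (rule retraction_imp_ndr_pair[OF cl L(1,2)]) (use L(3) K(3) CB in auto)
qed

section \<open>Gluing and unions of NDR pairs\<close>

lemma continuous_map_paste_closed:
  assumes q: "closed_map D Z q" and C: "closedin Z C" and cover: "topspace Z = C \<union> q ` topspace D"
    and hq: "continuous_map D Y (\<lambda>d. h (q d))" and hC: "continuous_map (subtopology Z C) Y h"
  shows "continuous_map Z Y h"
  unfolding continuous_map_closedin
proof (intro conjI allI impI)
  show "h \<in> topspace Z \<rightarrow> topspace Y"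
    using hq hC cover closedin_subset[OF C] by (force simp: continuous_map_def Pi_iff)
next
  fix V assume V: "closedin Y V"
  have "closedin Z {z \<in> topspace (subtopology Z C). h z \<in> V}"
    using closedin_continuous_map_preimage[OF hC V] C closedin_trans_full by blast
  \<comment> \<open>Since \<open>q\<close> is closed, a preimage under \<open>h\<close> can be
    tested after pulling it back to \<open>D\<close>; no inverse of \<open>q\<close> has to be
    continuous.\<close>
  moreover have "closedin Z (q ` {d \<in> topspace D. h (q d) \<in> V})"
    using q closedin_continuous_map_preimage[OF hq V] by (auto simp: closed_map_def)
  moreover have "{z \<in> topspace Z. h z \<in> V} =
      {z \<in> topspace (subtopology Z C). h z \<in> V} \<union> q ` {d \<in> topspace D. h (q d) \<in> V}"
    using cover by auto
  ultimately show "closedin Z {z \<in> topspace Z. h z \<in> V}" by auto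
qed

text \<open>\<open>Z\<close> arises from \<open>C\<close> by gluing \<open>D\<close> along
  \<open>S\<close>. The NDR data of \<open>(D, S)\<close> descend through \<open>q\<close>, because
  on \<open>S\<close>, where \<open>q\<close> need not be injective, the function is 0 and the
  deformation is stationary. Compactness of \<open>D\<close> makes \<open>q\<close> and its product
  with the identity of the interval closed, which gives continuity. Cells, excision and graphs are
  all instances.\<close>

lemma ndr_pair_relative_homeomorphism:
  assumes D: "ndr_pair D S" and "compact_space D" and "Hausdorff_space Z"
    and q: "continuous_map D Z q" and C: "closedin Z C"
    and cover: "topspace Z \<subseteq> C \<union> q ` topspace D"
    and qS: "\<And>d. d \<in> topspace D \<Longrightarrow> q d \<in> C \<longleftrightarrow> d \<in> S"
    and inj: "inj_on q (topspace D - S)"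
  shows "ndr_pair Z C"
proof -
  obtain v E where v: "continuous_map D I01 v" and E: "continuous_map (prod_topology I01 D) D E"
    and S: "S = {d \<in> topspace D. v d = 0}" and E0: "\<And>d. d \<in> topspace D \<Longrightarrow> E (0, d) = d"
    and ES: "\<And>t d. t \<in> {0..1} \<Longrightarrow> d \<in> S \<Longrightarrow> E (t, d) = d"
    and E1: "\<And>d. d \<in> topspace D \<Longrightarrow> v d < 1 \<Longrightarrow> E (1, d) \<in> S"
    by (rule ndr_pairE[OF D]) (rule that; assumption)
  have qZ: "q d \<in> topspace Z" if "d \<in> topspace D" for d
    using continuous_map_funspace[OF q] that by (auto simp: Pi_iff)
  have cover: "topspace Z = C \<union> q ` topspace D"
    using cover qZ closedin_subset[OF C] by blast
  define g where "g = inv_into (topspace D - S) q"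
  have gq: "g (q d) = d" if "d \<in> topspace D" "d \<notin> S" for d
    using inv_into_f_f[OF inj] that by (simp add: g_def)
  define w where "w = (\<lambda>z. if z \<in> C then 0 else v (g z))"
  define G where "G = (\<lambda>p. if snd p \<in> C then snd p else q (E (fst p, g (snd p))))"
  have wq: "w (q d) = v d" if "d \<in> topspace D" for d
    using that qS[OF that] gq[OF that] by (auto simp: w_def S)
  have Gq: "G (t, q d) = q (E (t, d))" if "t \<in> {0..1}" "d \<in> topspace D" for t d
    using that qS[OF that(2)] gq[OF that(2)] by (auto simp: G_def ES)
  have ED: "E (t, d) \<in> topspace D" if "t \<in> {0..1}" "d \<in> topspace D" for t d
    using continuous_map_funspace[OF E] that by (auto simp: Pi_iff)
  have "continuous_map Z I01 w"
  proof (rule continuous_map_paste_closed[OF _ C cover])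
    show "closed_map D Z q" using continuous_imp_closed_map assms by blast
    show "continuous_map D I01 (\<lambda>d. w (q d))"
      using wq by (intro continuous_map_eq[OF v]) auto
    show "continuous_map (subtopology Z C) I01 w"
      by (rule continuous_map_eq[of _ _ "\<lambda>_. 0"]) (auto simp: w_def continuous_map_const)
  qed
  moreover have "continuous_map (prod_topology I01 Z) Z G"
  proof (rule continuous_map_paste_closed[where D = "prod_topology I01 D"
        and q = "\<lambda>p. (fst p, q (snd p))" and C = "{0..1} \<times> C"])
    have q': "continuous_map (prod_topology I01 D) (prod_topology I01 Z) (\<lambda>p. (fst p, q (snd p)))"
      using continuous_map_pairedI[OF continuous_map_fst continuous_map_comp[OF continuous_map_snd q]] .
    show "closed_map (prod_topology I01 D) (prod_topology I01 Z) (\<lambda>p. (fst p, q (snd p)))"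
      by (rule continuous_imp_closed_map[OF q'])
        (use assms compact_space_I01 in \<open>auto simp: compact_space_prod_topology Hausdorff_space_prod_topology
          Hausdorff_space_subtopology\<close>)
    show "closedin (prod_topology I01 Z) ({0..1} \<times> C)"
      using C closedin_topspace[of I01] by (simp add: closedin_prod_Times_iff)
    show "topspace (prod_topology I01 Z)
        = {0..1} \<times> C \<union> (\<lambda>p. (fst p, q (snd p))) ` topspace (prod_topology I01 D)"
      by (force simp: cover)
    show "continuous_map (prod_topology I01 D) Z (\<lambda>p. G (fst p, q (snd p)))"
      by (rule continuous_map_eq[OF continuous_map_comp[OF E q]]) (auto simp: Gq)
    show "continuous_map (subtopology (prod_topology I01 Z) ({0..1} \<times> C)) Z G"
      by (rule continuous_map_eq[OF continuous_map_from_subtopology[OF continuous_map_snd]])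
        (auto simp: G_def)
  qed
  moreover have "C = {z \<in> topspace Z. w z = 0}"
    using wq qS by (auto simp: cover S) (auto simp: w_def)
  moreover have "G (0, z) = z" if "z \<in> topspace Z" for z
    using that unfolding cover by (auto simp: Gq E0) (auto simp: G_def)
  moreover have "G (1, z) \<in> C" if "z \<in> topspace Z" "w z < 1" for z
    using that unfolding cover
  proof (elim UnE imageE)
    fix d assume "z = q d" "d \<in> topspace D"
    then show ?thesis using that E1[of d] qS[OF ED[of 1 d]] by (simp add: Gq wq)
  qed (simp add: G_def)
  ultimately show ?thesis
    unfolding ndr_pair_def
    by (intro exI[of _ w] exI[of _ G]) (auto simp: G_def)
qed

text \<open>Lillig's union theorem. A map \<open>F\<close> of the cylinder that is already the
  identity on the bottom and over \<open>A\<close> is corrected over \<open>B\<close>: there it is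
  homotopic to the inclusion, relative to the bottom and to \<open>A \<inter> B\<close>, by way of
  the retraction \<open>R\<close>, on whose image \<open>F\<close> is the identity. Extending that
  homotopy without disturbing the bottom and \<open>A\<close> turns \<open>F\<close> into a
  retraction.\<close>

lemma ndr_pair_Un:
  assumes A: "ndr_pair Z A" and B: "ndr_pair Z B" and AB: "ndr_pair (subtopology Z B) (A \<inter> B)"
  shows "ndr_pair Z (A \<union> B)"
proof -
  let ?Q = "extension_domain Z (A \<union> B)" and ?ZB = "subtopology Z B"
  have AZ: "A \<subseteq> topspace Z" and BZ: "B \<subseteq> topspace Z" using A B ndr_pair_subset by auto
  obtain F where F: "continuous_map (prod_topology I01 Z) ?Q F"
    and F0: "\<And>z. z \<in> topspace Z \<Longrightarrow> F (0, z) = (0, z)"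
    and FA: "\<And>t a. t \<in> {0..1} \<Longrightarrow> a \<in> A \<Longrightarrow> F (t, a) = (t, a)"
    by (rule ndr_pair_extension[OF A continuous_map_extension_domain_bottom
          continuous_map_extension_domain_side[of A "A \<union> B"]]) auto
  obtain R where R: "continuous_map (prod_topology I01 ?ZB) (extension_domain ?ZB (A \<inter> B)) R"
    and R0: "\<And>b. b \<in> topspace ?ZB \<Longrightarrow> R (0, b) = (0, b)"
    and RC: "\<And>t c. t \<in> {0..1} \<Longrightarrow> c \<in> A \<inter> B \<Longrightarrow> R (t, c) = (t, c)"
    by (rule ndr_pair_extension[OF AB continuous_map_extension_domain_bottom
          continuous_map_extension_domain_side[OF subset_refl]]) auto
  have R': "continuous_map (prod_topology I01 ?ZB) (prod_topology I01 ?ZB) R"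
    and Rim: "\<And>p. p \<in> topspace (prod_topology I01 ?ZB) \<Longrightarrow> R p \<in> {0} \<times> UNIV \<union> UNIV \<times> (A \<inter> B)"
    using R unfolding extension_domain_def continuous_map_in_subtopology by blast+
  have RB: "fst (R (t, b)) \<in> {0..1} \<and> snd (R (t, b)) \<in> B" if "t \<in> {0..1}" "b \<in> B" for t b
    using continuous_map_funspace[OF R'] that BZ by (auto simp: Pi_iff mem_Times_iff)
  \<comment> \<open>A deformation of the cylinder over \<open>B\<close> into \<open>R\<close> that
    is stationary on the bottom and over \<open>A \<inter> B\<close>: time is interpolated linearly,
    while the space coordinate follows \<open>R\<close> up to the time \<open>s * t\<close>.\<close>
  define k where "k = (\<lambda>q. ((1 - fst q) * fst (snd q) + fst q * fst (R (snd q)),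
                         snd (R (fst q * fst (snd q), snd (snd q)))))"
  let ?T = "prod_topology I01 (prod_topology I01 ?ZB)"
  have t: "continuous_map ?T euclideanreal fst" "continuous_map ?T euclideanreal (\<lambda>q. fst (snd q))"
    "continuous_map ?T euclideanreal (\<lambda>q. fst (R (snd q)))"
    using continuous_map_fst[of I01 "prod_topology I01 ?ZB"]
      continuous_map_comp[OF continuous_map_snd continuous_map_fst, of I01 I01 ?ZB]
      continuous_map_comp[OF continuous_map_comp[OF continuous_map_snd R'] continuous_map_fst, of I01]
    by (auto simp: continuous_map_in_subtopology)
  have k: "continuous_map ?T (prod_topology I01 ?ZB) k"
    unfolding k_def
  proof (rule continuous_map_pairedI)
    have "continuous_map ?T euclideanreal
        (\<lambda>q. (1 - fst q) * fst (snd q) + fst q * fst (R (snd q)))"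
      by (intro continuous_map_add continuous_map_diff continuous_map_real_mult t)
        (auto simp: continuous_map_const)
    moreover have "(1 - fst q) * fst (snd q) + fst q * fst (R (snd q)) \<in> {0..1}"
      if "q \<in> topspace ?T" for q
    proof -
      have "fst q \<in> {0..1}" "fst (snd q) \<in> {0..1}" "fst (R (snd q)) \<in> {0..1}"
        using that RB[of "fst (snd q)" "snd (snd q)"] by (auto simp: mem_Times_iff)
      then show ?thesis using convexD_alt[of "{0..1::real}" "fst (snd q)" "fst (R (snd q))" "fst q"] by simp
    qed
    ultimately show "continuous_map ?T I01
        (\<lambda>q. (1 - fst q) * fst (snd q) + fst q * fst (R (snd q)))"
      by (auto simp: continuous_map_in_subtopology)
    have "continuous_map ?T euclideanreal (\<lambda>q. fst q * fst (snd q))"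
      by (intro continuous_map_real_mult t)
    then have "continuous_map ?T I01 (\<lambda>q. fst q * fst (snd q))"
      by (auto simp: continuous_map_in_subtopology mult_le_one)
    from continuous_map_comp[OF continuous_map_comp[OF continuous_map_pairedI[OF this
          continuous_map_comp[OF continuous_map_snd continuous_map_snd]] R'] continuous_map_snd]
    show "continuous_map ?T ?ZB (\<lambda>q. snd (R (fst q * fst (snd q), snd (snd q))))" .
  qed
  have k0: "k (0, (t, b)) = (t, b)" if "b \<in> B" for t b
    using that BZ by (auto simp: k_def R0)
  have k1: "k (1, p) = R p" for p
    by (simp add: k_def)
  have k_bottom: "k (s, (0, b)) = (0, b)" if "b \<in> B" for s b
    using that BZ by (auto simp: k_def R0)
  have k_side: "k (s, (t, c)) = (t, c)" if "s \<in> {0..1}" "t \<in> {0..1}" "c \<in> A \<inter> B" for s t c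
    using that RC[of "s * t" c] by (simp add: k_def RC mult_le_one algebra_simps)
  \<comment> \<open>From \<open>F\<close> to \<open>F\<close> after \<open>R\<close>, then back
    along \<open>k\<close> from \<open>R\<close> to the inclusion. The halves match because
    \<open>F\<close> fixes the image of \<open>R\<close>.\<close>
  define h where "h = (\<lambda>q. if fst q \<le> 1/2 then F (k (2 * fst q, snd q)) else k (2 - 2 * fst q, snd q))"
  have h: "continuous_map ?T ?Q h"
    unfolding h_def
  proof (rule continuous_map_cases_le[OF t(1)])
    show "continuous_map ?T euclideanreal (\<lambda>q. 1/2)" by (simp add: continuous_map_const)
    have "continuous_map (subtopology ?T {q \<in> topspace ?T. fst q \<le> 1/2}) ?T (\<lambda>q. (2 * fst q, snd q))"
      by (rule continuous_map_pairedI[OF _ continuous_map_from_subtopology[OF continuous_map_snd]])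
        (auto simp: continuous_map_in_subtopology
          intro!: continuous_map_real_mult_left continuous_map_from_subtopology[OF t(1)])
    from continuous_map_comp[OF this k]
    have "continuous_map (subtopology ?T {q \<in> topspace ?T. fst q \<le> 1/2}) (prod_topology I01 Z)
        (\<lambda>q. k (2 * fst q, snd q))"
      by (simp add: prod_topology_subtopology continuous_map_in_subtopology)
    from continuous_map_comp[OF this F]
    show "continuous_map (subtopology ?T {q \<in> topspace ?T. fst q \<le> 1/2}) ?Q
        (\<lambda>q. F (k (2 * fst q, snd q)))" .
    have "continuous_map (subtopology ?T {q \<in> topspace ?T. 1/2 \<le> fst q}) ?T (\<lambda>q. (2 - 2 * fst q, snd q))"
      by (rule continuous_map_pairedI[OF _ continuous_map_from_subtopology[OF continuous_map_snd]])
        (auto simp: continuous_map_in_subtopology continuous_map_const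
          intro!: continuous_map_real_mult_left continuous_map_diff continuous_map_from_subtopology[OF t(1)])
    from continuous_map_comp[OF continuous_map_comp[OF this k]
        continuous_map_extension_domain_side[of B "A \<union> B" Z]]
    show "continuous_map (subtopology ?T {q \<in> topspace ?T. 1/2 \<le> fst q}) ?Q
        (\<lambda>q. k (2 - 2 * fst q, snd q))" by simp
  next
    fix q assume q: "q \<in> topspace ?T" "fst q = 1/2"
    obtain t b where tb: "snd q = (t, b)" by (cases "snd q")
    then have "R (t, b) \<in> {0} \<times> B \<union> {0..1} \<times> (A \<inter> B)"
      using q Rim[of "(t, b)"] RB[of t b] by (auto simp: mem_Times_iff)
    then have "F (R (t, b)) = R (t, b)" using F0 FA BZ by auto
    moreover have e: "2 * fst q = 1" "2 - 2 * fst q = 1" using q by auto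
    ultimately show "F (k (2 * fst q, snd q)) = k (2 - 2 * fst q, snd q)"
      unfolding e(2) unfolding e(1) tb k1 by blast
  qed
  obtain v where v: "continuous_map Z I01 v" "A = {z \<in> topspace Z. v z = 0}"
    by (rule ndr_pairE[OF A]) (rule that; assumption)
  have v01: "0 \<le> v z" "v z \<le> 1" if "z \<in> topspace Z" for z
    using continuous_map_funspace[OF v(1)] that by (auto simp: Pi_iff)
  \<comment> \<open>The product of time with \<open>v\<close> vanishes exactly on the bottom and
    over \<open>A\<close>, the two places where \<open>F\<close> must be kept.\<close>
  have u: "continuous_map (prod_topology I01 Z) I01 (\<lambda>p. fst p * v (snd p))"
  proof -
    have "continuous_map (prod_topology I01 Z) euclideanreal fst"
      "continuous_map (prod_topology I01 Z) euclideanreal (\<lambda>p. v (snd p))"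
      using continuous_map_fst[of I01 Z] continuous_map_comp[OF continuous_map_snd v(1), of I01]
      by (auto simp: continuous_map_in_subtopology)
    then show ?thesis
      by (auto simp: continuous_map_in_subtopology mult_le_one v01 intro!: continuous_map_real_mult)
  qed
  obtain M where M: "continuous_map (prod_topology I01 (prod_topology I01 Z)) ?Q M"
    and MB: "\<And>s p. s \<in> {0..1} \<Longrightarrow> p \<in> {0..1} \<times> B \<Longrightarrow> M (s, p) = h (s, p)"
    and Mu: "\<And>s p. s \<in> {0..1} \<Longrightarrow> p \<in> topspace (prod_topology I01 Z) \<Longrightarrow> fst p * v (snd p) = 0
      \<Longrightarrow> M (s, p) = F p"
  proof (rule ndr_pair_extension_rel[OF ndr_pair_prod[OF B, of I01] u F])
    show "continuous_map (prod_topology I01 (subtopology (prod_topology I01 Z) (topspace I01 \<times> B))) ?Q h"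
      using h by (simp add: prod_topology_subtopology)
    show "h (0, c) = F c" if "c \<in> topspace I01 \<times> B" for c
      using that by (auto simp: h_def k0)
    show "h (s, c) = F c" if s: "s \<in> {0..1}" and cB: "c \<in> topspace I01 \<times> B" and cv: "fst c * v (snd c) = 0" for s c
    proof -
      obtain t b where c: "c = (t, b)" "t \<in> {0..1}" "b \<in> B" using cB by auto
      have "t = 0 \<or> b \<in> A \<inter> B" using cv c BZ v(2) by auto
      then show ?thesis
      proof
        assume "t = 0"
        then show ?thesis using c BZ by (auto simp: h_def k_bottom F0)
      next
        assume "b \<in> A \<inter> B"
        then show ?thesis using c s by (auto simp: h_def k_side FA)
      qed
    qed
  qed (use that in auto)
  show ?thesis
  proof (rule retraction_imp_ndr_pair)
    show "closedin Z (A \<union> B)" using A B ndr_pair_closedin by blast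
    show "continuous_map (prod_topology I01 Z) ?Q (\<lambda>p. M (1, p))"
      using continuous_map_prod_section'[OF M] by simp
    show "M (1, 0, z) = (0, z)" if "z \<in> topspace Z" for z
      using Mu[of 1 "(0, z)"] F0 that by simp
    show "M (1, t, c) = (t, c)" if t: "t \<in> {0..1}" and c: "c \<in> A \<union> B" for t c
    proof (cases "c \<in> A")
      case True
      then show ?thesis using Mu[of 1 "(t, c)"] FA t AZ v(2) by auto
    next
      case False
      then show ?thesis using MB[of 1 "(t, c)"] t c k0 by (auto simp: h_def)
    qed
  qed
qed

section \<open>Discs\<close>

lemma ndr_pair_prod_left:
  assumes "ndr_pair Z C"
  shows "ndr_pair (prod_topology Z W) (C \<times> topspace W)"
proof -
  obtain v D where v: "continuous_map Z I01 v" and D: "continuous_map (prod_topology I01 Z) Z D"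
    and C: "C = {z \<in> topspace Z. v z = 0}" and 0: "\<And>z. z \<in> topspace Z \<Longrightarrow> D (0, z) = z"
    and fix_C: "\<And>t z. t \<in> {0..1} \<Longrightarrow> z \<in> C \<Longrightarrow> D (t, z) = z"
    and 1: "\<And>z. z \<in> topspace Z \<Longrightarrow> v z < 1 \<Longrightarrow> D (1, z) \<in> C"
    by (rule ndr_pairE[OF assms]) (rule that; assumption)
  have "continuous_map (prod_topology Z W) I01 (\<lambda>p. v (fst p))"
    using continuous_map_comp[OF continuous_map_fst v] .
  moreover have "continuous_map (prod_topology I01 (prod_topology Z W)) (prod_topology Z W)
      (\<lambda>q. (D (fst q, fst (snd q)), snd (snd q)))"
    by (rule continuous_map_pairedI[OF continuous_map_comp[OF continuous_map_pairedI[OF continuous_map_fst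
            continuous_map_comp[OF continuous_map_snd continuous_map_fst]] D]
          continuous_map_comp[OF continuous_map_snd continuous_map_snd]])
  ultimately show ?thesis
    unfolding ndr_pair_def
    by (intro exI[of _ "\<lambda>p. v (fst p)"] exI[of _ "\<lambda>q. (D (fst q, fst (snd q)), snd (snd q))"])
      (use 0 fix_C 1 in \<open>auto simp: C\<close>)
qed

text \<open>Empty for \<open>n = 0\<close>, since the empty sum makes both discs the same point; a
  0-cell is thus attached along nothing, and the attaching arguments need no separate case.\<close>

definition sphere_of_disc :: "nat \<Rightarrow> (nat \<Rightarrow> real) set" where
  "sphere_of_disc n = topspace (closed_disc n) - topspace (open_disc n)"

lemma topspace_closed_disc:
  "topspace (closed_disc n) = {x. (\<forall>i\<ge>n. x i = 0) \<and> (\<Sum>i<n. (x i)\<^sup>2) \<le> 1}"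
  by (auto simp: closed_disc_def topspace_Euclidean_space)

lemma topspace_open_disc:
  "topspace (open_disc n) = {x. (\<forall>i\<ge>n. x i = 0) \<and> (\<Sum>i<n. (x i)\<^sup>2) < 1}"
  by (auto simp: open_disc_def topspace_Euclidean_space)

lemma sphere_of_disc: "sphere_of_disc n = {x \<in> topspace (closed_disc n). (\<Sum>i<n. (x i)\<^sup>2) = 1}"
  by (auto simp: sphere_of_disc_def topspace_closed_disc topspace_open_disc)

lemma closed_disc_eq: "closed_disc n = subtopology (powertop_real UNIV) (topspace (closed_disc n))"
proof -
  have "closed_disc n = subtopology (powertop_real UNIV)
      ({x. \<forall>i\<ge>n. x i = 0} \<inter> {x. (\<Sum>i<n. (x i)\<^sup>2) \<le> 1})"
    by (simp only: closed_disc_def Euclidean_space_def subtopology_subtopology)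
  also have "{x. \<forall>i\<ge>n. x i = 0} \<inter> {x. (\<Sum>i<n. (x i)\<^sup>2) \<le> 1} = topspace (closed_disc n)"
    by (auto simp: topspace_closed_disc)
  finally show ?thesis .
qed

lemma continuous_map_closed_disc:
  "continuous_map X (closed_disc n) g \<longleftrightarrow>
     (\<forall>i. continuous_map X euclideanreal (\<lambda>x. g x i)) \<and> g \<in> topspace X \<rightarrow> topspace (closed_disc n)"
proof -
  have "continuous_map X (closed_disc n) g \<longleftrightarrow>
      continuous_map X (powertop_real UNIV) g \<and> g \<in> topspace X \<rightarrow> topspace (closed_disc n)"
    by (subst closed_disc_eq) (rule continuous_map_in_subtopology)
  then show ?thesis by (simp add: continuous_map_componentwise_UNIV)
qed

lemma continuous_map_disc_coordinate: "continuous_map (closed_disc n) euclideanreal (\<lambda>x. x i)"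
  using continuous_map_closed_disc[of "closed_disc n" n "\<lambda>x. x"] continuous_map_ident by blast

lemma Hausdorff_space_closed_disc: "Hausdorff_space (closed_disc n)"
  by (simp add: closed_disc_def Euclidean_space_def Hausdorff_space_subtopology
      Hausdorff_space_product_topology)

text \<open>The disc is closed in the countable power of \<open>[-1, 1]\<close>, which is compact by
  Tychonoff; the coordinates from \<open>n\<close> on are pinned to 0.\<close>

lemma compact_space_closed_disc: "compact_space (closed_disc n)"
proof -
  let ?S = "topspace (closed_disc n)"
  have proj: "continuous_map (powertop_real UNIV) euclideanreal (\<lambda>x. x i)" for i :: nat
    by (rule continuous_map_product_projection) simp
  have "continuous_map (powertop_real UNIV) euclideanreal (\<lambda>x. \<Sum>i<n. (x i)\<^sup>2)"
    by (intro continuous_map_sum continuous_map_real_pow proj) simp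
  from closedin_continuous_map_preimage[OF this, of "{..1}"]
  have "closedin (powertop_real UNIV)
      (topspace (Euclidean_space n) \<inter> {x \<in> topspace (powertop_real UNIV). (\<Sum>i<n. (x i)\<^sup>2) \<in> {..1}})"
    by (intro closedin_Int closedin_Euclidean_space) auto
  moreover have "?S = topspace (Euclidean_space n)
      \<inter> {x \<in> topspace (powertop_real UNIV). (\<Sum>i<n. (x i)\<^sup>2) \<in> {..1}}"
    by (auto simp: topspace_closed_disc topspace_Euclidean_space)
  ultimately have "closedin (powertop_real UNIV) ?S" by simp
  moreover have "compactin (powertop_real UNIV) (PiE UNIV (\<lambda>_::nat. {-1..1::real}))"
    by (simp add: compactin_PiE)
  moreover have "?S \<subseteq> PiE UNIV (\<lambda>_. {-1..1})"
  proof
    fix x assume x: "x \<in> ?S"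
    have "x i \<in> {-1..1}" for i
    proof (cases "i < n")
      case True
      have "(x i)\<^sup>2 \<le> (\<Sum>i<n. (x i)\<^sup>2)"
        using True by (intro member_le_sum) auto
      also have "\<dots> \<le> 1" using x by (simp add: topspace_closed_disc)
      finally show ?thesis using abs_le_square_iff[of "x i" 1] by auto
    qed (use x in \<open>auto simp: topspace_closed_disc\<close>)
    then show "x \<in> PiE UNIV (\<lambda>_. {-1..1})" by auto
  qed
  ultimately have "compactin (powertop_real UNIV) ?S" using closed_compactin by blast
  then show ?thesis by (subst closed_disc_eq) (rule compact_space_subtopology)
qed

lemma ndr_pair_disc: "ndr_pair (closed_disc n) (sphere_of_disc n)"
proof -
  let ?D = "closed_disc n"
  define N where "N x = (\<Sum>i<n. (x i)\<^sup>2)" for x :: "nat \<Rightarrow> real"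
  \<comment> \<open>The deformation pushes radially outwards, ending at \<open>x\<close> divided by
    \<open>M x\<close>; the cutoff 1/2 in \<open>M\<close> keeps this defined at the centre. The
    push reaches the sphere when the norm is at least 1/2, and 4/3 is chosen so that
    \<open>v x < 1\<close> means \<open>N x > 1/4\<close>.\<close>
  define v where "v x = min 1 (4/3 * (1 - N x))" for x
  define M where "M x = max (sqrt (N x)) (1/2)" for x
  define c where "c = (\<lambda>p. (1 - fst p) + fst p / M (snd p))"
  define E where "E = (\<lambda>p i. c p * snd p i)"
  have N: "continuous_map ?D euclideanreal N"
    unfolding N_def by (intro continuous_map_sum continuous_map_real_pow continuous_map_disc_coordinate) auto
  have N01: "0 \<le> N x" "N x \<le> 1" if "x \<in> topspace ?D" for x
    using that by (auto simp: N_def topspace_closed_disc sum_nonneg)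
  have "continuous_map ?D euclideanreal v"
    unfolding v_def
    by (intro continuous_map_real_min continuous_map_real_mult_left continuous_map_diff N)
      (simp_all add: continuous_map_const)
  then have v: "continuous_map ?D I01 v"
    using N01 by (auto simp: continuous_map_in_subtopology v_def)
  have M: "1/2 \<le> M x" "sqrt (N x) \<le> M x" for x by (auto simp: M_def)
  let ?T = "prod_topology I01 ?D"
  have fst': "continuous_map ?T euclideanreal fst"
    using continuous_map_fst[of I01 ?D] by (simp add: continuous_map_in_subtopology)
  have sqrtN: "continuous_map ?T euclideanreal (\<lambda>p. sqrt (N (snd p)))"
    using continuous_map_comp[OF continuous_map_comp[OF continuous_map_snd N] continuous_map_square_root] .
  have c: "continuous_map ?T euclideanreal c"
    unfolding c_def
  proof (intro continuous_map_add continuous_map_diff continuous_map_real_divide fst')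
    show "continuous_map ?T euclideanreal (\<lambda>p. M (snd p))"
      unfolding M_def
      by (rule continuous_map_real_max[OF sqrtN]) (simp add: continuous_map_const)
    show "M (snd p) \<noteq> 0" for p :: "real \<times> (nat \<Rightarrow> real)" using M[of "snd p"] by linarith
  qed (simp add: continuous_map_const)
  have NE: "N (E p) = (c p * sqrt (N (snd p)))\<^sup>2" if "p \<in> topspace ?T" for p
  proof -
    have "N (E p) = (c p)\<^sup>2 * N (snd p)"
      by (simp add: N_def E_def power_mult_distrib sum_distrib_left)
    then show ?thesis using N01(1)[of "snd p"] that by (auto simp: power_mult_distrib)
  qed
  have cN: "0 \<le> c p * sqrt (N (snd p))" "c p * sqrt (N (snd p)) \<le> 1" if "p \<in> topspace ?T" for p
  proof -
    let ?r = "sqrt (N (snd p))"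
    have r: "0 \<le> ?r" "?r \<le> 1" "0 \<le> fst p" "fst p \<le> 1" using that N01[of "snd p"] by auto
    have "?r / M (snd p) \<le> 1" using M[of "snd p"] by (simp add: divide_le_eq_1)
    have "c p * ?r = (1 - fst p) * ?r + fst p * (?r / M (snd p))"
      by (simp add: c_def algebra_simps)
    also have "\<dots> \<le> (1 - fst p) * 1 + fst p * 1"
      using r \<open>?r / M (snd p) \<le> 1\<close> by (intro add_mono mult_left_mono) auto
    finally show "c p * ?r \<le> 1" by simp
    have "0 \<le> c p" using r M(1)[of "snd p"] by (simp add: c_def)
    then show "0 \<le> c p * ?r" using r(1) by (rule mult_nonneg_nonneg)
  qed
  have ED: "E p \<in> topspace ?D" if "p \<in> topspace ?T" for p
  proof -
    have "N (E p) \<le> 1" using NE[OF that] cN[OF that] by (simp add: power_le_one)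
    then show ?thesis using that by (auto simp: topspace_closed_disc N_def E_def)
  qed
  have E: "continuous_map ?T ?D E"
    unfolding continuous_map_closed_disc
  proof (intro conjI allI)
    show "continuous_map ?T euclideanreal (\<lambda>p. E p i)" for i
      unfolding E_def
      by (intro continuous_map_real_mult c
          continuous_map_comp[OF continuous_map_snd continuous_map_disc_coordinate])
  qed (use ED in auto)
  have S: "sphere_of_disc n = {x \<in> topspace ?D. v x = 0}"
    by (auto simp: sphere_of_disc v_def N_def min_def)
  show ?thesis
    unfolding ndr_pair_def
  proof (intro exI[of _ v] exI[of _ E] conjI v E S ballI impI)
    show "E (0, x) = x" for x by (simp add: E_def c_def)
    show "E (t, x) = x" if "t \<in> {0..1}" "x \<in> sphere_of_disc n" for t x
      using that by (simp add: E_def c_def sphere_of_disc N_def M_def)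
    show "E (1, x) \<in> sphere_of_disc n" if x: "x \<in> topspace ?D" and "v x < 1" for x
    proof -
      have "N x > (1/2)\<^sup>2" using that by (auto simp: v_def min_def power2_eq_square split: if_splits)
      then have "sqrt (N x) > 1/2" using real_less_rsqrt by blast
      then have "c (1, x) * sqrt (N x) = 1" by (auto simp: c_def M_def max_def)
      then show ?thesis using NE[of "(1, x)"] ED[of "(1, x)"] x by (simp add: sphere_of_disc N_def)
    qed
  qed
qed

lemma closed_disc_convex:
  assumes "a \<in> topspace (closed_disc n)" and "b \<in> topspace (closed_disc n)" and "t \<in> {0..1}"
  shows "(\<lambda>i. (1 - t) * b i + t * a i) \<in> topspace (closed_disc n)"
proof -
  have "((1 - t) * b i + t * a i)\<^sup>2 \<le> (1 - t) * (b i)\<^sup>2 + t * (a i)\<^sup>2" for i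
  proof -
    have "(1 - t) * (b i)\<^sup>2 + t * (a i)\<^sup>2 - ((1 - t) * b i + t * a i)\<^sup>2 = t * (1 - t) * (a i - b i)\<^sup>2"
      by (simp add: power2_eq_square algebra_simps)
    moreover have "0 \<le> t * (1 - t) * (a i - b i)\<^sup>2" using assms(3) by simp
    ultimately show ?thesis by linarith
  qed
  then have "(\<Sum>i<n. ((1 - t) * b i + t * a i)\<^sup>2) \<le> (\<Sum>i<n. (1 - t) * (b i)\<^sup>2 + t * (a i)\<^sup>2)"
    by (intro sum_mono)
  also have "\<dots> = (1 - t) * (\<Sum>i<n. (b i)\<^sup>2) + t * (\<Sum>i<n. (a i)\<^sup>2)"
    by (simp add: sum.distrib sum_distrib_left)
  also have "\<dots> \<le> (1 - t) * 1 + t * 1"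
    using assms by (intro add_mono mult_left_mono) (auto simp: topspace_closed_disc)
  finally show ?thesis using assms by (auto simp: topspace_closed_disc)
qed

lemma ndr_pair_disc_diagonal:
  "ndr_pair (prod_topology (closed_disc n) (closed_disc n)) ((\<lambda>a. (a, a)) ` topspace (closed_disc n))"
proof -
  let ?D = "closed_disc n"
  \<comment> \<open>The disc has diameter 2, so a quarter of the squared distance lies in the unit
    interval. By convexity the second coordinate can be slid to the first from anywhere in the
    disc.\<close>
  define v :: "(nat \<Rightarrow> real) \<times> (nat \<Rightarrow> real) \<Rightarrow> real"
    where "v = (\<lambda>p. (\<Sum>i<n. (fst p i - snd p i)\<^sup>2) / 4)"
  define E :: "real \<times> (nat \<Rightarrow> real) \<times> (nat \<Rightarrow> real) \<Rightarrow> (nat \<Rightarrow> real) \<times> (nat \<Rightarrow> real)"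
    where "E = (\<lambda>q. (fst (snd q), \<lambda>i. (1 - fst q) * snd (snd q) i + fst q * fst (snd q) i))"
  have v_bounds: "v (a, b) \<in> {0..1}" if "a \<in> topspace ?D" "b \<in> topspace ?D" for a b
  proof -
    have "(\<Sum>i<n. (a i - b i)\<^sup>2) \<le> (\<Sum>i<n. 2 * (a i)\<^sup>2 + 2 * (b i)\<^sup>2)"
    proof (intro sum_mono)
      show "(a i - b i)\<^sup>2 \<le> 2 * (a i)\<^sup>2 + 2 * (b i)\<^sup>2" for i
        using zero_le_power2[of "a i + b i"] by (simp add: power2_eq_square algebra_simps)
    qed
    also have "\<dots> = 2 * (\<Sum>i<n. (a i)\<^sup>2) + 2 * (\<Sum>i<n. (b i)\<^sup>2)"
      by (simp add: sum.distrib sum_distrib_left)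
    also have "\<dots> \<le> 4" using that by (simp add: topspace_closed_disc)
    finally show ?thesis by (simp add: v_def sum_nonneg)
  qed
  have "continuous_map (prod_topology ?D ?D) euclideanreal v"
    unfolding v_def
    by (intro continuous_map_real_divide continuous_map_sum continuous_map_real_pow continuous_map_diff
        continuous_map_comp[OF continuous_map_fst continuous_map_disc_coordinate]
        continuous_map_comp[OF continuous_map_snd continuous_map_disc_coordinate])
      (auto simp: continuous_map_const)
  then have v: "continuous_map (prod_topology ?D ?D) I01 v"
    using v_bounds by (auto simp: continuous_map_in_subtopology)
  let ?T = "prod_topology I01 (prod_topology ?D ?D)"
  have fst': "continuous_map ?T euclideanreal fst"
    using continuous_map_fst[of I01 "prod_topology ?D ?D"] by (simp add: continuous_map_in_subtopology)
  have E: "continuous_map ?T (prod_topology ?D ?D) E"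
    unfolding E_def
  proof (rule continuous_map_pairedI)
    show 1: "continuous_map ?T ?D (\<lambda>q. fst (snd q))"
      using continuous_map_comp[OF continuous_map_snd continuous_map_fst] .
    have 2: "continuous_map ?T ?D (\<lambda>q. snd (snd q))"
      using continuous_map_comp[OF continuous_map_snd continuous_map_snd] .
    show "continuous_map ?T ?D (\<lambda>q i. (1 - fst q) * snd (snd q) i + fst q * fst (snd q) i)"
      unfolding continuous_map_closed_disc
    proof (intro conjI allI)
      show "continuous_map ?T euclideanreal (\<lambda>q. (1 - fst q) * snd (snd q) i + fst q * fst (snd q) i)" for i
        by (intro continuous_map_add continuous_map_real_mult continuous_map_diff fst'
            continuous_map_comp[OF 1 continuous_map_disc_coordinate]
            continuous_map_comp[OF 2 continuous_map_disc_coordinate])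
          (auto simp: continuous_map_const)
    qed (use closed_disc_convex in auto)
  qed
  have "v (a, b) = 0 \<longleftrightarrow> a = b" if "a \<in> topspace ?D" "b \<in> topspace ?D" for a b
  proof
    assume "v (a, b) = 0"
    then have "\<forall>i<n. a i = b i" by (auto simp: v_def sum_nonneg_eq_0_iff)
    moreover have "\<forall>i\<ge>n. a i = b i" using that by (simp add: topspace_closed_disc)
    ultimately have "a i = b i" for i by (cases "i < n") auto
    then show "a = b" by (rule ext)
  qed (simp add: v_def)
  then have \<Delta>: "(\<lambda>a. (a, a)) ` topspace ?D = {p \<in> topspace (prod_topology ?D ?D). v p = 0}"
    by auto
  have "E (t, a, a) = (a, a)" for t a by (auto simp: E_def algebra_simps)
  then show ?thesis
    unfolding ndr_pair_def
    by (intro exI[of _ v] exI[of _ E] conjI v E \<Delta>) (auto simp: E_def)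
qed

text \<open>This is the part along which the product of a cell with itself is glued when the
  diagonal of a complex is treated cell by cell. It is assembled by two unions: the two halves of
  the boundary, which meet in sphere times sphere, and then the diagonal, which meets that boundary
  in a copy of the sphere.\<close>

lemma ndr_pair_disc_square:
  "ndr_pair (prod_topology (closed_disc n) (closed_disc n))
     {(a, b). a \<in> topspace (closed_disc n) \<and> b \<in> topspace (closed_disc n) \<and>
              (a \<in> sphere_of_disc n \<or> b \<in> sphere_of_disc n \<or> a = b)}"
proof -
  let ?D = "closed_disc n" and ?S = "sphere_of_disc n"
  let ?Z = "prod_topology ?D ?D" and ?\<Delta> = "(\<lambda>a. (a, a)) ` topspace ?D"
  have SD: "?S \<subseteq> topspace ?D" by (auto simp: sphere_of_disc)
  have 1: "ndr_pair ?Z (?S \<times> topspace ?D)" by (rule ndr_pair_prod_left[OF ndr_pair_disc])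
  have 2: "ndr_pair ?Z (topspace ?D \<times> ?S)" by (rule ndr_pair_prod[OF ndr_pair_disc])
  have "ndr_pair (prod_topology ?D (subtopology ?D ?S)) (?S \<times> topspace (subtopology ?D ?S))"
    by (rule ndr_pair_prod_left[OF ndr_pair_disc])
  moreover have "?S \<times> topspace (subtopology ?D ?S) = (?S \<times> topspace ?D) \<inter> (topspace ?D \<times> ?S)"
    using SD by auto
  ultimately have "ndr_pair (subtopology ?Z (topspace ?D \<times> ?S)) ((?S \<times> topspace ?D) \<inter> (topspace ?D \<times> ?S))"
    by (simp add: prod_topology_subtopology)
  from ndr_pair_Un[OF 1 2 this] have 3: "ndr_pair ?Z (?S \<times> topspace ?D \<union> topspace ?D \<times> ?S)" .
  have "ndr_pair (subtopology ?Z ?\<Delta>) ((?S \<times> topspace ?D \<union> topspace ?D \<times> ?S) \<inter> ?\<Delta>)"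
  proof (rule ndr_pair_relative_homeomorphism[OF ndr_pair_disc compact_space_closed_disc,
        where q = "\<lambda>a. (a, a)"])
    show "Hausdorff_space (subtopology ?Z ?\<Delta>)"
      by (simp add: Hausdorff_space_subtopology Hausdorff_space_prod_topology Hausdorff_space_closed_disc)
    show "continuous_map ?D (subtopology ?Z ?\<Delta>) (\<lambda>a. (a, a))"
      by (rule continuous_map_into_subtopology[OF continuous_map_pairedI])
        (auto intro: continuous_map_ident)
    show "closedin (subtopology ?Z ?\<Delta>) ((?S \<times> topspace ?D \<union> topspace ?D \<times> ?S) \<inter> ?\<Delta>)"
      using ndr_pair_closedin[OF 3] unfolding closedin_subtopology by blast
  qed (use SD in \<open>auto simp: inj_on_def\<close>)
  from ndr_pair_Un[OF 3 ndr_pair_disc_diagonal this]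
  have "ndr_pair ?Z (?S \<times> topspace ?D \<union> topspace ?D \<times> ?S \<union> ?\<Delta>)" .
  moreover have "?S \<times> topspace ?D \<union> topspace ?D \<times> ?S \<union> ?\<Delta> =
      {(a, b). a \<in> topspace ?D \<and> b \<in> topspace ?D \<and> (a \<in> ?S \<or> b \<in> ?S \<or> a = b)}"
    using SD by auto
  ultimately show ?thesis by simp
qed

section \<open>CW complexes\<close>

lemma cw_complexD:
  assumes "cw_complex Y \<E> d"
  shows "Hausdorff_space Y" and "pairwise disjnt \<E>" and "\<Union>\<E> = topspace Y"
    and "\<And>e. e \<in> \<E> \<Longrightarrow> \<exists>\<phi>. characteristic_map Y \<E> d e \<phi>"
    and "\<And>e. e \<in> \<E> \<Longrightarrow> \<exists>\<F>\<subseteq>\<E>. finite \<F> \<and> Y closure_of e \<subseteq> \<Union>\<F>"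
    and "\<And>C. C \<subseteq> topspace Y \<Longrightarrow> (\<And>e. e \<in> \<E> \<Longrightarrow> closedin Y (C \<inter> Y closure_of e)) \<Longrightarrow> closedin Y C"
proof -
  note cw = assms[unfolded cw_complex_def]
  show "Hausdorff_space Y" using cw by (elim conjE)
  show "pairwise disjnt \<E>" using cw by (elim conjE)
  show "\<Union>\<E> = topspace Y" using cw by (elim conjE)
  from cw have char: "\<forall>e\<in>\<E>. \<exists>\<phi>. characteristic_map Y \<E> d e \<phi>" by (elim conjE)
  from cw have fin: "\<forall>e\<in>\<E>. \<exists>\<F>\<subseteq>\<E>. finite \<F> \<and> Y closure_of e \<subseteq> \<Union>\<F>" by (elim conjE)
  from cw have weak: "\<forall>C\<subseteq>topspace Y. (\<forall>e\<in>\<E>. closedin Y (C \<inter> Y closure_of e)) \<longrightarrow> closedin Y C"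
    by (elim conjE)
  show "\<exists>\<phi>. characteristic_map Y \<E> d e \<phi>" if "e \<in> \<E>" for e
    using char that by (rule bspec)
  show "\<exists>\<F>\<subseteq>\<E>. finite \<F> \<and> Y closure_of e \<subseteq> \<Union>\<F>" if "e \<in> \<E>" for e
    using fin that by (rule bspec)
  show "closedin Y C" if "C \<subseteq> topspace Y" "\<And>e. e \<in> \<E> \<Longrightarrow> closedin Y (C \<inter> Y closure_of e)" for C
    using weak that by simp
qed

text \<open>A point of the disc is the limit along its radius of interior points, so its image lies
  in the closure of the cell. Conversely, the image of the disc is compact, hence closed in the
  Hausdorff space, and contains the cell.\<close>

lemma closure_cell:
  assumes "cw_complex Y \<E> d" and e: "e \<in> \<E>"
  obtains \<phi> where "continuous_map (closed_disc (d e)) Y \<phi>"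
    and "\<phi> ` topspace (closed_disc (d e)) = Y closure_of e"
    and "\<phi> ` (topspace (closed_disc (d e)) - sphere_of_disc (d e)) = e"
    and "inj_on \<phi> (topspace (closed_disc (d e)) - sphere_of_disc (d e))"
    and "\<phi> ` sphere_of_disc (d e) \<subseteq> \<Union>{e' \<in> \<E>. d e' < d e}"
proof -
  obtain \<phi> where \<phi>: "characteristic_map Y \<E> d e \<phi>"
    using cw_complexD(4)[OF assms] by blast
  let ?D = "topspace (closed_disc (d e))" and ?O = "topspace (open_disc (d e))"
  have OD: "?D - sphere_of_disc (d e) = ?O"
    by (auto simp: sphere_of_disc topspace_closed_disc topspace_open_disc)
  have eY: "e \<subseteq> topspace Y" using cw_complexD(3)[OF assms(1)] e by blast
  have cont: "continuous_map (closed_disc (d e)) Y \<phi>"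
    and homeo: "homeomorphic_map (open_disc (d e)) (subtopology Y e) \<phi>"
    and bd: "\<phi> ` sphere_of_disc (d e) \<subseteq> \<Union>{e' \<in> \<E>. d e' < d e}"
    using \<phi> unfolding characteristic_map_def sphere_of_disc_def by auto
  have im: "\<phi> ` ?O = e" and inj: "inj_on \<phi> ?O"
    using homeomorphic_imp_surjective_map[OF homeo] homeomorphic_imp_injective_map[OF homeo] eY by auto
  have "\<phi> ` ?D \<subseteq> Y closure_of e"
  proof (rule image_subsetI)
    fix x assume x: "x \<in> ?D"
    define g where "g t = (\<lambda>i. t * x i)" for t :: real
    have gD: "(\<Sum>i<d e. (g t i)\<^sup>2) \<le> t\<^sup>2" for t
    proof -
      have "(\<Sum>i<d e. (g t i)\<^sup>2) = t\<^sup>2 * (\<Sum>i<d e. (x i)\<^sup>2)"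
        by (simp add: g_def power_mult_distrib sum_distrib_left)
      also have "\<dots> \<le> t\<^sup>2 * 1" using x by (intro mult_left_mono) (auto simp: topspace_closed_disc)
      finally show ?thesis by simp
    qed
    have "continuous_map I01 (closed_disc (d e)) g"
      unfolding continuous_map_closed_disc
    proof (intro conjI allI funcsetI)
      show "continuous_map I01 euclideanreal (\<lambda>t. g t i)" for i
        by (auto simp: g_def intro!: continuous_intros)
      show "g t \<in> ?D" if "t \<in> topspace I01" for t
        using that x gD[of t] power_le_one[of t 2] by (auto simp: topspace_closed_disc g_def)
    qed
    then have "continuous_map I01 Y (\<lambda>t. \<phi> (g t))" using continuous_map_comp cont by blast
    from continuous_map_image_closure_subset[OF this, of "{0..<1}"]
    have "(\<lambda>t. \<phi> (g t)) ` (I01 closure_of {0..<1}) \<subseteq> Y closure_of ((\<lambda>t. \<phi> (g t)) ` {0..<1})" .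
    moreover have "(\<lambda>t. \<phi> (g t)) ` {0..<1} \<subseteq> e"
    proof (rule image_subsetI)
      fix t :: real assume "t \<in> {0..<1}"
      then have "t\<^sup>2 < 1" by (simp add: power2_eq_square mult_strict_mono' less_1_mult
            power_less_one_iff flip: power2_eq_square)
      then have "g t \<in> ?O" using x gD[of t] by (auto simp: topspace_open_disc topspace_closed_disc g_def)
      then show "\<phi> (g t) \<in> e" using im by blast
    qed
    moreover have "{0..1} \<inter> {0..<1::real} = {0..<1}" by auto
    then have "1 \<in> I01 closure_of {0..<1}"
      by (simp add: closure_of_subtopology)
    ultimately have "\<phi> (g 1) \<in> Y closure_of e"
      using closure_of_mono by blast
    then show "\<phi> x \<in> Y closure_of e" by (simp add: g_def)
  qed
  moreover have "Y closure_of e \<subseteq> \<phi> ` ?D"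
  proof (rule closure_of_minimal)
    show "e \<subseteq> \<phi> ` ?D" using im OD by blast
    have "compactin Y (\<phi> ` ?D)"
      using image_compactin[OF _ cont] compact_space_closed_disc by (simp add: compact_space_def)
    then show "closedin Y (\<phi> ` ?D)"
      using cw_complexD(1)[OF assms(1)] compactin_imp_closedin by blast
  qed
  ultimately show ?thesis using that[of \<phi>] cont im inj bd OD by auto
qed

section \<open>Subcomplexes and compact subsets\<close>

lemma cells_disjoint:
  "cw_complex Y \<E> d \<Longrightarrow> e \<in> \<E> \<Longrightarrow> e' \<in> \<E> \<Longrightarrow> y \<in> e \<Longrightarrow> y \<in> e' \<Longrightarrow> e = e'"
  by (rule ccontr) (use pairwiseD[OF cw_complexD(2)[of Y \<E> d], of e e'] in \<open>auto simp: disjnt_iff\<close>)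

lemma closure_cell_subset:
  assumes "cw_complex Y \<E> d" and "e \<in> \<E>"
  shows "Y closure_of e \<subseteq> e \<union> \<Union>{e' \<in> \<E>. d e' < d e}"
    and "compactin Y (Y closure_of e)"
proof -
  obtain \<phi> where \<phi>: "continuous_map (closed_disc (d e)) Y \<phi>"
    and im: "\<phi> ` topspace (closed_disc (d e)) = Y closure_of e"
    and int: "\<phi> ` (topspace (closed_disc (d e)) - sphere_of_disc (d e)) = e"
    and bd: "\<phi> ` sphere_of_disc (d e) \<subseteq> \<Union>{e' \<in> \<E>. d e' < d e}"
    by (rule closure_cell[OF assms]) (rule that; assumption)
  show "Y closure_of e \<subseteq> e \<union> \<Union>{e' \<in> \<E>. d e' < d e}"
    using im int bd by blast
  show "compactin Y (Y closure_of e)"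
    using image_compactin[OF _ \<phi>] compact_space_closed_disc im by (metis compact_space_def)
qed

text \<open>Kept as a set of cells rather than as a subspace, so that finiteness and induction on
  the number of cells are immediate; the subspace is its union.\<close>

definition subcomplex :: "'a topology \<Rightarrow> 'a set set \<Rightarrow> 'a set set \<Rightarrow> bool" where
  "subcomplex Y \<E> S \<longleftrightarrow> S \<subseteq> \<E> \<and> (\<forall>e\<in>S. Y closure_of e \<subseteq> \<Union>S)"

lemma subcomplex_UN: "(\<And>i. i \<in> I \<Longrightarrow> subcomplex Y \<E> (S i)) \<Longrightarrow> subcomplex Y \<E> (\<Union>i\<in>I. S i)"
  unfolding subcomplex_def UN_iff
proof (intro conjI ballI, goal_cases)
  case 1
  then show ?case by blast
next
  case (2 e)
  then obtain i where "i \<in> I" "e \<in> S i" by blast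
  then have "Y closure_of e \<subseteq> \<Union>(S i)" using 2(1) by blast
  also have "\<dots> \<subseteq> \<Union>(\<Union>i\<in>I. S i)" using \<open>i \<in> I\<close> by (intro Sup_subset_mono) blast
  finally show ?case .
qed

lemma finite_subcomplex_compact:
  assumes cw: "cw_complex Y \<E> d" and "finite S" and S: "subcomplex Y \<E> S"
  shows "compactin Y (\<Union>S)" and "closedin Y (\<Union>S)"
proof -
  have "e \<subseteq> Y closure_of e" if "e \<in> S" for e
    using that cw_complexD(3)[OF cw] S unfolding subcomplex_def by (intro closure_of_subset) blast
  then have "\<Union>S = (\<Union>e\<in>S. Y closure_of e)"
    using S unfolding subcomplex_def by blast
  moreover have "compactin Y (Y closure_of e)" if "e \<in> S" for e
    using closure_cell_subset(2)[OF cw] that S unfolding subcomplex_def by blast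
  ultimately show "compactin Y (\<Union>S)" using \<open>finite S\<close> by (auto intro: compactin_Union)
  then show "closedin Y (\<Union>S)"
    using cw_complexD(1)[OF cw] compactin_imp_closedin by blast
qed

lemma cell_in_finite_subcomplex:
  assumes cw: "cw_complex Y \<E> d" and "e \<in> \<E>"
  shows "\<exists>S. finite S \<and> subcomplex Y \<E> S \<and> e \<in> S"
  using assms(2)
proof (induction "d e" arbitrary: e rule: less_induct)
  case less
  obtain \<F> where \<F>: "\<F> \<subseteq> \<E>" "finite \<F>" "Y closure_of e \<subseteq> \<Union>\<F>"
    using cw_complexD(5)[OF cw less.prems] by blast
  \<comment> \<open>The finite family may contain irrelevant cells of any dimension. Those that
    actually meet the closure, other than \<open>e\<close>, have smaller dimension, so the induction
    applies to them.\<close>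
  define \<F>' where "\<F>' = {e' \<in> \<F>. e' \<inter> Y closure_of e \<noteq> {}} - {e}"
  have lower: "d e' < d e" "e' \<in> \<E>" if e': "e' \<in> \<F>'" for e'
  proof -
    show "e' \<in> \<E>" using e' \<F> by (auto simp: \<F>'_def)
    obtain y where "y \<in> e'" "y \<in> Y closure_of e" "e' \<noteq> e" using e' by (auto simp: \<F>'_def)
    then show "d e' < d e"
      using closure_cell_subset(1)[OF cw less.prems] cells_disjoint[OF cw _ \<open>e' \<in> \<E>\<close>] less.prems by blast
  qed
  then have "\<forall>e'\<in>\<F>'. \<exists>S. finite S \<and> subcomplex Y \<E> S \<and> e' \<in> S" using less.hyps by blast
  then obtain S where S: "\<And>e'. e' \<in> \<F>' \<Longrightarrow> finite (S e') \<and> subcomplex Y \<E> (S e') \<and> e' \<in> S e'"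
    by metis
  define T where "T = insert e (\<Union>e'\<in>\<F>'. S e')"
  have "finite T" using S \<F> by (auto simp: T_def \<F>'_def)
  moreover have "subcomplex Y \<E> T"
    unfolding subcomplex_def
  proof (intro conjI ballI)
    show "T \<subseteq> \<E>" using S less.prems by (auto simp: T_def subcomplex_def)
    have "Y closure_of e \<subseteq> \<Union>T"
    proof
      fix y assume y: "y \<in> Y closure_of e"
      then obtain e' where "e' \<in> \<F>" "y \<in> e'" using \<F> by blast
      then show "y \<in> \<Union>T" using S[of e'] y by (cases "e' = e") (auto simp: T_def \<F>'_def)
    qed
    moreover have "subcomplex Y \<E> (\<Union>e'\<in>\<F>'. S e')" using S by (intro subcomplex_UN) auto
    ultimately show "Y closure_of e'' \<subseteq> \<Union>T" if "e'' \<in> T" for e''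
      using that unfolding T_def subcomplex_def by blast
  qed
  ultimately show ?case unfolding T_def by blast
qed

lemma finite_cells_in_finite_subcomplex:
  assumes cw: "cw_complex Y \<E> d" and "finite \<F>" and "\<F> \<subseteq> \<E>"
  shows "\<exists>S. finite S \<and> subcomplex Y \<E> S \<and> \<F> \<subseteq> S"
proof -
  obtain S where S: "\<And>e. e \<in> \<F> \<Longrightarrow> finite (S e) \<and> subcomplex Y \<E> (S e) \<and> e \<in> S e"
    using cell_in_finite_subcomplex[OF cw] \<open>\<F> \<subseteq> \<E>\<close> by (metis subsetD)
  then show ?thesis
    using \<open>finite \<F>\<close> by (intro exI[of _ "\<Union>e\<in>\<F>. S e"]) (auto intro: subcomplex_UN)
qed

text \<open>Pick a point of \<open>K\<close> in every cell that meets \<open>K\<close>. A closed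
  cell contains only finitely many of these points, so by the weak topology every set of them is
  closed; they form a closed discrete subset of a compact set and hence are finite in
  number.\<close>

lemma compact_in_finite_subcomplex:
  assumes cw: "cw_complex Y \<E> d" and K: "compactin Y K"
  shows "\<exists>S. finite S \<and> subcomplex Y \<E> S \<and> K \<subseteq> \<Union>S"
proof -
  have haus: "Hausdorff_space Y" by (rule cw_complexD(1)[OF cw])
  define M where "M = {e \<in> \<E>. e \<inter> K \<noteq> {}}"
  define p where "p e = (SOME y. y \<in> e \<inter> K)" for e
  have p: "p e \<in> e" "p e \<in> K" if "e \<in> M" for e
    using someI_ex[of "\<lambda>y. y \<in> e \<inter> K"] that by (auto simp: M_def p_def)
  have inj: "inj_on p M"
  proof (rule inj_onI)
    fix e1 e2 assume "e1 \<in> M" "e2 \<in> M" "p e1 = p e2"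
    then show "e1 = e2"
      using p(1)[of e1] p(1)[of e2] by (intro cells_disjoint[OF cw, of e1 e2 "p e1"]) (auto simp: M_def)
  qed
  have closed: "closedin Y T" if T: "T \<subseteq> p ` M" for T
  proof -
    have cl: "closedin Y (T \<inter> Y closure_of e)" if e: "e \<in> \<E>" for e
    proof -
      obtain \<F> where \<F>: "\<F> \<subseteq> \<E>" "finite \<F>" "Y closure_of e \<subseteq> \<Union>\<F>"
        using cw_complexD(5)[OF cw e] by blast
      have "T \<inter> Y closure_of e \<subseteq> p ` \<F>"
      proof
        fix y assume y: "y \<in> T \<inter> Y closure_of e"
        then obtain e1 e2 where "e1 \<in> M" "y = p e1" "e2 \<in> \<F>" "y \<in> e2" using T \<F> by blast
        moreover from this have "e1 = e2"
          using p(1)[of e1] \<F>(1) by (intro cells_disjoint[OF cw]) (auto simp: M_def)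
        ultimately show "y \<in> p ` \<F>" by blast
      qed
      then have "finite (T \<inter> Y closure_of e)" using \<F>(2) by (rule finite_surj[rotated])
      then show ?thesis
        by (intro closedin_Hausdorff_finite[OF haus])
          (use closure_of_subset_topspace[of Y e] in auto)
    qed
    have "T \<subseteq> topspace Y" using T p(2) compactin_subset_topspace[OF K] by blast
    then show ?thesis by (rule cw_complexD(6)[OF cw]) (rule cl)
  qed
  have comp: "compactin Y (p ` M)"
    using closed[OF subset_refl] p by (intro closed_compactin[OF K]) auto
  \<comment> \<open>\<open>V y\<close> contains no chosen point other than \<open>y\<close>, so a
    finite subcover leaves only finitely many points.\<close>
  define V where "V y = topspace Y - (p ` M - {y})" for y
  have "p ` M \<subseteq> topspace Y" using compactin_subset_topspace[OF comp] .
  then have "p ` M \<subseteq> \<Union>(V ` p ` M)" by (auto simp: V_def)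
  moreover have "openin Y U" if "U \<in> V ` p ` M" for U
    using that closed[of "p ` M - {_}"] by (auto simp: V_def)
  ultimately obtain \<V> where \<V>: "finite \<V>" "\<V> \<subseteq> V ` p ` M" "p ` M \<subseteq> \<Union>\<V>"
    using compactinD[OF comp, of "V ` p ` M"] by blast
  then obtain N where N: "finite N" "N \<subseteq> p ` M" "\<V> = V ` N"
    using finite_subset_image[OF \<V>(1,2)] by blast
  have "p ` M \<subseteq> N"
  proof
    fix y assume y: "y \<in> p ` M"
    then obtain z where "z \<in> N" "y \<in> V z" using \<V>(3) N(3) by blast
    then show "y \<in> N" using y by (auto simp: V_def)
  qed
  then have "finite M" by (intro finite_imageD[OF _ inj]) (rule finite_subset[OF _ N(1)])
  then obtain S where "finite S" "subcomplex Y \<E> S" "M \<subseteq> S"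
    using finite_cells_in_finite_subcomplex[OF cw, of M] by (auto simp: M_def)
  moreover have "K \<subseteq> \<Union>M"
    using compactin_subset_topspace[OF K] cw_complexD(3)[OF cw] unfolding M_def by blast
  ultimately show ?thesis by blast
qed

text \<open>No remaining cell has \<open>e\<close> in its closure: a cell of \<open>S\<close> has
  its closure inside \<open>S\<close>, and any other cell has dimension at most that of
  \<open>e\<close>, so its boundary lies in cells of strictly smaller dimension.\<close>

lemma subcomplex_remove_cell:
  assumes cw: "cw_complex Y \<E> d" and S: "subcomplex Y \<E> S" and T: "subcomplex Y \<E> T"
    and "S \<subseteq> T" and e: "e \<in> T - S" and max: "\<And>e'. e' \<in> T - S \<Longrightarrow> d e' \<le> d e"
  shows "subcomplex Y \<E> (T - {e})"
  unfolding subcomplex_def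
proof (intro conjI ballI subsetI)
  show "e' \<in> \<E>" if "e' \<in> T - {e}" for e' using that T by (auto simp: subcomplex_def)
  fix e' y assume e': "e' \<in> T - {e}" and y: "y \<in> Y closure_of e'"
  have mem: "e \<in> \<E>" "e' \<in> \<E>" using e e' T by (auto simp: subcomplex_def)
  show "y \<in> \<Union>(T - {e})"
  proof (cases "e' \<in> S")
    case True
    then show ?thesis using S y e \<open>S \<subseteq> T\<close> unfolding subcomplex_def by blast
  next
    case False
    obtain e'' where e'': "e'' \<in> T" "y \<in> e''" using T e' y unfolding subcomplex_def by blast
    have "y \<notin> e"
      using closure_cell_subset(1)[OF cw mem(2)] y cells_disjoint[OF cw mem(1)] mem max[of e'] e' False
      by fastforce
    then show ?thesis using e'' by blast
  qed
qed

text \<open>The characteristic map is put into the form that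
  \<open>ndr_pair_relative_homeomorphism\<close> expects. A boundary point lies in a lower cell, and
  disjointness of cells identifies that cell with a member of \<open>T\<close>.\<close>

lemma attach_cell:
  assumes cw: "cw_complex Y \<E> d" and T: "subcomplex Y \<E> T" and e: "e \<in> T"
    and S: "subcomplex Y \<E> (T - {e})"
  obtains \<phi> where "continuous_map (closed_disc (d e)) (subtopology Y (\<Union>T)) \<phi>"
    and "\<And>x. x \<in> topspace (closed_disc (d e)) \<Longrightarrow> \<phi> x \<in> \<Union>(T - {e}) \<longleftrightarrow> x \<in> sphere_of_disc (d e)"
    and "inj_on \<phi> (topspace (closed_disc (d e)) - sphere_of_disc (d e))"
    and "\<Union>T \<subseteq> \<Union>(T - {e}) \<union> \<phi> ` topspace (closed_disc (d e))"
proof -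
  let ?D = "topspace (closed_disc (d e))" and ?S = "sphere_of_disc (d e)"
  have TE: "T \<subseteq> \<E>" "e \<in> \<E>" using T e by (auto simp: subcomplex_def)
  obtain \<phi> where \<phi>: "continuous_map (closed_disc (d e)) Y \<phi>"
    and im: "\<phi> ` ?D = Y closure_of e" and int: "\<phi> ` (?D - ?S) = e"
    and inj: "inj_on \<phi> (?D - ?S)" and bd: "\<phi> ` ?S \<subseteq> \<Union>{e' \<in> \<E>. d e' < d e}"
    by (rule closure_cell[OF cw TE(2)]) (rule that; assumption)
  have imT: "\<phi> ` ?D \<subseteq> \<Union>T" using im T e unfolding subcomplex_def by blast
  show ?thesis
  proof (rule that[OF _ _ inj])
    show "continuous_map (closed_disc (d e)) (subtopology Y (\<Union>T)) \<phi>"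
      using \<phi> imT by (intro continuous_map_into_subtopology) auto
    show "\<phi> x \<in> \<Union>(T - {e}) \<longleftrightarrow> x \<in> ?S" if x: "x \<in> ?D" for x
    proof
      assume "\<phi> x \<in> \<Union>(T - {e})"
      then obtain e' where "e' \<in> T" "e' \<noteq> e" "\<phi> x \<in> e'" by blast
      then have "\<phi> x \<notin> e" using cells_disjoint[OF cw TE(2)] TE(1) by blast
      then show "x \<in> ?S" using int x by blast
    next
      assume xS: "x \<in> ?S"
      obtain e' where e': "e' \<in> \<E>" "d e' < d e" "\<phi> x \<in> e'" using bd xS by blast
      obtain e'' where e'': "e'' \<in> T" "\<phi> x \<in> e''" using imT x by blast
      have "e'' = e'" using cells_disjoint[OF cw] e' e'' TE by blast
      then show "\<phi> x \<in> \<Union>(T - {e})" using e' e'' by blast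
    qed
    show "\<Union>T \<subseteq> \<Union>(T - {e}) \<union> \<phi> ` ?D" using int by blast
  qed
qed

section \<open>Finite complexes: subcomplexes and diagonals as NDR pairs\<close>

lemma ndr_pair_topspace: "ndr_pair Z (topspace Z)"
  unfolding ndr_pair_def
  by (intro exI[of _ "\<lambda>_. 0"] exI[of _ snd]) (auto simp: continuous_map_const continuous_map_snd)

text \<open>Removing a cell of maximal dimension outside \<open>S\<close> leaves a subcomplex to
  which \<open>T\<close> attaches a single disc; transitivity then finishes the induction.\<close>

lemma ndr_pair_subcomplex:
  assumes cw: "cw_complex Y \<E> d" and S: "subcomplex Y \<E> S"
  shows "finite T \<Longrightarrow> subcomplex Y \<E> T \<Longrightarrow> S \<subseteq> T \<Longrightarrow> ndr_pair (subtopology Y (\<Union>T)) (\<Union>S)"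
proof (induction "card (T - S)" arbitrary: T)
  case 0
  then have "T = S" by auto
  moreover have "topspace (subtopology Y (\<Union>S)) = \<Union>S"
    using cw_complexD(3)[OF cw] S by (auto simp: subcomplex_def)
  ultimately show ?case using ndr_pair_topspace[of "subtopology Y (\<Union>S)"] by simp
next
  case (Suc k)
  have "T - S \<noteq> {}" "finite (T - S)" using Suc by auto
  then obtain e where e: "e \<in> T - S" and max: "\<And>e'. e' \<in> T - S \<Longrightarrow> d e' \<le> d e"
    using obtains_MAX[of "T - S" d] by (metis Max_ge finite_imageI imageI)
  have rem: "subcomplex Y \<E> (T - {e})"
    using subcomplex_remove_cell[OF cw S] Suc.prems e max by blast
  have "T - {e} - S = T - S - {e}" by blast
  then have "card (T - {e} - S) = k" using Suc.hyps(2) e Suc.prems by simp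
  then have IH: "ndr_pair (subtopology Y (\<Union>(T - {e}))) (\<Union>S)"
    using Suc.hyps(1)[of "T - {e}"] Suc.prems rem e by auto
  obtain \<phi> where \<phi>: "continuous_map (closed_disc (d e)) (subtopology Y (\<Union>T)) \<phi>"
    "\<And>x. x \<in> topspace (closed_disc (d e)) \<Longrightarrow> \<phi> x \<in> \<Union>(T - {e}) \<longleftrightarrow> x \<in> sphere_of_disc (d e)"
    "inj_on \<phi> (topspace (closed_disc (d e)) - sphere_of_disc (d e))"
    "\<Union>T \<subseteq> \<Union>(T - {e}) \<union> \<phi> ` topspace (closed_disc (d e))"
    by (rule attach_cell[OF cw Suc.prems(2) DiffD1[OF e] rem]) (rule that; assumption)
  have "ndr_pair (subtopology Y (\<Union>T)) (\<Union>(T - {e}))"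
  proof (rule ndr_pair_relative_homeomorphism[OF ndr_pair_disc compact_space_closed_disc _ \<phi>(1) _ _ \<phi>(2,3)])
    show "Hausdorff_space (subtopology Y (\<Union>T))"
      using cw_complexD(1)[OF cw] Hausdorff_space_subtopology by blast
    show "closedin (subtopology Y (\<Union>T)) (\<Union>(T - {e}))"
      using finite_subcomplex_compact(2)[OF cw _ rem] Suc.prems
      by (intro closedin_subset_topspace) auto
  qed (use \<phi>(4) in auto)
  moreover have "subtopology (subtopology Y (\<Union>T)) (\<Union>(T - {e})) = subtopology Y (\<Union>(T - {e}))"
    by (simp add: subtopology_subtopology) (metis Diff_subset Sup_subset_mono inf.absorb_iff2)
  ultimately show ?case using IH ndr_pair_trans by metis
qed

text \<open>The inclusion of \<open>W\<close> is a relative homeomorphism: the union is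
  \<open>C\<close> with \<open>W\<close> glued on along the intersection.\<close>

lemma ndr_pair_excision:
  assumes "compact_space Z" and "Hausdorff_space Z" and W: "closedin Z W" and C: "closedin Z C"
    and "ndr_pair (subtopology Z W) (W \<inter> C)"
  shows "ndr_pair (subtopology Z (W \<union> C)) C"
proof (rule ndr_pair_relative_homeomorphism[OF assms(5), where q = "\<lambda>x. x"])
  show "compact_space (subtopology Z W)"
    using assms closedin_compact_space compact_space_subtopology by blast
  show "Hausdorff_space (subtopology Z (W \<union> C))" using assms Hausdorff_space_subtopology by blast
  show "continuous_map (subtopology Z W) (subtopology Z (W \<union> C)) (\<lambda>x. x)"
    by (simp add: continuous_map_in_subtopology continuous_map_from_subtopology continuous_map_ident)
  show "closedin (subtopology Z (W \<union> C)) C"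
    using C by (intro closedin_subset_topspace) auto
qed (use closedin_subset[OF C] in auto)

text \<open>Let \<open>b\<close> arise from \<open>a\<close> by attaching a top cell, and let
  \<open>U\<close> be the part of \<open>b \<times> b\<close> with some coordinate in
  \<open>a\<close>. The diagonal of \<open>b\<close> meets \<open>U\<close> in the diagonal of
  \<open>a\<close>, which by induction is an NDR in \<open>a \<times> a\<close> and hence, through
  \<open>a \<times> b\<close>, in \<open>U\<close>; excision passes to the diagonal of
  \<open>b\<close> in its union with \<open>U\<close>. The rest of \<open>b \<times> b\<close> is
  the product of the new cell with itself, glued on by \<open>ndr_pair_disc_square\<close>.\<close>

lemma ndr_pair_diagonal_finite_subcomplex:
  assumes cw: "cw_complex Y \<E> d"
  shows "finite T \<Longrightarrow> subcomplex Y \<E> T \<Longrightarrow>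
    ndr_pair (prod_topology (subtopology Y (\<Union>T)) (subtopology Y (\<Union>T))) ((\<lambda>y. (y, y)) ` \<Union>T)"
proof (induction "card T" arbitrary: T)
  case 0
  then have "T = {}" by auto
  then show ?case
    using ndr_pair_topspace[of "prod_topology (subtopology Y (\<Union>T)) (subtopology Y (\<Union>T))"] by simp
next
  case (Suc k)
  have "T \<noteq> {}" using Suc by auto
  then obtain e where e: "e \<in> T" and max: "\<And>e'. e' \<in> T \<Longrightarrow> d e' \<le> d e"
    using Suc.prems obtains_MAX[of T d] by (metis Max_ge finite_imageI imageI)
  define S where "S = T - {e}"
  define a where "a = \<Union>S"
  define b where "b = \<Union>T"
  have S: "subcomplex Y \<E> S" "finite S" "S \<subseteq> T"
    using subcomplex_remove_cell[OF cw _ Suc.prems(2), of "{}" e] Suc.prems e max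
    by (auto simp: S_def subcomplex_def)
  have ab: "a \<subseteq> b" and bY: "b \<subseteq> topspace Y"
    using Suc.prems cw_complexD(3)[OF cw] by (auto simp: a_def b_def S_def subcomplex_def)
  let ?Z = "prod_topology (subtopology Y b) (subtopology Y b)"
  define U where "U = a \<times> b \<union> b \<times> a"
  define \<Delta> where "\<Delta> A = (\<lambda>y. (y, y)) ` A" for A :: "'a set"
  have compact_b: "compact_space (subtopology Y b)" and cl_a: "closedin (subtopology Y b) a"
    using finite_subcomplex_compact[OF cw] Suc.prems S ab
    by (auto simp: a_def b_def compact_space_subtopology intro: closedin_subset_topspace)
  have cl_b: "closedin (subtopology Y b) b"
    using closedin_topspace[of "subtopology Y b"] bY by (simp add: Int_absorb1)
  have haus_b: "Hausdorff_space (subtopology Y b)"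
    using cw_complexD(1)[OF cw] Hausdorff_space_subtopology by blast
  have Z: "compact_space ?Z" "Hausdorff_space ?Z"
    using compact_b haus_b by (auto simp: compact_space_prod_topology Hausdorff_space_prod_topology)
  have sub: "subtopology ?Z (A \<times> B) = prod_topology (subtopology Y A) (subtopology Y B)"
    if "A \<subseteq> b" "B \<subseteq> b" for A B
    using that by (simp add: subtopology_Times subtopology_subtopology Int_absorb1)
  have top: "topspace (subtopology Y A) = A" if "A \<subseteq> b" for A
    using that bY by auto
  have "card S = k" using Suc e by (simp add: S_def)
  then have IH: "ndr_pair (subtopology ?Z (a \<times> a)) (\<Delta> a)"
    using Suc.hyps(1)[of S] S sub[OF ab ab] by (simp add: a_def \<Delta>_def)
  have ba: "ndr_pair (subtopology Y b) a"
    using ndr_pair_subcomplex[OF cw S(1) Suc.prems(1,2) S(3)] by (simp add: a_def b_def)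
  have 1: "ndr_pair (subtopology ?Z (a \<times> b)) (a \<times> a)"
    using ndr_pair_prod[OF ba, of "subtopology Y a"] sub[OF ab] top[OF ab] by simp
  have 2: "ndr_pair (subtopology ?Z (b \<times> a)) (a \<times> a)"
    using ndr_pair_prod_left[OF ba, of "subtopology Y a"] sub[OF _ ab] top[OF ab] by simp
  have cl: "closedin ?Z (a \<times> b)" "closedin ?Z (b \<times> a)" "closedin ?Z U"
    using cl_a cl_b by (auto simp: closedin_prod_Times_iff U_def)
  have cl\<Delta>: "closedin ?Z (\<Delta> b)"
    using haus_b top[of b] by (simp add: Hausdorff_space_closedin_diagonal \<Delta>_def)
  have "(b \<times> a) \<inter> (a \<times> b) = a \<times> a" "b \<times> a \<union> a \<times> b = U" using ab by (auto simp: U_def)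
  then have 3: "ndr_pair (subtopology ?Z U) (a \<times> b)"
    using ndr_pair_excision[OF Z cl(2,1)] 2 by simp
  have subsub: "subtopology (subtopology ?Z B) A = subtopology ?Z A" if "A \<subseteq> B" for A B
    using that by (simp add: subtopology_subtopology Int_absorb1)
  have "a \<times> a \<subseteq> a \<times> b" "a \<times> b \<subseteq> U" using ab by (auto simp: U_def)
  note eq = this[THEN subsub]
  have "ndr_pair (subtopology ?Z (a \<times> b)) (\<Delta> a)"
    by (rule ndr_pair_trans[OF 1]) (simp only: eq IH)
  then have 4: "ndr_pair (subtopology ?Z U) (\<Delta> a)"
    by (intro ndr_pair_trans[OF 3]) (simp only: eq)
  have "U \<inter> \<Delta> b = \<Delta> a" using ab by (auto simp: U_def \<Delta>_def)
  then have 5: "ndr_pair (subtopology ?Z (U \<union> \<Delta> b)) (\<Delta> b)"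
    using ndr_pair_excision[OF Z cl(3) cl\<Delta>] 4 by simp
  let ?D = "closed_disc (d e)" and ?S = "sphere_of_disc (d e)"
  have S': "subcomplex Y \<E> (T - {e})" using S by (simp add: S_def)
  obtain \<phi> where \<phi>: "continuous_map ?D (subtopology Y b) \<phi>"
    and \<phi>S: "\<And>x. x \<in> topspace ?D \<Longrightarrow> \<phi> x \<in> a \<longleftrightarrow> x \<in> ?S"
    and inj: "inj_on \<phi> (topspace ?D - ?S)" and cover: "b \<subseteq> a \<union> \<phi> ` topspace ?D"
    by (rule attach_cell[OF cw Suc.prems(2) e S']) (rule that; simp add: a_def b_def S_def)
  have \<phi>b: "\<phi> x \<in> b" if "x \<in> topspace ?D" for x
    using continuous_map_funspace[OF \<phi>] that by auto
  \<comment> \<open>Outside \<open>U\<close> both coordinates lie in the new cell, where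
    \<open>\<phi>\<close> is injective; hence the diagonal of \<open>b\<close> pulls back there
    exactly to the diagonal of the disc.\<close>
  have "ndr_pair ?Z (U \<union> \<Delta> b)"
  proof (rule ndr_pair_relative_homeomorphism[OF ndr_pair_disc_square _ Z(2),
        where q = "\<lambda>p. (\<phi> (fst p), \<phi> (snd p))"])
    show "compact_space (prod_topology ?D ?D)"
      by (simp add: compact_space_prod_topology compact_space_closed_disc)
    show "continuous_map (prod_topology ?D ?D) ?Z (\<lambda>p. (\<phi> (fst p), \<phi> (snd p)))"
      by (rule continuous_map_pairedI[OF continuous_map_comp[OF continuous_map_fst \<phi>]
            continuous_map_comp[OF continuous_map_snd \<phi>]])
    show "closedin ?Z (U \<union> \<Delta> b)" using cl cl\<Delta> by blast
    show "topspace ?Z \<subseteq> U \<union> \<Delta> b \<union> (\<lambda>p. (\<phi> (fst p), \<phi> (snd p))) ` topspace (prod_topology ?D ?D)"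
    proof
      fix p assume "p \<in> topspace ?Z"
      then obtain y z where p: "p = (y, z)" "y \<in> b" "z \<in> b" by auto
      show "p \<in> U \<union> \<Delta> b \<union> (\<lambda>p. (\<phi> (fst p), \<phi> (snd p))) ` topspace (prod_topology ?D ?D)"
      proof (cases "y \<in> a \<or> z \<in> a")
        case True
        then show ?thesis using p by (auto simp: U_def)
      next
        case False
        then obtain u v where "u \<in> topspace ?D" "v \<in> topspace ?D" "y = \<phi> u" "z = \<phi> v"
          using p cover by blast
        then show ?thesis using p by (auto intro!: image_eqI[of _ _ "(u, v)"])
      qed
    qed
    show "(\<phi> (fst p), \<phi> (snd p)) \<in> U \<union> \<Delta> b \<longleftrightarrow>
        p \<in> {(x, y). x \<in> topspace ?D \<and> y \<in> topspace ?D \<and> (x \<in> ?S \<or> y \<in> ?S \<or> x = y)}"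
      if pD: "p \<in> topspace (prod_topology ?D ?D)" for p
    proof -
      obtain x y where p: "p = (x, y)" "x \<in> topspace ?D" "y \<in> topspace ?D" using pD by auto
      note b = \<phi>b[OF p(2)] \<phi>b[OF p(3)]
      have "(\<phi> x, \<phi> y) \<in> U \<longleftrightarrow> \<phi> x \<in> a \<or> \<phi> y \<in> a"
        using b unfolding U_def by blast
      then have "(\<phi> x, \<phi> y) \<in> U \<longleftrightarrow> x \<in> ?S \<or> y \<in> ?S"
        using \<phi>S[OF p(2)] \<phi>S[OF p(3)] by blast
      moreover have "(\<phi> x, \<phi> y) \<in> \<Delta> b \<longleftrightarrow> \<phi> x = \<phi> y"
        using b by (auto simp: \<Delta>_def)
      moreover have "\<phi> x = \<phi> y \<longleftrightarrow> x = y" if "x \<notin> ?S" "y \<notin> ?S"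
        by (rule inj_on_eq_iff[OF inj]) (use p that in simp_all)
      ultimately have "(\<phi> x, \<phi> y) \<in> U \<union> \<Delta> b \<longleftrightarrow> x \<in> ?S \<or> y \<in> ?S \<or> x = y"
        by blast
      then show ?thesis using p by simp
    qed
    show "inj_on (\<lambda>p. (\<phi> (fst p), \<phi> (snd p))) (topspace (prod_topology ?D ?D) -
        {(x, y). x \<in> topspace ?D \<and> y \<in> topspace ?D \<and> (x \<in> ?S \<or> y \<in> ?S \<or> x = y)})"
    proof (rule inj_onI, goal_cases)
      case (1 p q)
      then have "fst p \<in> topspace ?D - ?S" "snd p \<in> topspace ?D - ?S"
        "fst q \<in> topspace ?D - ?S" "snd q \<in> topspace ?D - ?S"
        by (auto simp: case_prod_beta)
      then show "p = q" using 1(3) inj_onD[OF inj] by (simp add: prod_eq_iff)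
    qed
  qed
  from ndr_pair_trans[OF this 5] show ?case by (simp add: b_def \<Delta>_def)
qed

section \<open>Countable complexes and graphs of maps\<close>

lemma continuous_map_prod_weak_topology:
  assumes K: "\<And>n. closedin Y (K n)" and cover: "topspace Y \<subseteq> (\<Union>n. K n)"
    and weak: "\<And>C. C \<subseteq> topspace Y \<Longrightarrow> (\<And>n. closedin Y (C \<inter> K n)) \<Longrightarrow> closedin Y C"
    and f: "\<And>n. continuous_map (prod_topology I01 (subtopology Y (K n))) Z f"
  shows "continuous_map (prod_topology I01 Y) Z f"
  unfolding continuous_map_def
proof (intro conjI allI impI)
  show "f \<in> topspace (prod_topology I01 Y) \<rightarrow> topspace Z"
  proof
    fix p assume p: "p \<in> topspace (prod_topology I01 Y)"
    then obtain t y n where "p = (t, y)" "y \<in> K n" using cover by (cases p) auto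
    then show "f p \<in> topspace Z"
      using p continuous_map_funspace[OF f[of n]] by (auto simp: Pi_iff)
  qed
next
  fix V assume V: "openin Z V"
  define U where "U = {p \<in> topspace (prod_topology I01 Y). f p \<in> V}"
  have "\<exists>N. openin (prod_topology I01 Y) N \<and> p \<in> N \<and> N \<subseteq> U" if p: "p \<in> U" for p
  proof -
    obtain t0 y0 where ty: "p = (t0, y0)" "t0 \<in> {0..1}" "y0 \<in> topspace Y" "f (t0, y0) \<in> V"
      using p by (auto simp: U_def)
    obtain n0 where n0: "y0 \<in> K n0" using ty(3) cover by blast
    have "continuous_map I01 Z (\<lambda>t. f (t, y0))"
      using continuous_map_prod_section[OF f[of n0], of y0] n0 ty(3) by simp
    from openin_continuous_map_preimage[OF this V]
    have "openin I01 {t \<in> {0..1}. f (t, y0) \<in> V}" by simp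
    then obtain \<epsilon> where \<epsilon>: "\<epsilon> > 0" "cball t0 \<epsilon> \<inter> {0..1} \<subseteq> {t \<in> {0..1}. f (t, y0) \<in> V}"
      unfolding openin_contains_cball using ty(2,4) by blast
    \<comment> \<open>The weak topology survives the product with the interval because the interval
      is locally compact: with a compact neighbourhood \<open>J\<close> of \<open>t0\<close>, the
      tube lemma over each \<open>K n\<close> shows that \<open>N\<close> is open in every piece,
      hence open.\<close>
    define J where "J = cball t0 \<epsilon> \<inter> {0..1}"
    have J: "J \<subseteq> {0..1}" "compact_space (top_of_set J)"
      by (auto simp: J_def compact_space_subtopology compact_Int)
    define N where "N = {y \<in> topspace Y. \<forall>t\<in>J. f (t, y) \<in> V}"
    have cl: "closedin Y ((topspace Y - N) \<inter> K n)" for n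
    proof -
      let ?W = "subtopology Y (K n)"
      have "continuous_map (prod_topology (top_of_set J) ?W) (prod_topology I01 ?W) (\<lambda>q. (fst q, snd q))"
        using J(1) continuous_map_fst[of "top_of_set J" ?W]
        by (intro continuous_map_pairedI continuous_map_snd) (auto simp: continuous_map_in_subtopology)
      from continuous_map_comp[OF this f]
      have "continuous_map (prod_topology (top_of_set J) ?W) Z f" by simp
      from openin_forall_compact[OF J(2) openin_continuous_map_preimage[OF this V]]
      have "closedin ?W (topspace ?W - {y \<in> topspace ?W. \<forall>t\<in>topspace (top_of_set J).
          (t, y) \<in> {q \<in> topspace (prod_topology (top_of_set J) ?W). f q \<in> V}})"
        by blast
      moreover have "topspace ?W - {y \<in> topspace ?W. \<forall>t\<in>topspace (top_of_set J).
          (t, y) \<in> {q \<in> topspace (prod_topology (top_of_set J) ?W). f q \<in> V}} = (topspace Y - N) \<inter> K n"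
        by (auto simp: N_def)
      ultimately have "closedin ?W ((topspace Y - N) \<inter> K n)" by (simp only:)
      then show ?thesis by (rule closedin_trans_full[OF _ K])
    qed
    have "closedin Y (topspace Y - N)" by (rule weak[OF Diff_subset cl])
    moreover have "N \<subseteq> topspace Y" by (auto simp: N_def)
    ultimately have "openin Y N" by (simp add: openin_closedin_eq)
    moreover have "openin I01 (ball t0 \<epsilon> \<inter> {0..1})" 
      using openin_open_Int[OF open_ball, of "{0..1}" t0 \<epsilon>] by (simp only: Int_commute)
    ultimately have "openin (prod_topology I01 Y) ((ball t0 \<epsilon> \<inter> {0..1}) \<times> N)"
      by (simp add: openin_prod_Times_iff)
    moreover have "p \<in> (ball t0 \<epsilon> \<inter> {0..1}) \<times> N"
      using ty \<epsilon> by (auto simp: N_def J_def)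
    moreover have "(ball t0 \<epsilon> \<inter> {0..1}) \<times> N \<subseteq> U"
      using ball_subset_cball[of t0 \<epsilon>] by (auto simp: N_def J_def U_def)
    ultimately show ?thesis by blast
  qed
  then have "openin (prod_topology I01 Y) U" by (subst openin_subopen) blast
  then show "openin (prod_topology I01 Y) {p \<in> topspace (prod_topology I01 Y). f p \<in> V}"
    by (simp add: U_def)
qed

lemma subcomplex_filtration:
  assumes cw: "cw_complex Y \<E> d" and "countable \<E>" and S\<^sub>0: "finite S\<^sub>0" "subcomplex Y \<E> S\<^sub>0"
  obtains S where "S (0::nat) = S\<^sub>0" and "\<And>n. finite (S n)" and "\<And>n. subcomplex Y \<E> (S n)"
    and "\<And>n. S n \<subseteq> S (Suc n)" and "\<E> \<subseteq> (\<Union>n. S n)"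
proof -
  obtain h where h: "\<And>e. e \<in> \<E> \<Longrightarrow> finite (h e) \<and> subcomplex Y \<E> (h e) \<and> e \<in> h e"
    using cell_in_finite_subcomplex[OF cw] by metis
  \<comment> \<open>The strict inequality makes \<open>I 0\<close> empty, so the filtration starts
    exactly at the given subcomplex; a cell with index \<open>i\<close> is present from stage
    \<open>Suc i\<close> on.\<close>
  define I where "I n = {e \<in> \<E>. to_nat_on \<E> e < n}" for n
  define S where "S n = (\<Union>A\<in>insert S\<^sub>0 (h ` I n). A)" for n
  have "finite (I n)" for n
  proof (rule inj_on_finite)
    show "inj_on (to_nat_on \<E>) (I n)"
      using inj_on_to_nat_on[OF \<open>countable \<E>\<close>] by (rule inj_on_subset) (auto simp: I_def)
    show "to_nat_on \<E> ` I n \<subseteq> {..<n}" by (auto simp: I_def)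
  qed simp
  show ?thesis
  proof (rule that[of S])
    show "S 0 = S\<^sub>0" by (simp add: S_def I_def)
    show "finite (S n)" for n
      unfolding S_def using S\<^sub>0 h \<open>finite (I n)\<close> by (auto simp: I_def)
    show "subcomplex Y \<E> (S n)" for n
      unfolding S_def using S\<^sub>0 h by (intro subcomplex_UN) (auto simp: I_def)
    show "S n \<subseteq> S (Suc n)" for n
      unfolding S_def by (intro UN_mono) (auto simp: I_def)
    show "\<E> \<subseteq> (\<Union>n. S n)"
    proof
      fix e assume e: "e \<in> \<E>"
      then have "e \<in> S (Suc (to_nat_on \<E> e))" using h[OF e] by (auto simp: S_def I_def)
      then show "e \<in> (\<Union>n. S n)" by blast
    qed
  qed
qed

text \<open>A retraction of the cylinder is extended stage by stage through a filtration by finite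
  subcomplexes. Each map restricts to its predecessor, so they glue, and the weak topology makes the
  result continuous; the NDR data are extracted only at the end.\<close>

lemma ndr_pair_finite_subcomplex:
  assumes cw: "cw_complex Y \<E> d" and "countable \<E>" and S\<^sub>0: "finite S\<^sub>0" "subcomplex Y \<E> S\<^sub>0"
  shows "ndr_pair Y (\<Union>S\<^sub>0)"
proof -
  obtain S where S0: "S (0::nat) = S\<^sub>0" and fin: "\<And>n. finite (S n)" and sub: "\<And>n. subcomplex Y \<E> (S n)"
    and inc: "\<And>n. S n \<subseteq> S (Suc n)" and cover: "\<E> \<subseteq> (\<Union>n. S n)"
    by (rule subcomplex_filtration[OF assms]) (rule that; assumption)
  define K where "K n = \<Union>(S n)" for n
  let ?Q = "extension_domain Y (K 0)"
  have K1: "closedin Y (K n)" for n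
    unfolding K_def by (rule finite_subcomplex_compact(2)[OF cw fin sub])
  note K = K1 closedin_subset[OF K1]
  have Kinc: "K n \<subseteq> K (Suc n)" for n using inc by (auto simp: K_def)
  have subK: "subtopology (subtopology Y (K (Suc n))) (K n) = subtopology Y (K n)" for n
    using Kinc[of n] by (simp add: subtopology_subtopology Int_absorb1)
  have cov: "topspace Y \<subseteq> (\<Union>n. K n)"
  proof
    fix y assume "y \<in> topspace Y"
    then obtain e where "e \<in> \<E>" "y \<in> e" using cw_complexD(3)[OF cw] by blast
    then obtain n where "e \<in> S n" using cover by blast
    then show "y \<in> (\<Union>n. K n)" using \<open>y \<in> e\<close> unfolding K_def by blast
  qed
  have "\<exists>g. \<forall>n. (continuous_map (prod_topology I01 (subtopology Y (K n))) ?Q (g n) \<and>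
          (\<forall>y\<in>K n. g n (0, y) = (0, y)) \<and> (\<forall>t\<in>{0..1}. \<forall>y\<in>K 0. g n (t, y) = (t, y))) \<and>
        (\<forall>t\<in>{0..1}. \<forall>y\<in>K n. g (Suc n) (t, y) = g n (t, y))"
  proof (rule dependent_nat_choice)
    show "\<exists>g. continuous_map (prod_topology I01 (subtopology Y (K 0))) ?Q g \<and>
        (\<forall>y\<in>K 0. g (0, y) = (0, y)) \<and> (\<forall>t\<in>{0..1}. \<forall>y\<in>K 0. g (t, y) = (t, y))"
      using continuous_map_extension_domain_side[OF subset_refl] by (intro exI[of _ "\<lambda>p. p"]) auto
  next
    fix g n
    assume g: "continuous_map (prod_topology I01 (subtopology Y (K n))) ?Q g \<and>
        (\<forall>y\<in>K n. g (0, y) = (0, y)) \<and> (\<forall>t\<in>{0..1}. \<forall>y\<in>K 0. g (t, y) = (t, y))"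
    have ndr: "ndr_pair (subtopology Y (K (Suc n))) (K n)"
      unfolding K_def by (rule ndr_pair_subcomplex[OF cw sub fin sub inc])
    obtain g' where g': "continuous_map (prod_topology I01 (subtopology Y (K (Suc n)))) ?Q g'"
      "\<And>y. y \<in> topspace (subtopology Y (K (Suc n))) \<Longrightarrow> g' (0, y) = (0, y)"
      "\<And>t y. t \<in> {0..1} \<Longrightarrow> y \<in> K n \<Longrightarrow> g' (t, y) = g (t, y)"
      by (rule ndr_pair_extension[OF ndr
            continuous_map_from_subtopology[OF continuous_map_extension_domain_bottom], of "K 0" g])
        (use g subK in auto)
    have "K 0 \<subseteq> K n" by (rule lift_Suc_mono_le[of K, OF Kinc]) simp
    then show "\<exists>g'. (continuous_map (prod_topology I01 (subtopology Y (K (Suc n)))) ?Q g' \<and>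
        (\<forall>y\<in>K (Suc n). g' (0, y) = (0, y)) \<and> (\<forall>t\<in>{0..1}. \<forall>y\<in>K 0. g' (t, y) = (t, y))) \<and>
        (\<forall>t\<in>{0..1}. \<forall>y\<in>K n. g' (t, y) = g (t, y))"
      using g g' K(2) by (intro exI[of _ g']) (auto simp: subset_iff)
  qed
  then obtain g where g: "\<And>n. continuous_map (prod_topology I01 (subtopology Y (K n))) ?Q (g n)"
    and g0: "\<And>n y. y \<in> K n \<Longrightarrow> g n (0, y) = (0, y)"
    and gK: "\<And>n t y. t \<in> {0..1} \<Longrightarrow> y \<in> K 0 \<Longrightarrow> g n (t, y) = (t, y)"
    and gS: "\<And>n t y. t \<in> {0..1} \<Longrightarrow> y \<in> K n \<Longrightarrow> g (Suc n) (t, y) = g n (t, y)"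
    by blast
  define N where "N y = (LEAST n. y \<in> K n)" for y
  define G where "G p = g (N (snd p)) p" for p
  have Gg: "G (t, y) = g n (t, y)" if t: "t \<in> {0..1}" and y: "y \<in> K n" for t y n
  proof -
    have "N y \<le> n" unfolding N_def using y by (rule Least_le)
    moreover have "y \<in> K (N y)" unfolding N_def using y by (rule LeastI)
    ultimately have "y \<in> K n \<and> g n (t, y) = g (N y) (t, y)"
    proof (induction n rule: dec_induct)
      case (step n)
      then show ?case using gS[OF t] Kinc[of n] by auto
    qed simp
    then show ?thesis by (simp add: G_def)
  qed
  have "continuous_map (prod_topology I01 Y) ?Q G"
  proof (rule continuous_map_prod_weak_topology[OF K(1) cov])
    show "continuous_map (prod_topology I01 (subtopology Y (K n))) ?Q G" for n
      by (rule continuous_map_eq[OF g[of n]]) (auto simp: Gg)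
    fix C assume C: "C \<subseteq> topspace Y" "\<And>n. closedin Y (C \<inter> K n)"
    show "closedin Y C"
    proof (rule cw_complexD(6)[OF cw C(1)])
      fix e assume "e \<in> \<E>"
      then obtain n where "e \<in> S n" using cover by blast
      then have "Y closure_of e \<subseteq> K n" using sub[of n] by (auto simp: subcomplex_def K_def)
      then have "C \<inter> Y closure_of e = (C \<inter> K n) \<inter> Y closure_of e" by blast
      then show "closedin Y (C \<inter> Y closure_of e)" using C(2)[of n] by (simp add: closedin_Int)
    qed
  qed
  then have "ndr_pair Y (K 0)"
  proof (rule retraction_imp_ndr_pair[OF K(1)])
    show "G (0, y) = (0, y)" if y: "y \<in> topspace Y" for y
    proof -
      obtain n where "y \<in> K n" using y cov by blast
      then show ?thesis using Gg[of 0 y n] g0 by simp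
    qed
    show "G (t, c) = (t, c)" if "t \<in> {0..1}" "c \<in> K 0" for t c
      using Gg[OF that] gK[OF that] by simp
  qed
  then show ?thesis by (simp add: K_def S0)
qed

text \<open>
  The deformation of a neighbourhood of the diagonal moves both coordinates \<open>(a, b)\<close>. Following the
  path of \<open>b\<close> until it meets that of \<open>a\<close>, and then the path of \<open>a\<close> backwards, moves \<open>b\<close> to \<open>a\<close>
  while \<open>a\<close> stays fixed; such a vertical deformation can be pulled back along \<open>f\<close>.
\<close>

lemma ndr_pair_graph:
  fixes f :: "'x \<Rightarrow> 'y"
  assumes cw: "cw_complex Y \<E> d" and "countable \<E>" and X: "compact_space X" and f: "continuous_map X Y f"
  shows "ndr_pair (prod_topology X Y) ((\<lambda>x. (x, f x)) ` topspace X)"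
proof -
  have "compactin Y (f ` topspace X)"
    using image_compactin[OF _ f] X by (simp add: compact_space_def)
  then obtain S where S: "finite S" "subcomplex Y \<E> S" "f ` topspace X \<subseteq> \<Union>S"
    using compact_in_finite_subcomplex[OF cw] by blast
  define K where "K = \<Union>S"
  let ?P = "prod_topology (subtopology Y K) Y" and ?\<Delta> = "(\<lambda>y. (y, y)) ` K"
  have KY: "K \<subseteq> topspace Y"
    using closedin_subset[OF finite_subcomplex_compact(2)[OF cw S(1,2)]] by (simp add: K_def)
  \<comment> \<open>The diagonal of \<open>K\<close> in \<open>K \<times> Y\<close> is reached
    through \<open>K \<times> K\<close>: the first inclusion is the finite case, the second is the
    NDR pair \<open>(Y, K)\<close> times \<open>K\<close>.\<close>
  have "ndr_pair ?P (K \<times> K)"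
    using ndr_pair_prod[OF ndr_pair_finite_subcomplex[OF cw \<open>countable \<E>\<close> S(1,2)], of "subtopology Y K"] KY
    by (simp add: K_def Int_absorb1)
  moreover have "subtopology ?P (K \<times> K) = prod_topology (subtopology Y K) (subtopology Y K)"
    by (simp add: subtopology_Times subtopology_subtopology)
  ultimately have ndr: "ndr_pair ?P ?\<Delta>"
    using ndr_pair_diagonal_finite_subcomplex[OF cw S(1,2)] ndr_pair_trans by (metis K_def)
  obtain v D where v: "continuous_map ?P I01 v" and D: "continuous_map (prod_topology I01 ?P) ?P D"
    and \<Delta>: "?\<Delta> = {z \<in> topspace ?P. v z = 0}" and D0: "\<And>z. z \<in> topspace ?P \<Longrightarrow> D (0, z) = z"
    and D\<Delta>: "\<And>t z. t \<in> {0..1} \<Longrightarrow> z \<in> ?\<Delta> \<Longrightarrow> D (t, z) = z"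
    and D1: "\<And>z. z \<in> topspace ?P \<Longrightarrow> v z < 1 \<Longrightarrow> D (1, z) \<in> ?\<Delta>"
    by (rule ndr_pairE[OF ndr]) (rule that; assumption)
  let ?Z = "prod_topology X Y" and ?T = "prod_topology I01 (prod_topology X Y)"
  have fK: "continuous_map X (subtopology Y K) f"
    using f S(3) by (auto simp: continuous_map_in_subtopology K_def)
  define z :: "'x \<times> 'y \<Rightarrow> 'y \<times> 'y" where "z = (\<lambda>p. (f (fst p), snd p))"
  define w where "w = (\<lambda>p. v (z p))"
  \<comment> \<open>A cutoff equal to 1 for \<open>w \<le> 1/2\<close> and to 0 for
    \<open>w \<ge> 3/4\<close>. The path may pass its turning point at \<open>\<sigma> = 1\<close>
    only where \<open>w < 1\<close>, so that both coordinates have met. The new function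
    \<open>min 1 (2 * w)\<close> is below 1 just where \<open>w < 1/2\<close>; there
    \<open>\<sigma>\<close> runs up to 2 and the path ends at \<open>f (fst p)\<close>.\<close>
  define \<kappa> where "\<kappa> p = max 0 (min 1 (3 - 4 * w p))" for p
  define \<sigma> where "\<sigma> q = 2 * fst q * \<kappa> (snd q)" for q
  define E where "E = (\<lambda>q. (fst (snd q), if \<sigma> q \<le> 1 then snd (D (\<sigma> q, z (snd q)))
                                          else fst (D (2 - \<sigma> q, z (snd q)))))"
  have z: "continuous_map ?Z ?P z"
    unfolding z_def
    by (rule continuous_map_pairedI[OF continuous_map_comp[OF continuous_map_fst fK] continuous_map_snd])
  have zP: "z p \<in> topspace ?P" if "p \<in> topspace ?Z" for p
    using continuous_map_funspace[OF z] that by blast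
  have w': "continuous_map ?Z I01 w" unfolding w_def by (rule continuous_map_comp[OF z v])
  then have w: "continuous_map ?Z euclideanreal w" by (simp add: continuous_map_in_subtopology)
  have w01: "0 \<le> w p" "w p \<le> 1" if "p \<in> topspace ?Z" for p
    using continuous_map_funspace[OF w'] that by (auto simp: Pi_iff)
  have "continuous_map ?Z euclideanreal \<kappa>"
    unfolding \<kappa>_def
    by (intro continuous_map_real_max continuous_map_real_min continuous_map_diff continuous_map_real_mult_left w)
      (simp_all add: continuous_map_const)
  then have \<kappa>: "continuous_map ?T euclideanreal (\<lambda>q. \<kappa> (snd q))"
    by (rule continuous_map_comp[OF continuous_map_snd])
  have \<kappa>01: "0 \<le> \<kappa> p" "\<kappa> p \<le> 1" for p by (auto simp: \<kappa>_def)
  have fstT: "continuous_map ?T euclideanreal fst"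
    using continuous_map_fst[of I01 ?Z] by (simp add: continuous_map_in_subtopology)
  have \<sigma>: "continuous_map ?T euclideanreal \<sigma>"
    unfolding \<sigma>_def by (intro continuous_map_real_mult continuous_map_real_mult_left fstT \<kappa>)
  have \<sigma>02: "0 \<le> \<sigma> q" "\<sigma> q \<le> 2" if "q \<in> topspace ?T" for q
  proof -
    have "0 \<le> fst q" "fst q \<le> 1" using that by auto
    then show "0 \<le> \<sigma> q" "\<sigma> q \<le> 2"
      using \<kappa>01[of "snd q"] mult_le_one[of "fst q" "\<kappa> (snd q)"] by (auto simp: \<sigma>_def)
  qed
  have zT: "continuous_map (subtopology ?T A) ?P (\<lambda>q. z (snd q))" for A
    by (rule continuous_map_from_subtopology[OF continuous_map_comp[OF continuous_map_snd z]])
  have E: "continuous_map ?T ?Z E"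
    unfolding E_def
  proof (rule continuous_map_pairedI[OF continuous_map_comp[OF continuous_map_snd continuous_map_fst]],
      rule continuous_map_cases_le[OF \<sigma>])
    show "continuous_map ?T euclideanreal (\<lambda>q. 1)" by (simp add: continuous_map_const)
    have "continuous_map (subtopology ?T {q \<in> topspace ?T. \<sigma> q \<le> 1}) I01 \<sigma>"
      using \<sigma>02 continuous_map_from_subtopology[OF \<sigma>] by (auto simp: continuous_map_in_subtopology)
    from continuous_map_comp[OF continuous_map_comp[OF continuous_map_pairedI[OF this zT] D] continuous_map_snd]
    show "continuous_map (subtopology ?T {q \<in> topspace ?T. \<sigma> q \<le> 1}) Y (\<lambda>q. snd (D (\<sigma> q, z (snd q))))" .
    have "continuous_map (subtopology ?T {q \<in> topspace ?T. 1 \<le> \<sigma> q}) euclideanreal (\<lambda>q. 2 - \<sigma> q)"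
      by (intro continuous_map_diff continuous_map_from_subtopology[OF \<sigma>]) (simp add: continuous_map_const)
    then have "continuous_map (subtopology ?T {q \<in> topspace ?T. 1 \<le> \<sigma> q}) I01 (\<lambda>q. 2 - \<sigma> q)"
      using \<sigma>02 by (auto simp: continuous_map_in_subtopology)
    from continuous_map_comp[OF continuous_map_comp[OF continuous_map_pairedI[OF this zT] D] continuous_map_fst]
    show "continuous_map (subtopology ?T {q \<in> topspace ?T. 1 \<le> \<sigma> q}) Y (\<lambda>q. fst (D (2 - \<sigma> q, z (snd q))))"
      by (simp add: continuous_map_in_subtopology)
  next
    fix q assume q: "q \<in> topspace ?T" "\<sigma> q = 1"
    then have "\<kappa> (snd q) \<noteq> 0" by (auto simp: \<sigma>_def)
    then have "v (z (snd q)) < 1" by (auto simp: \<kappa>_def w_def)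
    then have "D (1, z (snd q)) \<in> ?\<Delta>" using q zP[of "snd q"] by (intro D1) auto
    then show "snd (D (\<sigma> q, z (snd q))) = fst (D (2 - \<sigma> q, z (snd q)))" using q by auto
  qed
  have "continuous_map ?Z euclideanreal (\<lambda>p. min 1 (2 * w p))"
    by (intro continuous_map_real_min continuous_map_real_mult_left w) (simp add: continuous_map_const)
  then have u: "continuous_map ?Z I01 (\<lambda>p. min 1 (2 * w p))"
    using w01 by (auto simp: continuous_map_in_subtopology)
  have graph: "p \<in> (\<lambda>x. (x, f x)) ` topspace X \<longleftrightarrow> p \<in> topspace ?Z \<and> z p \<in> ?\<Delta>" for p
    using continuous_map_funspace[OF fK] KY by (auto simp: z_def image_iff)
  have min0: "min 1 (2 * w p) = 0 \<longleftrightarrow> w p = 0" for p by (auto simp: min_def)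
  have zw: "z p \<in> ?\<Delta> \<longleftrightarrow> w p = 0" if "p \<in> topspace ?Z" for p
    unfolding \<Delta> using zP[OF that] by (simp add: w_def)
  have "(\<lambda>x. (x, f x)) ` topspace X = {p \<in> topspace ?Z. min 1 (2 * w p) = 0}"
    by (rule set_eqI, unfold graph mem_Collect_eq min0) (intro conj_cong refl zw)
  moreover have "E (0, p) = p" if "p \<in> topspace ?Z" for p
    using D0[OF zP[OF that]] by (simp add: E_def \<sigma>_def) (simp add: z_def)
  moreover have "E (t, p) = p" if t: "t \<in> {0..1}" and p: "p \<in> (\<lambda>x. (x, f x)) ` topspace X" for t p
  proof -
    have "(t, p) \<in> topspace ?T" using t p graph by auto
    note \<sigma>02 = \<sigma>02[OF this]
    have p': "z p \<in> ?\<Delta>" using p graph by blast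
    have "D (\<sigma> (t, p), z p) = z p" if "\<sigma> (t, p) \<le> 1" using D\<Delta>[OF _ p'] \<sigma>02 that by simp
    moreover have "D (2 - \<sigma> (t, p), z p) = z p" if "\<not> \<sigma> (t, p) \<le> 1" using D\<Delta>[OF _ p'] \<sigma>02 that by simp
    moreover have "fst (z p) = snd p" "snd (z p) = snd p" using p by (auto simp: z_def)
    ultimately show ?thesis by (simp add: E_def)
  qed
  moreover have "E (1, p) \<in> (\<lambda>x. (x, f x)) ` topspace X"
    if p: "p \<in> topspace ?Z" and "min 1 (2 * w p) < 1" for p
  proof -
    have "\<kappa> p = 1" using that by (auto simp: \<kappa>_def)
    then have "E (1, p) = (fst p, f (fst p))"
      using D0[OF zP[OF p]] by (simp add: E_def \<sigma>_def) (simp add: z_def)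
    then show ?thesis using p by auto
  qed
  ultimately show ?thesis
    unfolding ndr_pair_def
    by (intro exI[of _ "\<lambda>p. min 1 (2 * w p)"] exI[of _ E] conjI u E) auto
qed

text \<open>The axis meets the graph in one point, and the graph is a copy of \<open>X\<close>, so
  the union theorem reduces to the non-degenerate basepoint of \<open>X\<close>.\<close>

lemma ndr_pair_axis_graph:
  assumes X: "compact_space X" "Hausdorff_space X" "ndr_pair X {x\<^sub>0}" and Y: "Hausdorff_space Y"
    and f: "continuous_map X Y f" and graph: "ndr_pair (prod_topology X Y) ((\<lambda>x. (x, f x)) ` topspace X)"
  shows "ndr_pair (prod_topology X Y) ({x\<^sub>0} \<times> topspace Y \<union> (\<lambda>x. (x, f x)) ` topspace X)"
proof (rule ndr_pair_Un[OF ndr_pair_prod_left[OF X(3)] graph])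
  let ?Z = "prod_topology X Y" and ?\<Gamma> = "(\<lambda>x. (x, f x)) ` topspace X"
  have fY: "f x \<in> topspace Y" if "x \<in> topspace X" for x
    using continuous_map_funspace[OF f] that by blast
  have x\<^sub>0: "x\<^sub>0 \<in> topspace X" using ndr_pair_subset[OF X(3)] by simp
  show "ndr_pair (subtopology ?Z ?\<Gamma>) ({x\<^sub>0} \<times> topspace Y \<inter> ?\<Gamma>)"
  proof (rule ndr_pair_relative_homeomorphism[OF X(3,1), where q = "\<lambda>x. (x, f x)"])
    show "Hausdorff_space (subtopology ?Z ?\<Gamma>)"
      using X Y by (simp add: Hausdorff_space_subtopology Hausdorff_space_prod_topology)
    show "continuous_map X (subtopology ?Z ?\<Gamma>) (\<lambda>x. (x, f x))"
      by (rule continuous_map_into_subtopology[OF continuous_map_pairedI[OF continuous_map_ident f]]) auto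
    show "closedin (subtopology ?Z ?\<Gamma>) ({x\<^sub>0} \<times> topspace Y \<inter> ?\<Gamma>)"
      using ndr_pair_closedin[OF ndr_pair_prod_left[OF X(3), of Y]] unfolding closedin_subtopology by blast
  qed (use fY x\<^sub>0 in \<open>auto simp: inj_on_def\<close>)
qed

section \<open>Fibrewise homotopy equivalences relative to a subspace\<close>

text \<open>Free homotopy is the case \<open>C = {}\<close>. Stationarity mentions \<open>a\<close>
  alone; for \<open>C\<close> inside \<open>topspace Z\<close> the end condition then gives
  agreement with \<open>b\<close>, whence that side condition in symmetry and transitivity.\<close>

definition rel_homotopic ::
    "'a topology \<Rightarrow> 'b topology \<Rightarrow> 'a set \<Rightarrow> ('a \<Rightarrow> 'b) \<Rightarrow> ('a \<Rightarrow> 'b) \<Rightarrow> bool" where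
  "rel_homotopic Z Y C a b \<longleftrightarrow>
     (\<exists>H. continuous_map (prod_topology I01 Z) Y H \<and>
          (\<forall>z\<in>topspace Z. H (0, z) = a z) \<and> (\<forall>z\<in>topspace Z. H (1, z) = b z) \<and>
          (\<forall>t\<in>{0..1}. \<forall>z\<in>C. H (t, z) = a z))"

lemma rel_homotopicE:
  assumes "rel_homotopic Z Y C a b"
  obtains H where "continuous_map (prod_topology I01 Z) Y H"
    and "\<And>z. z \<in> topspace Z \<Longrightarrow> H (0, z) = a z" and "\<And>z. z \<in> topspace Z \<Longrightarrow> H (1, z) = b z"
    and "\<And>t z. t \<in> {0..1} \<Longrightarrow> z \<in> C \<Longrightarrow> H (t, z) = a z"
proof -
  from assms obtain H where H: "continuous_map (prod_topology I01 Z) Y H"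
    "\<forall>z\<in>topspace Z. H (0, z) = a z" "\<forall>z\<in>topspace Z. H (1, z) = b z"
    "\<forall>t\<in>{0..1}. \<forall>z\<in>C. H (t, z) = a z"
    unfolding rel_homotopic_def by blast
  show thesis by (rule that[of H]) (use H in blast)+
qed

lemma homotopic_imp_rel_homotopic:
  assumes "homotopic_with P Z Y a b"
  shows "rel_homotopic Z Y {} a b"
  using assms unfolding homotopic_with_def rel_homotopic_def by auto

lemma rel_homotopic_empty: "rel_homotopic Z Y C a b \<Longrightarrow> rel_homotopic Z Y {} a b"
  unfolding rel_homotopic_def by auto

lemma rel_homotopic_sym:
  assumes "rel_homotopic Z Y C a b" and C: "C \<subseteq> topspace Z"
  shows "rel_homotopic Z Y C b a"
proof -
  obtain H where H: "continuous_map (prod_topology I01 Z) Y H"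
    and H01: "\<And>z. z \<in> topspace Z \<Longrightarrow> H (0, z) = a z" "\<And>z. z \<in> topspace Z \<Longrightarrow> H (1, z) = b z"
    and HC: "\<And>t z. t \<in> {0..1} \<Longrightarrow> z \<in> C \<Longrightarrow> H (t, z) = a z"
    by (rule rel_homotopicE[OF assms(1)]) (rule that; assumption)
  have "continuous_map (prod_topology I01 Z) euclideanreal (\<lambda>p. 1 - fst p)"
    using continuous_map_fst[of I01 Z]
    by (intro continuous_map_diff) (auto simp: continuous_map_const continuous_map_in_subtopology)
  then have "continuous_map (prod_topology I01 Z) I01 (\<lambda>p. 1 - fst p)"
    by (auto simp: continuous_map_in_subtopology)
  from continuous_map_comp[OF continuous_map_pairedI[OF this continuous_map_snd] H]
  have "continuous_map (prod_topology I01 Z) Y (\<lambda>p. H (1 - fst p, snd p))" .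
  moreover have "a z = b z" if "z \<in> C" for z
    using HC[of 1 z] H01(2)[of z] that C by auto
  ultimately show ?thesis
    unfolding rel_homotopic_def
    by (intro exI[of _ "\<lambda>p. H (1 - fst p, snd p)"]) (use H01 HC in auto)
qed

lemma rel_homotopic_trans:
  assumes ab: "rel_homotopic Z Y C a b" and bc: "rel_homotopic Z Y C b c" and C: "C \<subseteq> topspace Z"
  shows "rel_homotopic Z Y C a c"
proof -
  obtain H where H: "continuous_map (prod_topology I01 Z) Y H"
    and H01: "\<And>z. z \<in> topspace Z \<Longrightarrow> H (0, z) = a z" "\<And>z. z \<in> topspace Z \<Longrightarrow> H (1, z) = b z"
    and HC: "\<And>t z. t \<in> {0..1} \<Longrightarrow> z \<in> C \<Longrightarrow> H (t, z) = a z"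
    by (rule rel_homotopicE[OF ab]) (rule that; assumption)
  obtain K where K: "continuous_map (prod_topology I01 Z) Y K"
    and K01: "\<And>z. z \<in> topspace Z \<Longrightarrow> K (0, z) = b z" "\<And>z. z \<in> topspace Z \<Longrightarrow> K (1, z) = c z"
    and KC: "\<And>t z. t \<in> {0..1} \<Longrightarrow> z \<in> C \<Longrightarrow> K (t, z) = b z"
    by (rule rel_homotopicE[OF bc]) (rule that; assumption)
  let ?T = "prod_topology I01 Z"
  have fst': "continuous_map ?T euclideanreal fst"
    using continuous_map_fst[of I01 Z] by (simp add: continuous_map_in_subtopology)
  define L where "L p = (if fst p \<le> 1/2 then H (2 * fst p, snd p) else K (2 * fst p - 1, snd p))" for p
  have "continuous_map ?T Y L"
    unfolding L_def
  proof (rule continuous_map_cases_le[OF fst'])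
    show "continuous_map ?T euclideanreal (\<lambda>p. 1/2)" by (simp add: continuous_map_const)
    have "continuous_map (subtopology ?T {p \<in> topspace ?T. fst p \<le> 1/2}) I01 (\<lambda>p. 2 * fst p)"
      using continuous_map_real_mult_left[OF continuous_map_from_subtopology[OF fst']]
      by (auto simp: continuous_map_in_subtopology)
    from continuous_map_comp[OF continuous_map_pairedI[OF this
        continuous_map_from_subtopology[OF continuous_map_snd]] H]
    show "continuous_map (subtopology ?T {p \<in> topspace ?T. fst p \<le> 1/2}) Y (\<lambda>p. H (2 * fst p, snd p))" .
    have "continuous_map (subtopology ?T {p \<in> topspace ?T. 1/2 \<le> fst p}) euclideanreal (\<lambda>p. 2 * fst p - 1)"
      by (intro continuous_map_diff continuous_map_real_mult_left continuous_map_from_subtopology[OF fst'])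
        (simp add: continuous_map_const)
    then have "continuous_map (subtopology ?T {p \<in> topspace ?T. 1/2 \<le> fst p}) I01 (\<lambda>p. 2 * fst p - 1)"
      by (auto simp: continuous_map_in_subtopology)
    from continuous_map_comp[OF continuous_map_pairedI[OF this
        continuous_map_from_subtopology[OF continuous_map_snd]] K]
    show "continuous_map (subtopology ?T {p \<in> topspace ?T. 1/2 \<le> fst p}) Y (\<lambda>p. K (2 * fst p - 1, snd p))" .
    show "H (2 * fst p, snd p) = K (2 * fst p - 1, snd p)" if p: "p \<in> topspace ?T" "fst p = 1/2" for p
    proof -
      have "2 * fst p = 1" "2 * fst p - 1 = 0" "snd p \<in> topspace Z" using p by auto
      then show ?thesis using H01(2)[of "snd p"] K01(1)[of "snd p"] by (simp only:)
    qed
  qed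
  moreover have "L (t, z) = a z" if "t \<in> {0..1}" "z \<in> C" for t z
    using that HC[of "2 * t" z] KC[of "2 * t - 1" z] HC[of 1 z] H01(2)[of z] C
    by (auto simp: L_def)
  ultimately show ?thesis
    unfolding rel_homotopic_def
    by (intro exI[of _ L]) (use H01 K01 in \<open>auto simp: L_def\<close>)
qed

text \<open>
  A map \<open>a : X \<times> Y \<rightarrow> Y\<close> stands for the self-map \<open>(x, y) \<mapsto> (x, a (x, y))\<close> of \<open>X \<times> Y\<close> over \<open>X\<close>; it acts
  on \<open>map(X, Y)\<close> by \<open>h \<mapsto> (x \<mapsto> a (x, h x))\<close>. The identity is \<open>snd\<close>.
\<close>

definition fibre_comp :: "('x \<times> 'y \<Rightarrow> 'y) \<Rightarrow> ('x \<times> 'y \<Rightarrow> 'y) \<Rightarrow> 'x \<times> 'y \<Rightarrow> 'y" (infixl "\<star>" 70) where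
  "(a \<star> b) p = a (fst p, b p)"

lemma fibre_comp_assoc: "(a \<star> b) \<star> c = a \<star> (b \<star> c)"
  by (simp add: fun_eq_iff fibre_comp_def)

lemma snd_fibre_comp: "snd \<star> a = a" and fibre_comp_snd: "a \<star> snd = a"
  by (simp_all add: fun_eq_iff fibre_comp_def)

lemma continuous_map_fibre:
  "continuous_map (prod_topology X Y) Y b \<Longrightarrow>
   continuous_map (prod_topology X Y) (prod_topology X Y) (\<lambda>p. (fst p, b p))"
  by (rule continuous_map_pairedI[OF continuous_map_fst])

lemma continuous_map_fibre_comp:
  assumes "continuous_map (prod_topology X Y) Y a" and "continuous_map (prod_topology X Y) Y b"
  shows "continuous_map (prod_topology X Y) Y (a \<star> b)"
  unfolding fibre_comp_def[abs_def] by (rule continuous_map_comp[OF continuous_map_fibre[OF assms(2)] assms(1)])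

lemma rel_homotopic_fibre_comp_left:
  assumes "rel_homotopic (prod_topology X Y) Y C' a a'" and b: "continuous_map (prod_topology X Y) Y b"
    and bC: "\<And>p. p \<in> C \<Longrightarrow> (fst p, b p) \<in> C'"
  shows "rel_homotopic (prod_topology X Y) Y C (a \<star> b) (a' \<star> b)"
proof -
  let ?Z = "prod_topology X Y"
  obtain H where H: "continuous_map (prod_topology I01 ?Z) Y H"
    and H01: "\<And>z. z \<in> topspace ?Z \<Longrightarrow> H (0, z) = a z" "\<And>z. z \<in> topspace ?Z \<Longrightarrow> H (1, z) = a' z"
    and HC: "\<And>t z. t \<in> {0..1} \<Longrightarrow> z \<in> C' \<Longrightarrow> H (t, z) = a z"
    by (rule rel_homotopicE[OF assms(1)]) (rule that; assumption)
  have b': "(fst p, b p) \<in> topspace ?Z" if "p \<in> topspace ?Z" for p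
    using continuous_map_funspace[OF continuous_map_fibre[OF b]] that by blast
  from continuous_map_comp[OF continuous_map_pairedI[OF continuous_map_fst
      continuous_map_comp[OF continuous_map_snd continuous_map_fibre[OF b]]] H]
  have "continuous_map (prod_topology I01 ?Z) Y (\<lambda>q. H (fst q, (fst (snd q), b (snd q))))" .
  then show ?thesis
    unfolding rel_homotopic_def fibre_comp_def
    by (intro exI[of _ "\<lambda>q. H (fst q, (fst (snd q), b (snd q)))"])
      (use H01 HC bC b' in \<open>simp del: topspace_prod_topology\<close>)
qed

lemma rel_homotopic_fibre_comp_right:
  assumes "rel_homotopic (prod_topology X Y) Y C b b'" and a: "continuous_map (prod_topology X Y) Y a"
  shows "rel_homotopic (prod_topology X Y) Y C (a \<star> b) (a \<star> b')"
proof -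
  let ?Z = "prod_topology X Y"
  obtain H where H: "continuous_map (prod_topology I01 ?Z) Y H"
    and H01: "\<And>z. z \<in> topspace ?Z \<Longrightarrow> H (0, z) = b z" "\<And>z. z \<in> topspace ?Z \<Longrightarrow> H (1, z) = b' z"
    and HC: "\<And>t z. t \<in> {0..1} \<Longrightarrow> z \<in> C \<Longrightarrow> H (t, z) = b z"
    by (rule rel_homotopicE[OF assms(1)]) (rule that; assumption)
  from continuous_map_comp[OF continuous_map_pairedI[OF
      continuous_map_comp[OF continuous_map_snd continuous_map_fst] H] a]
  have "continuous_map (prod_topology I01 ?Z) Y (\<lambda>q. a (fst (snd q), H q))" .
  then show ?thesis
    unfolding rel_homotopic_def fibre_comp_def
    by (intro exI[of _ "\<lambda>q. a (fst (snd q), H q)"]) (use H01 HC in \<open>simp del: topspace_prod_topology\<close>)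
qed

text \<open>
  A map that is freely homotopic to the identity and fixes \<open>C\<close> has a left inverse rel \<open>C\<close>. Undoing
  the track of \<open>C\<close> under the homotopy makes the composite homotopic to the identity along the track
  followed by its inverse, and this loop is contracted by homotopy extension on \<open>[0, 1] \<times> X \<times> Y\<close>.
\<close>

lemma left_inverse_rel_of_homotopic_identity:
  assumes ndr: "ndr_pair (prod_topology X Y) C"
    and \<theta>: "continuous_map (prod_topology X Y) Y \<theta>" and \<theta>C: "\<And>p. p \<in> C \<Longrightarrow> \<theta> p = snd p"
    and hom: "rel_homotopic (prod_topology X Y) Y {} \<theta> snd"
  obtains \<theta>' where "continuous_map (prod_topology X Y) Y \<theta>'" and "\<And>p. p \<in> C \<Longrightarrow> \<theta>' p = snd p"
    and "rel_homotopic (prod_topology X Y) Y C (\<theta>' \<star> \<theta>) snd"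
proof -
  let ?Z = "prod_topology X Y"
  let ?T = "prod_topology I01 ?Z"
  have CZ: "C \<subseteq> topspace ?Z" using ndr_pair_subset[OF ndr] .
  obtain H where H: "continuous_map ?T Y H"
    and H0: "\<And>z. z \<in> topspace ?Z \<Longrightarrow> H (0, z) = \<theta> z" and H1: "\<And>z. z \<in> topspace ?Z \<Longrightarrow> H (1, z) = snd z"
    using hom unfolding rel_homotopic_def by blast
  have HC: "continuous_map (prod_topology I01 (subtopology ?Z C)) Y H"
    using continuous_map_from_subtopology[OF H] by (simp add: prod_topology_subtopology)
  \<comment> \<open>\<open>K\<close> moves the identity so that \<open>C\<close> follows its track
    under \<open>H\<close>; its end \<open>\<theta>'\<close> is therefore homotopic to the identity
    and fixes \<open>C\<close>.\<close>
  obtain K where K: "continuous_map ?T Y K"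
    and K0: "\<And>z. z \<in> topspace ?Z \<Longrightarrow> K (0, z) = snd z"
    and KC: "\<And>t c. t \<in> {0..1} \<Longrightarrow> c \<in> C \<Longrightarrow> K (t, c) = H (t, c)"
    by (rule ndr_pair_extension[OF ndr continuous_map_snd HC]) (use H0 \<theta>C CZ in auto)
  define \<theta>' where "\<theta>' p = K (1, p)" for p
  have \<theta>': "continuous_map ?Z Y \<theta>'"
    unfolding \<theta>'_def using continuous_map_prod_section'[OF K] by simp
  have \<theta>'C: "\<theta>' p = snd p" if "p \<in> C" for p
    using that KC[of 1 p] H1[of p] CZ by (auto simp: \<theta>'_def)
  have fst': "continuous_map ?T euclideanreal fst"
    using continuous_map_fst[of I01 ?Z] by (simp add: continuous_map_in_subtopology)
  have \<theta>Z: "(fst p, \<theta> p) \<in> topspace ?Z" if "p \<in> topspace ?Z" for p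
    using continuous_map_funspace[OF continuous_map_fibre[OF \<theta>]] that by blast
  \<comment> \<open>First \<open>K\<close> backwards after \<open>\<theta>\<close>, from
    \<open>\<theta>' \<star> \<theta>\<close> to \<open>\<theta>\<close>, then \<open>H\<close> from
    \<open>\<theta>\<close> to the identity. On \<open>C\<close> this is the track of
    \<open>H\<close> traversed backwards and then forwards.\<close>
  define L where "L q = (if fst q \<le> 1/2 then K (1 - 2 * fst q, (fst (snd q), \<theta> (snd q)))
                         else H (2 * fst q - 1, snd q))" for q
  have L: "continuous_map ?T Y L"
    unfolding L_def
  proof (rule continuous_map_cases_le[OF fst'])
    show "continuous_map ?T euclideanreal (\<lambda>p. 1/2)" by (simp add: continuous_map_const)
    have "continuous_map (subtopology ?T {q \<in> topspace ?T. fst q \<le> 1/2}) euclideanreal (\<lambda>q. 1 - 2 * fst q)"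
      by (intro continuous_map_diff continuous_map_real_mult_left continuous_map_from_subtopology[OF fst'])
        (simp add: continuous_map_const)
    then have "continuous_map (subtopology ?T {q \<in> topspace ?T. fst q \<le> 1/2}) I01 (\<lambda>q. 1 - 2 * fst q)"
      by (auto simp: continuous_map_in_subtopology)
    from continuous_map_comp[OF continuous_map_pairedI[OF this continuous_map_from_subtopology[OF
        continuous_map_comp[OF continuous_map_snd continuous_map_fibre[OF \<theta>]]]] K]
    show "continuous_map (subtopology ?T {q \<in> topspace ?T. fst q \<le> 1/2}) Y
        (\<lambda>q. K (1 - 2 * fst q, (fst (snd q), \<theta> (snd q))))" .
    have "continuous_map (subtopology ?T {q \<in> topspace ?T. 1/2 \<le> fst q}) euclideanreal (\<lambda>q. 2 * fst q - 1)"
      by (intro continuous_map_diff continuous_map_real_mult_left continuous_map_from_subtopology[OF fst'])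
        (simp add: continuous_map_const)
    then have "continuous_map (subtopology ?T {q \<in> topspace ?T. 1/2 \<le> fst q}) I01 (\<lambda>q. 2 * fst q - 1)"
      by (auto simp: continuous_map_in_subtopology)
    from continuous_map_comp[OF continuous_map_pairedI[OF this
        continuous_map_from_subtopology[OF continuous_map_snd]] H]
    show "continuous_map (subtopology ?T {q \<in> topspace ?T. 1/2 \<le> fst q}) Y (\<lambda>q. H (2 * fst q - 1, snd q))" .
    show "K (1 - 2 * fst q, (fst (snd q), \<theta> (snd q))) = H (2 * fst q - 1, snd q)"
      if q: "q \<in> topspace ?T" "fst q = 1/2" for q
    proof -
      have e: "1 - 2 * fst q = 0" "2 * fst q - 1 = 0" and Z: "snd q \<in> topspace ?Z" using q by auto
      show ?thesis unfolding e using K0[OF \<theta>Z[OF Z]] H0[OF Z] by simp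
    qed
  qed
  have LC: "L (s, c) = H (\<bar>2 * s - 1\<bar>, c)" if s: "s \<in> {0..1}" and c: "c \<in> C" for s c
  proof -
    have "\<bar>2 * s - 1\<bar> = (if s \<le> 1/2 then 1 - 2 * s else 2 * s - 1)" by auto
    then show ?thesis using s KC[of "1 - 2 * s" c] \<theta>C[OF c] c by (simp add: L_def)
  qed
  \<comment> \<open>Raising every time below \<open>r\<close> to \<open>r\<close> contracts this
    loop to the value of \<open>H\<close> at time 1. On the sides \<open>s = 0\<close>,
    \<open>s = 1\<close> and \<open>r = 1\<close> of the square the maximum is 1, so
    \<open>h\<close> is \<open>snd\<close> there.\<close>
  define h where "h = (\<lambda>u. H (max (fst u) \<bar>2 * fst (snd u) - 1\<bar>, snd (snd u)))"
  have "continuous_map (prod_topology I01 ?T) euclideanreal fst"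
    "continuous_map (prod_topology I01 ?T) euclideanreal (\<lambda>u. fst (snd u))"
    using continuous_map_fst[of I01 ?T] continuous_map_comp[OF continuous_map_snd fst', of I01]
    by (simp_all add: continuous_map_in_subtopology)
  then have "continuous_map (prod_topology I01 ?T) euclideanreal (\<lambda>u. max (fst u) \<bar>2 * fst (snd u) - 1\<bar>)"
    by (intro continuous_map_real_max continuous_map_real_abs continuous_map_diff continuous_map_real_mult_left)
      (simp_all add: continuous_map_const)
  then have "continuous_map (prod_topology I01 ?T) I01 (\<lambda>u. max (fst u) \<bar>2 * fst (snd u) - 1\<bar>)"
    by (auto simp: continuous_map_in_subtopology)
  from continuous_map_comp[OF continuous_map_pairedI[OF this
      continuous_map_comp[OF continuous_map_snd continuous_map_snd]] H]
  have h: "continuous_map (prod_topology I01 ?T) Y h" unfolding h_def .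
  obtain M where M: "continuous_map (prod_topology I01 ?T) Y M"
    and M0: "\<And>q. q \<in> topspace ?T \<Longrightarrow> M (0, q) = L q"
    and MC: "\<And>r q. r \<in> {0..1} \<Longrightarrow> q \<in> {0..1} \<times> C \<Longrightarrow> M (r, q) = h (r, q)"
  proof (rule ndr_pair_extension[OF ndr_pair_prod[OF ndr, of I01] L])
    show "continuous_map (prod_topology I01 (subtopology ?T (topspace I01 \<times> C))) Y h"
      using continuous_map_from_subtopology[OF h] by (simp add: prod_topology_subtopology(2))
    show "h (0, q) = L q" if "q \<in> topspace I01 \<times> C" for q
      using that LC by (auto simp: h_def)
  qed (rule that, assumption, assumption, simp)
  have Mr: "continuous_map ?T Y (\<lambda>u. M (fst u, (s, snd u)))" if s: "s \<in> {0..1}" for s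
  proof -
    have "continuous_map ?T (prod_topology I01 ?T) (\<lambda>u. (fst u, (s, snd u)))"
      using s by (intro continuous_map_pairedI continuous_map_fst continuous_map_snd)
        (simp add: continuous_map_const)
    from continuous_map_comp[OF this M] show ?thesis .
  qed
  \<comment> \<open>Instead of \<open>L\<close>, the homotopy runs along the other three sides of
    the \<open>(r, s)\<close> square; on all of them \<open>C\<close> stays fixed.\<close>
  have end1: "rel_homotopic ?Z Y C (\<theta>' \<star> \<theta>) (\<lambda>p. M (1, (0, p)))"
    unfolding rel_homotopic_def
  proof (intro exI[of _ "\<lambda>u. M (fst u, (0, snd u))"] conjI Mr ballI)
    show "M (fst (0, z), (0, snd (0, z))) = (\<theta>' \<star> \<theta>) z" if "z \<in> topspace ?Z" for z
      using M0[of "(0, z)"] that by (simp add: L_def fibre_comp_def \<theta>'_def)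
    show "M (fst (t, z), (0, snd (t, z))) = (\<theta>' \<star> \<theta>) z" if t: "t \<in> {0..1}" and z: "z \<in> C" for t z
    proof -
      have "M (t, (0, z)) = H (1, z)" using MC[OF t, of "(0, z)"] t z by (simp add: h_def max_def)
      also have "\<dots> = snd z" using H1 z CZ by blast
      also have "\<dots> = (\<theta>' \<star> \<theta>) z" using \<theta>C[OF z] \<theta>'C[OF z] by (simp add: fibre_comp_def)
      finally show ?thesis by simp
    qed
  qed simp_all
  have end2: "rel_homotopic ?Z Y C snd (\<lambda>p. M (1, (1, p)))"
    unfolding rel_homotopic_def
  proof (intro exI[of _ "\<lambda>u. M (fst u, (1, snd u))"] conjI Mr ballI)
    show "M (fst (0, z), (1, snd (0, z))) = snd z" if "z \<in> topspace ?Z" for z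
      using M0[of "(1, z)"] H1 that by (simp add: L_def)
    show "M (fst (t, z), (1, snd (t, z))) = snd z" if t: "t \<in> {0..1}" and z: "z \<in> C" for t z
    proof -
      have "M (t, (1, z)) = H (1, z)" using MC[OF t, of "(1, z)"] t z by (simp add: h_def max_def)
      also have "\<dots> = snd z" using H1 z CZ by blast
      finally show ?thesis by simp
    qed
  qed simp_all
  have mid: "rel_homotopic ?Z Y C (\<lambda>p. M (1, (0, p))) (\<lambda>p. M (1, (1, p)))"
    unfolding rel_homotopic_def
  proof (intro exI[of _ "\<lambda>q. M (1, q)"] conjI ballI)
    show "continuous_map ?T Y (\<lambda>q. M (1, q))" using continuous_map_prod_section'[OF M] by simp
    show "M (1, t, z) = M (1, 0, z)" if t: "t \<in> {0..1}" and z: "z \<in> C" for t z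
    proof -
      have "max 1 \<bar>2 * t - 1\<bar> = 1" using t by (auto simp: max_absorb1)
      then show ?thesis using MC[of 1 "(t, z)"] MC[of 1 "(0, z)"] t z by (simp add: h_def)
    qed
  qed simp_all
  have "rel_homotopic ?Z Y C (\<theta>' \<star> \<theta>) snd"
    by (rule rel_homotopic_trans[OF rel_homotopic_trans[OF end1 mid CZ] rel_homotopic_sym[OF end2 CZ] CZ])
  then show ?thesis using that[of \<theta>'] \<theta>' \<theta>'C by blast
qed

text \<open>\<open>\<phi>\<close> restricts to a bijection from \<open>C\<close> to
  \<open>C'\<close> over \<open>X\<close> with inverse \<open>\<sigma>\<close>. By homotopy
  extension \<open>\<psi>\<close> is deformed into a map equal to \<open>\<sigma>\<close> on
  \<open>C'\<close>. Its composite with \<open>\<phi>\<close> then fixes \<open>C\<close> but is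
  only freely homotopic to the identity; composing with a left inverse rel \<open>C\<close> of that
  composite repairs this.\<close>

lemma left_inverse_rel:
  assumes C: "ndr_pair (prod_topology X Y) C" and C': "ndr_pair (prod_topology X Y) C'"
    and \<phi>: "continuous_map (prod_topology X Y) Y \<phi>" and \<psi>: "continuous_map (prod_topology X Y) Y \<psi>"
    and \<psi>\<phi>: "rel_homotopic (prod_topology X Y) Y {} (\<psi> \<star> \<phi>) snd"
    and \<phi>\<psi>: "rel_homotopic (prod_topology X Y) Y {} (\<phi> \<star> \<psi>) snd"
    and \<sigma>: "continuous_map (subtopology (prod_topology X Y) C') Y \<sigma>"
    and \<phi>C: "\<And>p. p \<in> C \<Longrightarrow> (fst p, \<phi> p) \<in> C'" and \<sigma>C: "\<And>p. p \<in> C' \<Longrightarrow> (fst p, \<sigma> p) \<in> C"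
    and \<sigma>\<phi>: "\<And>p. p \<in> C \<Longrightarrow> \<sigma> (fst p, \<phi> p) = snd p" and \<phi>\<sigma>: "\<And>p. p \<in> C' \<Longrightarrow> \<phi> (fst p, \<sigma> p) = snd p"
  obtains \<psi>' where "continuous_map (prod_topology X Y) Y \<psi>'" and "\<And>p. p \<in> C' \<Longrightarrow> \<psi>' p = \<sigma> p"
    and "rel_homotopic (prod_topology X Y) Y C (\<psi>' \<star> \<phi>) snd"
    and "rel_homotopic (prod_topology X Y) Y {} (\<phi> \<star> \<psi>') snd"
proof -
  let ?Z = "prod_topology X Y"
  have CZ: "C \<subseteq> topspace ?Z" "C' \<subseteq> topspace ?Z" using C C' ndr_pair_subset by blast+
  obtain H where H: "continuous_map (prod_topology I01 ?Z) Y H"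
    and H0: "\<And>z. z \<in> topspace ?Z \<Longrightarrow> H (0, z) = (\<psi> \<star> \<phi>) z"
    and H1: "\<And>z. z \<in> topspace ?Z \<Longrightarrow> H (1, z) = snd z"
    using \<psi>\<phi> unfolding rel_homotopic_def by blast
  have "continuous_map (subtopology ?Z C') ?Z (\<lambda>p. (fst p, \<sigma> p))"
    by (rule continuous_map_pairedI[OF continuous_map_from_subtopology[OF continuous_map_fst] \<sigma>])
  from continuous_map_comp[OF continuous_map_pairedI[OF continuous_map_fst
      continuous_map_comp[OF continuous_map_snd this]] H]
  \<comment> \<open>Running \<open>H\<close> from the points \<open>(x, \<sigma> c)\<close> starts
    at \<open>\<psi>\<close>, because \<open>\<phi>\<close> undoes \<open>\<sigma>\<close>, and ends
    at \<open>\<sigma>\<close>.\<close>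
  have track: "continuous_map (prod_topology I01 (subtopology ?Z C')) Y
      (\<lambda>q. H (fst q, (fst (snd q), \<sigma> (snd q))))" .
  obtain K where K: "continuous_map (prod_topology I01 ?Z) Y K"
    and K0: "\<And>z. z \<in> topspace ?Z \<Longrightarrow> K (0, z) = \<psi> z"
    and KC: "\<And>t c. t \<in> {0..1} \<Longrightarrow> c \<in> C' \<Longrightarrow> K (t, c) = H (t, (fst c, \<sigma> c))"
  proof (rule ndr_pair_extension[OF C' \<psi> track])
    show "H (fst (0, c), fst (snd (0, c)), \<sigma> (snd (0, c))) = \<psi> c" if "c \<in> C'" for c
      using H0[of "(fst c, \<sigma> c)"] \<sigma>C[OF that] CZ \<phi>\<sigma>[OF that] by (auto simp: fibre_comp_def)
  qed (rule that; simp)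
  define \<psi>\<^sub>1 where "\<psi>\<^sub>1 p = K (1, p)" for p
  have \<psi>\<^sub>1: "continuous_map ?Z Y \<psi>\<^sub>1"
    unfolding \<psi>\<^sub>1_def using continuous_map_prod_section'[OF K] by simp
  have \<psi>\<^sub>1\<sigma>: "\<psi>\<^sub>1 p = \<sigma> p" if p: "p \<in> C'" for p
    using KC[OF _ p, of 1] H1[of "(fst p, \<sigma> p)"] \<sigma>C[OF p] CZ by (auto simp: \<psi>\<^sub>1_def)
  have "rel_homotopic ?Z Y {} \<psi> \<psi>\<^sub>1"
    unfolding rel_homotopic_def by (intro exI[of _ K]) (use K K0 in \<open>auto simp: \<psi>\<^sub>1_def\<close>)
  then have "rel_homotopic ?Z Y {} \<psi>\<^sub>1 \<psi>" by (rule rel_homotopic_sym) simp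
  from rel_homotopic_fibre_comp_left[OF this \<phi>, of "{}"]
  have \<psi>\<^sub>1\<phi>: "rel_homotopic ?Z Y {} (\<psi>\<^sub>1 \<star> \<phi>) snd"
    using rel_homotopic_trans[OF _ \<psi>\<phi>] by blast
  obtain \<theta> where \<theta>: "continuous_map ?Z Y \<theta>" and \<theta>C: "\<And>p. p \<in> C \<Longrightarrow> \<theta> p = snd p"
    and \<theta>\<psi>: "rel_homotopic ?Z Y C (\<theta> \<star> (\<psi>\<^sub>1 \<star> \<phi>)) snd"
  proof (rule left_inverse_rel_of_homotopic_identity[OF C continuous_map_fibre_comp[OF \<psi>\<^sub>1 \<phi>] _ \<psi>\<^sub>1\<phi>])
    show "(\<psi>\<^sub>1 \<star> \<phi>) p = snd p" if "p \<in> C" for p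
      using \<psi>\<^sub>1\<sigma>[OF \<phi>C[OF that]] \<sigma>\<phi>[OF that] by (simp add: fibre_comp_def)
  qed (rule that; assumption)
  have left: "rel_homotopic ?Z Y C ((\<theta> \<star> \<psi>\<^sub>1) \<star> \<phi>) snd" using \<theta>\<psi> by (simp add: fibre_comp_assoc)
  have \<psi>\<^sub>2: "continuous_map ?Z Y (\<theta> \<star> \<psi>\<^sub>1)" by (rule continuous_map_fibre_comp[OF \<theta> \<psi>\<^sub>1])
  \<comment> \<open>As in a group, a left inverse of \<open>\<phi>\<close> is homotopic to the right
    inverse \<open>\<psi>\<close>, and is therefore itself a right inverse up to free
    homotopy.\<close>
  have "rel_homotopic ?Z Y {} (((\<theta> \<star> \<psi>\<^sub>1) \<star> \<phi>) \<star> \<psi>) (snd \<star> \<psi>)"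
    by (rule rel_homotopic_fibre_comp_left[OF rel_homotopic_empty[OF left] \<psi>]) simp
  then have 1: "rel_homotopic ?Z Y {} ((\<theta> \<star> \<psi>\<^sub>1) \<star> (\<phi> \<star> \<psi>)) \<psi>"
    by (simp add: fibre_comp_assoc snd_fibre_comp)
  have "rel_homotopic ?Z Y {} ((\<theta> \<star> \<psi>\<^sub>1) \<star> (\<phi> \<star> \<psi>)) ((\<theta> \<star> \<psi>\<^sub>1) \<star> snd)"
    by (rule rel_homotopic_fibre_comp_right[OF \<phi>\<psi> \<psi>\<^sub>2])
  then have "rel_homotopic ?Z Y {} (\<theta> \<star> \<psi>\<^sub>1) ((\<theta> \<star> \<psi>\<^sub>1) \<star> (\<phi> \<star> \<psi>))"
    unfolding fibre_comp_snd by (rule rel_homotopic_sym) simp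
  from rel_homotopic_trans[OF this 1] have "rel_homotopic ?Z Y {} (\<theta> \<star> \<psi>\<^sub>1) \<psi>" by simp
  from rel_homotopic_trans[OF rel_homotopic_fibre_comp_right[OF this \<phi>] \<phi>\<psi>]
  have right: "rel_homotopic ?Z Y {} (\<phi> \<star> (\<theta> \<star> \<psi>\<^sub>1)) snd" by simp
  have "(\<theta> \<star> \<psi>\<^sub>1) p = \<sigma> p" if "p \<in> C'" for p
    using \<psi>\<^sub>1\<sigma>[OF that] \<theta>C[OF \<sigma>C[OF that]] by (simp add: fibre_comp_def)
  then show ?thesis using that[OF \<psi>\<^sub>2 _ left right] by blast
qed

text \<open>One-sided inversion is applied twice. If \<open>\<psi>'\<close> is a left inverse of
  \<open>\<phi>\<close> rel \<open>C\<close> and \<open>\<phi>'\<close> is one of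
  \<open>\<psi>'\<close> rel \<open>C'\<close>, then \<open>\<phi>\<close> is homotopic rel
  \<open>C\<close> to \<open>\<phi>' \<star> \<psi>' \<star> \<phi>\<close>, hence to
  \<open>\<phi>'\<close>. Composing with \<open>\<psi>'\<close>, which carries \<open>C'\<close>
  into \<open>C\<close>, makes \<open>\<psi>'\<close> a right inverse rel \<open>C'\<close>.\<close>

proposition inverse_rel:
  assumes C: "ndr_pair (prod_topology X Y) C" and C': "ndr_pair (prod_topology X Y) C'"
    and \<phi>: "continuous_map (prod_topology X Y) Y \<phi>" and \<psi>: "continuous_map (prod_topology X Y) Y \<psi>"
    and \<psi>\<phi>: "rel_homotopic (prod_topology X Y) Y {} (\<psi> \<star> \<phi>) snd"
    and \<phi>\<psi>: "rel_homotopic (prod_topology X Y) Y {} (\<phi> \<star> \<psi>) snd"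
    and \<sigma>: "continuous_map (subtopology (prod_topology X Y) C') Y \<sigma>"
    and \<phi>C: "\<And>p. p \<in> C \<Longrightarrow> (fst p, \<phi> p) \<in> C'" and \<sigma>C: "\<And>p. p \<in> C' \<Longrightarrow> (fst p, \<sigma> p) \<in> C"
    and \<sigma>\<phi>: "\<And>p. p \<in> C \<Longrightarrow> \<sigma> (fst p, \<phi> p) = snd p" and \<phi>\<sigma>: "\<And>p. p \<in> C' \<Longrightarrow> \<phi> (fst p, \<sigma> p) = snd p"
  obtains \<psi>' where "continuous_map (prod_topology X Y) Y \<psi>'" and "\<And>p. p \<in> C' \<Longrightarrow> \<psi>' p = \<sigma> p"
    and "rel_homotopic (prod_topology X Y) Y C (\<psi>' \<star> \<phi>) snd"
    and "rel_homotopic (prod_topology X Y) Y C' (\<phi> \<star> \<psi>') snd"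
proof -
  let ?Z = "prod_topology X Y"
  have CZ: "C \<subseteq> topspace ?Z" "C' \<subseteq> topspace ?Z" using C C' ndr_pair_subset by blast+
  obtain \<psi>' where \<psi>': "continuous_map ?Z Y \<psi>'" and \<psi>'\<sigma>: "\<And>p. p \<in> C' \<Longrightarrow> \<psi>' p = \<sigma> p"
    and left: "rel_homotopic ?Z Y C (\<psi>' \<star> \<phi>) snd" and free: "rel_homotopic ?Z Y {} (\<phi> \<star> \<psi>') snd"
    by (rule left_inverse_rel[OF assms]) ((rule that; assumption) | assumption)+
  obtain \<phi>' where \<phi>': "continuous_map ?Z Y \<phi>'" and \<phi>'\<phi>: "\<And>p. p \<in> C \<Longrightarrow> \<phi>' p = \<phi> p"
    and left': "rel_homotopic ?Z Y C' (\<phi>' \<star> \<psi>') snd"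
  proof (rule left_inverse_rel[OF C' C \<psi>' \<phi> free rel_homotopic_empty[OF left]
        continuous_map_from_subtopology[OF \<phi>]])
    show "(fst p, \<psi>' p) \<in> C" if "p \<in> C'" for p using \<psi>'\<sigma>[OF that] \<sigma>C[OF that] by simp
    show "\<phi> (fst p, \<psi>' p) = snd p" if "p \<in> C'" for p using \<psi>'\<sigma>[OF that] \<phi>\<sigma>[OF that] by simp
    show "\<psi>' (fst p, \<phi> p) = snd p" if "p \<in> C" for p using \<psi>'\<sigma>[OF \<phi>C[OF that]] \<sigma>\<phi>[OF that] by simp
  qed (use \<phi>C that in blast)+
  have "rel_homotopic ?Z Y C ((\<phi>' \<star> \<psi>') \<star> \<phi>) (snd \<star> \<phi>)"
    by (rule rel_homotopic_fibre_comp_left[OF left' \<phi> \<phi>C])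
  then have 1: "rel_homotopic ?Z Y C \<phi> (\<phi>' \<star> (\<psi>' \<star> \<phi>))"
    unfolding fibre_comp_assoc snd_fibre_comp by (rule rel_homotopic_sym[OF _ CZ(1)])
  have "rel_homotopic ?Z Y C (\<phi>' \<star> (\<psi>' \<star> \<phi>)) (\<phi>' \<star> snd)"
    by (rule rel_homotopic_fibre_comp_right[OF left \<phi>'])
  from rel_homotopic_trans[OF 1 this CZ(1)]
  have "rel_homotopic ?Z Y C \<phi> \<phi>'" by (simp add: fibre_comp_snd)
  from rel_homotopic_fibre_comp_left[OF this \<psi>', of C']
  have "rel_homotopic ?Z Y C' (\<phi> \<star> \<psi>') (\<phi>' \<star> \<psi>')"
    using \<psi>'\<sigma> \<sigma>C by simp
  from rel_homotopic_trans[OF this left' CZ(2)]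
  have "rel_homotopic ?Z Y C' (\<phi> \<star> \<psi>') snd" .
  then show ?thesis using that[OF \<psi>' \<psi>'\<sigma> left] by blast
qed

section \<open>Mapping spaces\<close>

definition fibre_act :: "'x topology \<Rightarrow> ('x \<times> 'y \<Rightarrow> 'y) \<Rightarrow> ('x \<Rightarrow> 'y) \<Rightarrow> 'x \<Rightarrow> 'y" where
  "fibre_act X a h = (\<lambda>x\<in>topspace X. a (x, h x))"

lemma fibre_act_fibre_act: "fibre_act X a (fibre_act X b h) = fibre_act X (a \<star> b) h"
  by (auto simp: fibre_act_def fibre_comp_def fun_eq_iff)

lemma fibre_act_snd: "h \<in> continuous_maps X Y \<Longrightarrow> fibre_act X snd h = h"
  by (simp add: fibre_act_def continuous_maps_def extensional_restrict)

lemma continuous_mapsD: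
  assumes "h \<in> continuous_maps X Y"
  shows "continuous_map X Y h" and "\<And>x. x \<in> topspace X \<Longrightarrow> (x, h x) \<in> topspace (prod_topology X Y)"
proof -
  show h: "continuous_map X Y h" using assms by (simp add: continuous_maps_def)
  show "(x, h x) \<in> topspace (prod_topology X Y)" if "x \<in> topspace X" for x
    using continuous_map_funspace[OF h] that by auto
qed

lemma fibre_act_cong:
  assumes "h \<in> continuous_maps X Y" and "\<And>z. z \<in> topspace (prod_topology X Y) \<Longrightarrow> a z = b z"
  shows "fibre_act X a h = fibre_act X b h"
  using assms(2)[OF continuous_mapsD(2)[OF assms(1)]] by (auto simp: fibre_act_def fun_eq_iff)

lemma fibre_act_continuous_maps:
  assumes "continuous_map (prod_topology X Y) Y a" and "h \<in> continuous_maps X Y"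
  shows "fibre_act X a h \<in> continuous_maps X Y"
proof -
  have "continuous_map X Y (\<lambda>x. a (x, h x))"
    using continuous_map_comp[OF continuous_map_pairedI[OF continuous_map_ident
        continuous_mapsD(1)[OF assms(2)]] assms(1)] .
  then have "continuous_map X Y (fibre_act X a h)"
    by (rule continuous_map_eq) (simp add: fibre_act_def)
  then show ?thesis by (simp add: continuous_maps_def fibre_act_def)
qed

text \<open>
  The Hausdorff hypothesis provides, inside a compact set, compact neighbourhoods of each point.
\<close>

lemma continuous_map_fibre_act_param:
  assumes X: "Hausdorff_space X" and \<Theta>: "continuous_map (prod_topology P (prod_topology X Y)) Y \<Theta>"
  shows "continuous_map (prod_topology P (compact_open_topology X Y)) (compact_open_topology X Y)
           (\<lambda>q. fibre_act X (\<lambda>p. \<Theta> (fst q, p)) (snd q))"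
proof -
  let ?M = "compact_open_topology X Y" and ?Z = "prod_topology X Y"
  let ?F = "\<lambda>q. fibre_act X (\<lambda>p. \<Theta> (fst q, p)) (snd q)"
  have F: "?F q \<in> continuous_maps X Y" if "q \<in> topspace (prod_topology P ?M)" for q
  proof (rule fibre_act_continuous_maps)
    show "continuous_map ?Z Y (\<lambda>p. \<Theta> (fst q, p))"
      using continuous_map_prod_section'[OF \<Theta>] that by auto
    show "snd q \<in> continuous_maps X Y" using that by (auto simp: topspace_compact_open_topology)
  qed
  have "openin (prod_topology P ?M) (?F -` {f \<in> continuous_maps X Y. f ` K \<subseteq> U} \<inter> topspace (prod_topology P ?M))"
    if K: "compactin X K" and U: "openin Y U" for K U
  proof (subst openin_subopen, intro ballI)
    fix q assume q: "q \<in> ?F -` {f \<in> continuous_maps X Y. f ` K \<subseteq> U} \<inter> topspace (prod_topology P ?M)"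
    obtain t0 h0 where qth: "q = (t0, h0)" by (cases q)
    have t0: "t0 \<in> topspace P" and h0: "h0 \<in> continuous_maps X Y"
      using q by (auto simp: qth topspace_compact_open_topology)
    have KX: "K \<subseteq> topspace X" using K compactin_subset_topspace by blast
    have \<Theta>0: "\<Theta> (t0, (x, h0 x)) \<in> U" if "x \<in> K" for x
      using q that KX by (auto simp: qth fibre_act_def)
    have V: "openin (prod_topology P ?Z) {p \<in> topspace (prod_topology P ?Z). \<Theta> p \<in> U}"
      using openin_continuous_map_preimage[OF \<Theta> U] .
    have "compact_space (subtopology X K)" "Hausdorff_space (subtopology X K)"
      using K X by (simp_all add: compact_space_subtopology Hausdorff_space_subtopology)
    then have reg: "neighbourhood_base_of (closedin (subtopology X K)) (subtopology X K)"
      using compact_Hausdorff_imp_regular_space neighbourhood_base_of_closedin by blast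
    \<comment> \<open>Two neighbourhoods of \<open>x\<close> are needed: the open \<open>Q\<close>
      for the covering of \<open>K\<close>, and the compact \<open>L\<close> around it, since a
      subbasic condition on maps can only be imposed on a compact set.\<close>
    define R where "R x T W Q L \<longleftrightarrow> openin P T \<and> t0 \<in> T \<and> openin Y W \<and>
        openin (subtopology X K) Q \<and> x \<in> Q \<and> Q \<subseteq> L \<and> compactin X L \<and> h0 ` L \<subseteq> W \<and>
        (\<forall>t\<in>T. \<forall>x'\<in>L. \<forall>y\<in>W. \<Theta> (t, (x', y)) \<in> U)" for x T W Q L
    have "\<exists>T W Q L. R x T W Q L" if x: "x \<in> K" for x
    proof -
      have "(t0, (x, h0 x)) \<in> {p \<in> topspace (prod_topology P ?Z). \<Theta> p \<in> U}"
        using \<Theta>0[OF x] t0 continuous_mapsD(2)[OF h0, of x] x KX by auto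
      then obtain T B where T: "openin P T" "t0 \<in> T" "openin ?Z B" "(x, h0 x) \<in> B"
        "T \<times> B \<subseteq> {p \<in> topspace (prod_topology P ?Z). \<Theta> p \<in> U}"
        using V unfolding openin_prod_topology_alt by meson
      then obtain N W where N: "openin X N" "x \<in> N" "openin Y W" "h0 x \<in> W" "N \<times> W \<subseteq> B"
        unfolding openin_prod_topology_alt by meson
      define V where "V = N \<inter> {x \<in> topspace X. h0 x \<in> W}"
      have "openin X V"
        unfolding V_def using N(1) openin_continuous_map_preimage[OF continuous_mapsD(1)[OF h0] N(3)] by blast
      then have "openin (subtopology X K) (V \<inter> K)" by (rule openin_subtopology_Int)
      moreover have "x \<in> V \<inter> K" using x KX N by (auto simp: V_def)
      ultimately obtain Q L where L: "openin (subtopology X K) Q" "closedin (subtopology X K) L"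
        "x \<in> Q" "Q \<subseteq> L" "L \<subseteq> V \<inter> K"
        using reg unfolding neighbourhood_base_of by meson
      have "compactin X L"
        using closedin_compact_space[OF \<open>compact_space (subtopology X K)\<close> L(2)]
        by (simp add: compactin_subtopology)
      moreover have "h0 ` L \<subseteq> W" using L(5) by (auto simp: V_def)
      moreover have "\<Theta> (t, (x', y)) \<in> U" if "t \<in> T" "x' \<in> L" "y \<in> W" for t x' y
        using that L(5) N(5) T(5) by (auto simp: V_def)
      ultimately show ?thesis using T(1,2) N(3) L(1,3,4) unfolding R_def by blast
    qed
    then obtain T W Q L where R: "\<And>x. x \<in> K \<Longrightarrow> R x (T x) (W x) (Q x) (L x)" by metis
    have T: "\<And>x. x \<in> K \<Longrightarrow> openin P (T x) \<and> t0 \<in> T x"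
      and W: "\<And>x. x \<in> K \<Longrightarrow> openin Y (W x)"
      and Q: "\<And>x. x \<in> K \<Longrightarrow> openin (subtopology X K) (Q x) \<and> x \<in> Q x \<and> Q x \<subseteq> L x"
      and L: "\<And>x. x \<in> K \<Longrightarrow> compactin X (L x) \<and> h0 ` L x \<subseteq> W x"
      and TWL: "\<And>x t x' y. x \<in> K \<Longrightarrow> t \<in> T x \<Longrightarrow> x' \<in> L x \<Longrightarrow> y \<in> W x \<Longrightarrow> \<Theta> (t, (x', y)) \<in> U"
      using R unfolding R_def by blast+
    have "compactin (subtopology X K) K" using K by (simp add: compactin_subtopology)
    then obtain \<F> where \<F>: "finite \<F>" "\<F> \<subseteq> Q ` K" "K \<subseteq> \<Union>\<F>"
      using compactinD[of "subtopology X K" K "Q ` K"] Q by blast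
    then obtain J where J: "finite J" "J \<subseteq> K" "K \<subseteq> (\<Union>x\<in>J. Q x)"
      by (metis finite_subset_image)
    \<comment> \<open>Intersecting with the whole space covers an empty \<open>J\<close>, which
      occurs for empty \<open>K\<close>.\<close>
    define A where "A = (\<Inter>x\<in>J. T x) \<inter> topspace P"
    define B where "B = (\<Inter>x\<in>J. {h \<in> continuous_maps X Y. h ` L x \<subseteq> W x}) \<inter> topspace ?M"
    have "openin P A" unfolding A_def by (rule openin_INT[OF J(1)]) (use T J(2) in blast)
    moreover have "openin ?M B"
      unfolding B_def
    proof (rule openin_INT[OF J(1)])
      fix x assume "x \<in> J"
      then show "openin ?M {h \<in> continuous_maps X Y. h ` L x \<subseteq> W x}"
        unfolding compact_open_topology_def using J(2) L W by (intro topology_generated_by_Basis) blast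
    qed
    ultimately have "openin (prod_topology P ?M) (A \<times> B)" by (simp add: openin_prod_Times_iff)
    moreover have "q \<in> A \<times> B"
      using t0 h0 T L J(2) by (auto simp: qth A_def B_def topspace_compact_open_topology)
    moreover have "A \<times> B \<subseteq> ?F -` {f \<in> continuous_maps X Y. f ` K \<subseteq> U} \<inter> topspace (prod_topology P ?M)"
    proof
      fix r assume r: "r \<in> A \<times> B"
      then have top: "r \<in> topspace (prod_topology P ?M)" by (auto simp: A_def B_def)
      have "?F r x \<in> U" if x: "x \<in> K" for x
      proof -
        obtain j where j: "j \<in> J" "x \<in> Q j" using J(3) x by blast
        then have "j \<in> K" "x \<in> L j" using J(2) Q by auto
        moreover have "fst r \<in> A" "snd r \<in> B" using r by auto
        then have "fst r \<in> T j" "snd r ` L j \<subseteq> W j" using j(1) unfolding A_def B_def by blast+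
        ultimately have "\<Theta> (fst r, (x, snd r x)) \<in> U" by (intro TWL[of j]) auto
        then show ?thesis using x KX by (auto simp: fibre_act_def)
      qed
      then show "r \<in> ?F -` {f \<in> continuous_maps X Y. f ` K \<subseteq> U} \<inter> topspace (prod_topology P ?M)"
        using F[OF top] top by auto
    qed
    ultimately show "\<exists>N. openin (prod_topology P ?M) N \<and> q \<in> N \<and>
        N \<subseteq> ?F -` {f \<in> continuous_maps X Y. f ` K \<subseteq> U} \<inter> topspace (prod_topology P ?M)"
      by blast
  qed
  then have "continuous_map (prod_topology P ?M) (topology_generated_by
      {{f \<in> continuous_maps X Y. f ` K \<subseteq> U} | K U. compactin X K \<and> openin Y U}) ?F"
    unfolding continuous_on_generated_topo_iff
  proof (intro conjI allI impI)
    show "?F ` topspace (prod_topology P ?M) \<subseteq>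
        \<Union>{{f \<in> continuous_maps X Y. f ` K \<subseteq> U} | K U. compactin X K \<and> openin Y U}"
      using F topspace_compact_open_topology[of X Y]
      unfolding compact_open_topology_def topology_generated_by_topspace by blast
  qed blast
  then show ?thesis by (simp only: compact_open_topology_def)
qed

lemma continuous_map_fibre_act:
  assumes "Hausdorff_space X" and a: "continuous_map (prod_topology X Y) Y a"
  shows "continuous_map (compact_open_topology X Y) (compact_open_topology X Y) (fibre_act X a)"
  \<comment> \<open>The unit interval serves as a dummy parameter space.\<close>
  using continuous_map_prod_section'[OF continuous_map_fibre_act_param[OF assms(1)
      continuous_map_comp[OF continuous_map_snd a]], of 0 I01] by simp

section \<open>Actions on path components\<close>

lemma topspace_map_component:
  "topspace (map_component X Y f) = path_component_of_set (compact_open_topology X Y) f"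
  by (auto simp: map_component_def dest: path_component_in_topspace)

lemma map_component_continuous_maps: "h \<in> topspace (map_component X Y f) \<Longrightarrow> h \<in> continuous_maps X Y"
  unfolding map_component_def by (simp add: topspace_compact_open_topology)

lemma in_map_component: "f \<in> continuous_maps X Y \<Longrightarrow> f \<in> topspace (map_component X Y f)"
  by (simp add: topspace_map_component path_component_of_refl topspace_compact_open_topology)

lemma continuous_map_evaluation:
  assumes "x \<in> topspace X"
  shows "continuous_map (map_component X Y f) Y (\<lambda>h. h x)"
  unfolding map_component_def
proof (rule continuous_map_from_subtopology, unfold continuous_map_def, intro conjI allI impI)
  show "(\<lambda>h. h x) \<in> topspace (compact_open_topology X Y) \<rightarrow> topspace Y"
    using assms by (auto simp: topspace_compact_open_topology dest: continuous_mapsD(2))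
  fix U assume U: "openin Y U"
  have "openin (compact_open_topology X Y) {h \<in> continuous_maps X Y. h ` {x} \<subseteq> U}"
    unfolding compact_open_topology_def
    by (rule topology_generated_by_Basis) (use U assms in \<open>blast intro: finite_imp_compactin\<close>)
  then show "openin (compact_open_topology X Y) {h \<in> topspace (compact_open_topology X Y). h x \<in> U}"
    by (simp add: topspace_compact_open_topology)
qed

text \<open>The target is named by any \<open>g\<close> in the component of the image of
  \<open>f\<close>: on the way back, the homotopy inverse reaches the component of the original map,
  but not necessarily that map itself.\<close>

lemma continuous_map_fibre_act_component:
  assumes "Hausdorff_space X" and a: "continuous_map (prod_topology X Y) Y a"
    and g: "path_component_of (compact_open_topology X Y) g (fibre_act X a f)"
  shows "continuous_map (map_component X Y f) (map_component X Y g) (fibre_act X a)"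
  unfolding map_component_def
proof (rule continuous_map_into_subtopology[OF continuous_map_from_subtopology])
  show cont: "continuous_map (compact_open_topology X Y) (compact_open_topology X Y) (fibre_act X a)"
    by (rule continuous_map_fibre_act[OF assms(1,2)])
  show "fibre_act X a \<in> topspace (subtopology (compact_open_topology X Y)
      (path_component_of_set (compact_open_topology X Y) f)) \<rightarrow> path_component_of_set (compact_open_topology X Y) g"
    using path_component_of_trans[OF g path_component_of_continuous_image[OF cont]] by auto
qed

text \<open>The predicate \<open>P\<close> lets one argument produce free, based and fibrewise
  homotopies: every stage of the homotopy is the action of a map equal to \<open>snd\<close> on
  \<open>C\<close>, so \<open>P\<close> has to be checked for such actions only.\<close>

lemma fibre_act_homotopic:
  assumes X: "Hausdorff_space X" and rel: "rel_homotopic (prod_topology X Y) Y C a snd"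
    and f: "f \<in> continuous_maps X Y" and C: "C \<subseteq> topspace (prod_topology X Y)"
    and P_cong: "\<And>h k. (\<And>x. x \<in> topspace (map_component X Y f) \<Longrightarrow> h x = k x) \<Longrightarrow> P h = P k"
    and P: "\<And>b. (\<And>p. p \<in> C \<Longrightarrow> b p = snd p) \<Longrightarrow> P (fibre_act X b)"
  shows "homotopic_with P (map_component X Y f) (map_component X Y f) (fibre_act X a) id"
    and "path_component_of (compact_open_topology X Y) f (fibre_act X a f)"
proof -
  let ?Z = "prod_topology X Y" and ?M = "compact_open_topology X Y" and ?E = "map_component X Y f"
  obtain H where H: "continuous_map (prod_topology I01 ?Z) Y H"
    and H0: "\<And>z. z \<in> topspace ?Z \<Longrightarrow> H (0, z) = a z" and H1: "\<And>z. z \<in> topspace ?Z \<Longrightarrow> H (1, z) = snd z"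
    and HC: "\<And>t z. t \<in> {0..1} \<Longrightarrow> z \<in> C \<Longrightarrow> H (t, z) = a z"
    by (rule rel_homotopicE[OF rel]) (rule that; assumption)
  let ?F = "\<lambda>q. fibre_act X (\<lambda>p. H (fst q, p)) (snd q)"
  have F: "continuous_map (prod_topology I01 ?M) ?M ?F"
    by (rule continuous_map_fibre_act_param[OF X H])
  have F0: "?F (0, h) = fibre_act X a h" if "h \<in> continuous_maps X Y" for h
    using fibre_act_cong[OF that, of "\<lambda>p. H (0, p)" a] H0 by simp
  have F1: "?F (1, h) = h" if "h \<in> continuous_maps X Y" for h
    using fibre_act_cong[OF that, of "\<lambda>p. H (1, p)" snd] H1 fibre_act_snd[OF that] by simp
  \<comment> \<open>Each track of the homotopy, read backwards from time 1, is a path starting at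
    \<open>h\<close>; hence no stage leaves the path component.\<close>
  have path: "path_component_of ?M h (?F (t, h))" if h: "h \<in> continuous_maps X Y" and t: "t \<in> {0..1}" for h t
  proof -
    have 1: "continuous_map I01 ?M (\<lambda>s. ?F (s, h))"
      using continuous_map_prod_section[OF F] h by (simp add: topspace_compact_open_topology)
    have "(1 - s) * 1 + s * t \<in> {0..1}" if "s \<in> {0..1}" for s
      using convexD_alt[of "{0..1::real}" 1 t s] that t by simp
    then have "continuous_map I01 I01 (\<lambda>s. (1 - s) * 1 + s * t)"
      by (auto simp: continuous_map_in_subtopology intro!: continuous_intros)
    from continuous_map_comp[OF this 1]
    have "path_component_of ?M (?F (1, h)) (?F (t, h))"
      unfolding path_component_of_def pathin_def
      by (intro exI[of _ "\<lambda>s. ?F ((1 - s) * 1 + s * t, h)"]) simp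
    then show ?thesis using F1[OF h] by simp
  qed
  show "path_component_of ?M f (fibre_act X a f)" using path[OF f, of 0] F0[OF f] by simp
  have "continuous_map (prod_topology I01 ?E) ?E ?F"
  proof -
    have "continuous_map (prod_topology I01 ?E) ?M ?F"
      unfolding map_component_def prod_topology_subtopology(2) by (rule continuous_map_from_subtopology[OF F])
    moreover have "?F q \<in> path_component_of_set ?M f" if "q \<in> topspace (prod_topology I01 ?E)" for q
    proof -
      have "snd q \<in> continuous_maps X Y" "path_component_of ?M f (snd q)" "fst q \<in> {0..1}"
        using that map_component_continuous_maps by (auto simp: topspace_map_component)
      then show ?thesis using path_component_of_trans[OF _ path[of "snd q" "fst q"]] by simp
    qed
    ultimately show ?thesis
      unfolding map_component_def by (intro continuous_map_into_subtopology) (auto simp: map_component_def)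
  qed
  moreover have "P (\<lambda>h. ?F (t, h))" if t: "t \<in> {0..1}" for t
  proof -
    have "H (t, p) = snd p" if "p \<in> C" for p
      using HC[OF t that] HC[of 1 p] H1[of p] that C by auto
    then show ?thesis using P[of "\<lambda>p. H (t, p)"] by simp
  qed
  moreover have "?F (0, h) = fibre_act X a h" "?F (1, h) = id h" if "h \<in> topspace ?E" for h
    using F0 F1 map_component_continuous_maps[OF that] by auto
  ultimately have ex: "\<exists>F. continuous_map (prod_topology I01 ?E) ?E F \<and>
      (\<forall>h\<in>topspace ?E. F (0, h) = fibre_act X a h) \<and> (\<forall>h\<in>topspace ?E. F (1, h) = id h) \<and>
      (\<forall>t\<in>{0..1}. P (\<lambda>h. F (t, h)))"
    by (intro exI[of _ ?F]) blast
  show "homotopic_with P ?E ?E (fibre_act X a) id"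
    by (rule iffD2[OF homotopic_with ex]) (rule P_cong, blast)
qed

lemma fibre_act_inverse:
  fixes f :: "'x \<Rightarrow> 'y"
  assumes X: "Hausdorff_space X" and f: "f \<in> continuous_maps X Y"
    and \<phi>: "continuous_map (prod_topology X Y) Y \<phi>" and \<psi>: "continuous_map (prod_topology X Y) Y \<psi>"
    and C: "C \<subseteq> topspace (prod_topology X Y)" and C': "C' \<subseteq> topspace (prod_topology X Y)"
    and \<psi>\<phi>: "rel_homotopic (prod_topology X Y) Y C (\<psi> \<star> \<phi>) snd"
    and \<phi>\<psi>: "rel_homotopic (prod_topology X Y) Y C' (\<phi> \<star> \<psi>) snd"
  defines "g \<equiv> fibre_act X \<phi> f"
  shows "continuous_map (map_component X Y f) (map_component X Y g) (fibre_act X \<phi>)"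
    and "continuous_map (map_component X Y g) (map_component X Y f) (fibre_act X \<psi>)"
    and "\<And>P. \<lbrakk>\<And>h k. (\<And>x. x \<in> topspace (map_component X Y f) \<Longrightarrow> h x = k x) \<Longrightarrow> P h = P k;
             \<And>b. (\<And>p. p \<in> C \<Longrightarrow> b p = snd p) \<Longrightarrow> P (fibre_act X b)\<rbrakk> \<Longrightarrow>
           homotopic_with P (map_component X Y f) (map_component X Y f) (fibre_act X \<psi> \<circ> fibre_act X \<phi>) id"
    and "\<And>P. \<lbrakk>\<And>h k. (\<And>x. x \<in> topspace (map_component X Y g) \<Longrightarrow> h x = k x) \<Longrightarrow> P h = P k;
             \<And>b. (\<And>p. p \<in> C' \<Longrightarrow> b p = snd p) \<Longrightarrow> P (fibre_act X b)\<rbrakk> \<Longrightarrow>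
           homotopic_with P (map_component X Y g) (map_component X Y g) (fibre_act X \<phi> \<circ> fibre_act X \<psi>) id"
proof -
  have g: "g \<in> continuous_maps X Y" unfolding g_def by (rule fibre_act_continuous_maps[OF \<phi> f])
  have comp: "fibre_act X a \<circ> fibre_act X b = fibre_act X (a \<star> b)" for a b :: "'x \<times> 'y \<Rightarrow> 'y"
    by (simp add: fun_eq_iff fibre_act_fibre_act)
  show "continuous_map (map_component X Y f) (map_component X Y g) (fibre_act X \<phi>)"
    by (rule continuous_map_fibre_act_component[OF X \<phi>])
      (use g in \<open>simp add: g_def path_component_of_refl topspace_compact_open_topology\<close>)
  show "continuous_map (map_component X Y g) (map_component X Y f) (fibre_act X \<psi>)"
  proof (rule continuous_map_fibre_act_component[OF X \<psi>])
    show "path_component_of (compact_open_topology X Y) f (fibre_act X \<psi> g)"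
      unfolding g_def fibre_act_fibre_act
      by (rule fibre_act_homotopic(2)[OF X \<psi>\<phi> f C, of "\<lambda>_. True"]) simp_all
  qed
  show "homotopic_with P (map_component X Y f) (map_component X Y f) (fibre_act X \<psi> \<circ> fibre_act X \<phi>) id"
    if "\<And>h k. (\<And>x. x \<in> topspace (map_component X Y f) \<Longrightarrow> h x = k x) \<Longrightarrow> P h = P k"
      "\<And>b. (\<And>p. p \<in> C \<Longrightarrow> b p = snd p) \<Longrightarrow> P (fibre_act X b)" for P
    unfolding comp by (rule fibre_act_homotopic(1)[OF X \<psi>\<phi> f C, where P = P]) (fact that)+
  show "homotopic_with P (map_component X Y g) (map_component X Y g) (fibre_act X \<phi> \<circ> fibre_act X \<psi>) id"
    if "\<And>h k. (\<And>x. x \<in> topspace (map_component X Y g) \<Longrightarrow> h x = k x) \<Longrightarrow> P h = P k"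
      "\<And>b. (\<And>p. p \<in> C' \<Longrightarrow> b p = snd p) \<Longrightarrow> P (fibre_act X b)" for P
    unfolding comp by (rule fibre_act_homotopic(1)[OF X \<phi>\<psi> g C', where P = P]) (fact that)+
qed

section \<open>From the group-like action to the mapping spaces\<close>

lemma rel_homotopic_precompose:
  assumes "rel_homotopic W Y {} a b" and g: "continuous_map Z W g"
  shows "rel_homotopic Z Y {} (\<lambda>z. a (g z)) (\<lambda>z. b (g z))"
proof -
  obtain H where H: "continuous_map (prod_topology I01 W) Y H"
    and H01: "\<And>z. z \<in> topspace W \<Longrightarrow> H (0, z) = a z" "\<And>z. z \<in> topspace W \<Longrightarrow> H (1, z) = b z"
    using assms(1) unfolding rel_homotopic_def by blast
  have gW: "g z \<in> topspace W" if "z \<in> topspace Z" for z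
    using continuous_map_funspace[OF g] that by blast
  from continuous_map_comp[OF continuous_map_pairedI[OF continuous_map_fst
      continuous_map_comp[OF continuous_map_snd g]] H]
  have "continuous_map (prod_topology I01 Z) Y (\<lambda>q. H (fst q, g (snd q)))" .
  then show ?thesis
    unfolding rel_homotopic_def
    by (intro exI[of _ "\<lambda>q. H (fst q, g (snd q))"]) (use H01 gW in auto)
qed

text \<open>Associativity merges the two factors into \<open>m (\<alpha> x, \<beta> x)\<close>, the
  inverse homotopy moves this to \<open>e\<close>, and the unit homotopy removes \<open>e\<close>.
  The result is free; \<open>inverse_rel\<close> makes it relative.\<close>

lemma action_inverse_homotopic:
  fixes \<alpha> \<beta> :: "'x \<Rightarrow> 'g"
  assumes A: "homotopy_associative_action G e m Y y\<^sub>0 A"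
    and \<alpha>: "continuous_map X G \<alpha>" and \<beta>: "continuous_map X G \<beta>"
    and m: "continuous_map (prod_topology G G) G m"
    and inv: "rel_homotopic X G {} (\<lambda>x. m (\<alpha> x, \<beta> x)) (\<lambda>x. e)"
  shows "rel_homotopic (prod_topology X Y) Y {}
           ((\<lambda>p. A (\<alpha> (fst p), snd p)) \<star> (\<lambda>p. A (\<beta> (fst p), snd p))) snd"
proof -
  let ?Z = "prod_topology X Y"
  have contA: "continuous_map (prod_topology G Y) Y A"
    using A by (simp add: homotopy_associative_action_def based_map_def)
  have unit: "rel_homotopic Y Y {} (\<lambda>y. A (e, y)) id"
    using A by (auto simp: homotopy_associative_action_def based_homotopic_def intro: homotopic_imp_rel_homotopic)
  have assoc: "rel_homotopic (prod_topology G (prod_topology G Y)) Y {}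
      (\<lambda>(a, b, y). A (a, A (b, y))) (\<lambda>(a, b, y). A (m (a, b), y))"
    using A by (auto simp: homotopy_associative_action_def based_homotopic_def intro: homotopic_imp_rel_homotopic)
  have "continuous_map ?Z (prod_topology G (prod_topology G Y)) (\<lambda>p. (\<alpha> (fst p), \<beta> (fst p), snd p))"
    by (rule continuous_map_pairedI[OF continuous_map_comp[OF continuous_map_fst \<alpha>]
          continuous_map_pairedI[OF continuous_map_comp[OF continuous_map_fst \<beta>] continuous_map_snd]])
  from rel_homotopic_precompose[OF assoc this]
  have 1: "rel_homotopic ?Z Y {} ((\<lambda>p. A (\<alpha> (fst p), snd p)) \<star> (\<lambda>p. A (\<beta> (fst p), snd p)))
      (\<lambda>p. A (m (\<alpha> (fst p), \<beta> (fst p)), snd p))"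
    by (simp add: fibre_comp_def[abs_def])
  obtain H where H: "continuous_map (prod_topology I01 X) G H"
    and H01: "\<And>x. x \<in> topspace X \<Longrightarrow> H (0, x) = m (\<alpha> x, \<beta> x)" "\<And>x. x \<in> topspace X \<Longrightarrow> H (1, x) = e"
    using inv unfolding rel_homotopic_def by blast
  from continuous_map_comp[OF continuous_map_pairedI[OF continuous_map_comp[OF
      continuous_map_pairedI[OF continuous_map_fst continuous_map_comp[OF continuous_map_snd continuous_map_fst]] H]
      continuous_map_comp[OF continuous_map_snd continuous_map_snd]] contA]
  have "continuous_map (prod_topology I01 ?Z) Y (\<lambda>q. A (H (fst q, fst (snd q)), snd (snd q)))" .
  then have 2: "rel_homotopic ?Z Y {} (\<lambda>p. A (m (\<alpha> (fst p), \<beta> (fst p)), snd p)) (\<lambda>p. A (e, snd p))"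
    unfolding rel_homotopic_def
    by (intro exI[of _ "\<lambda>q. A (H (fst q, fst (snd q)), snd (snd q))"]) (use H01 in auto)
  have 3: "rel_homotopic ?Z Y {} (\<lambda>p. A (e, snd p)) snd"
    using rel_homotopic_precompose[OF unit continuous_map_snd, of X] by (simp add: id_def)
  show ?thesis using rel_homotopic_trans[OF rel_homotopic_trans[OF 1 2] 3] by simp
qed

theorem theorem2p4:
  fixes X :: "'x topology" and \<E>\<^sub>X :: "'x set set" and d\<^sub>X :: "'x set \<Rightarrow> nat" and x\<^sub>0 :: 'x
    and Y :: "'y topology" and \<E>\<^sub>Y :: "'y set set" and d\<^sub>Y :: "'y set \<Rightarrow> nat" and y\<^sub>0 :: 'y
    and G :: "'g topology" and e :: 'g and m :: "'g \<times> 'g \<Rightarrow> 'g" and \<iota> :: "'g \<Rightarrow> 'g"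
    and A :: "'g \<times> 'y \<Rightarrow> 'y" and f :: "'x \<Rightarrow> 'y" and \<gamma> :: "'x \<Rightarrow> 'g"
  assumes "cw_complex X \<E>\<^sub>X d\<^sub>X" and "countable \<E>\<^sub>X" and "connected_space X"
    and "nondegenerate_basepoint X x\<^sub>0"
    and "cw_complex Y \<E>\<^sub>Y d\<^sub>Y" and "countable \<E>\<^sub>Y" and "connected_space Y"
    and "nondegenerate_basepoint Y y\<^sub>0"
    and "f \<in> continuous_maps X Y"
    and "group_like_space G e m \<iota>"
    and "homotopy_associative_action G e m Y y\<^sub>0 A"
    and "based_map X x\<^sub>0 G e \<gamma>"
  shows
    "map_component X Y f homotopy_equivalent_space map_component X Y (translate_map X A \<gamma> f) \<and>
     (finite \<E>\<^sub>X \<longrightarrow>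
        based_homotopy_equivalent
          (map_component X Y f) f
          (map_component X Y (translate_map X A \<gamma> f)) (translate_map X A \<gamma> f)) \<and>
     (finite \<E>\<^sub>X \<and> strictly_unital e Y A \<longrightarrow>
        fibre_homotopy_equivalent Y
          (map_component X Y f) f (\<lambda>h. h x\<^sub>0)
          (map_component X Y (translate_map X A \<gamma> f)) (translate_map X A \<gamma> f) (\<lambda>h. h x\<^sub>0))"
proof -
  let ?Z = "prod_topology X Y"
  define g where "g = translate_map X A \<gamma> f"
  define \<phi> where "\<phi> p = A (\<gamma> (fst p), snd p)" for p
  define \<psi> where "\<psi> p = A (\<iota> (\<gamma> (fst p)), snd p)" for p
  note f = \<open>f \<in> continuous_maps X Y\<close>
  have X: "Hausdorff_space X" and Y: "Hausdorff_space Y"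
    using assms(1,5) cw_complexD(1) by blast+
  have x\<^sub>0: "x\<^sub>0 \<in> topspace X" using assms(4) by (simp add: nondegenerate_basepoint_def)
  have contf: "continuous_map X Y f" and fZ: "\<And>x. x \<in> topspace X \<Longrightarrow> f x \<in> topspace Y"
    using continuous_mapsD[OF f] by auto
  have \<gamma>: "continuous_map X G \<gamma>" "\<gamma> x\<^sub>0 = e" using assms(12) by (auto simp: based_map_def)
  have m: "continuous_map (prod_topology G G) G m" and \<iota>: "continuous_map G G \<iota>"
    using assms(10) by (auto simp: group_like_space_def H_space_def based_map_def)
  have A: "continuous_map (prod_topology G Y) Y A"
    using assms(11) by (simp add: homotopy_associative_action_def based_map_def)
  have \<iota>\<gamma>: "continuous_map X G (\<lambda>x. \<iota> (\<gamma> x))" by (rule continuous_map_comp[OF \<gamma>(1) \<iota>])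
  have act: "continuous_map ?Z Y (\<lambda>p. A (\<alpha> (fst p), snd p))" if "continuous_map X G \<alpha>" for \<alpha>
    by (rule continuous_map_comp[OF continuous_map_pairedI[OF
          continuous_map_comp[OF continuous_map_fst that] continuous_map_snd] A])
  have \<phi>: "continuous_map ?Z Y \<phi>" and \<psi>: "continuous_map ?Z Y \<psi>"
    unfolding \<phi>_def \<psi>_def using act[OF \<gamma>(1)] act[OF \<iota>\<gamma>] by auto
  have "rel_homotopic G G {} (\<lambda>g. m (\<iota> g, g)) (\<lambda>g. e)" "rel_homotopic G G {} (\<lambda>g. m (g, \<iota> g)) (\<lambda>g. e)"
    using assms(10) by (auto simp: group_like_space_def based_homotopic_def intro: homotopic_imp_rel_homotopic)
  note inv = this[THEN rel_homotopic_precompose[OF _ \<gamma>(1)]]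
  have \<psi>\<phi>: "rel_homotopic ?Z Y {} (\<psi> \<star> \<phi>) snd" and \<phi>\<psi>: "rel_homotopic ?Z Y {} (\<phi> \<star> \<psi>) snd"
    unfolding \<phi>_def \<psi>_def
    using action_inverse_homotopic[OF assms(11) \<iota>\<gamma> \<gamma>(1) m inv(1)]
      action_inverse_homotopic[OF assms(11) \<gamma>(1) \<iota>\<gamma> m inv(2)] by auto
  have g: "g = fibre_act X \<phi> f"
    by (simp add: g_def translate_map_def fibre_act_def \<phi>_def)
  have g_cm: "g \<in> continuous_maps X Y" unfolding g by (rule fibre_act_continuous_maps[OF \<phi> f])
  have contg: "continuous_map X Y g" and gY: "\<And>x. x \<in> topspace X \<Longrightarrow> g x \<in> topspace Y"
    using continuous_mapsD[OF g_cm] by auto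
  have \<phi>f: "\<phi> (x, f x) = g x" if "x \<in> topspace X" for x
    using that by (simp add: g fibre_act_def)
  let ?\<Gamma> = "\<lambda>h. (\<lambda>x. (x, h x)) ` topspace X" and ?E = "map_component X Y"
  have \<Gamma>_sub: "?\<Gamma> f \<subseteq> topspace ?Z" "?\<Gamma> g \<subseteq> topspace ?Z" using fZ gY by auto
  have fE: "f \<in> topspace (?E f)" "g \<in> topspace (?E g)" using in_map_component f g_cm by auto
  have act_eq: "fibre_act X b h = h'" if "h' \<in> continuous_maps X Y" "\<And>x. x \<in> topspace X \<Longrightarrow> b (x, h x) = h' x"
    for b h h'
    using that by (auto simp: fibre_act_def continuous_maps_def extensional_def fun_eq_iff)
  have partA: "?E f homotopy_equivalent_space ?E g"
    unfolding homotopy_equivalent_space_def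
  proof (intro exI conjI)
    \<comment> \<open>With empty subspaces the free homotopies suffice, so \<open>\<psi>\<close>
      itself serves as the inverse.\<close>
    note inv = fibre_act_inverse[OF X f \<phi> \<psi> empty_subsetI empty_subsetI \<psi>\<phi> \<phi>\<psi>, folded g]
    show "homotopic_with (\<lambda>_. True) (?E f) (?E f) (fibre_act X \<psi> \<circ> fibre_act X \<phi>) id"
      by (rule inv(3)) simp_all
    show "homotopic_with (\<lambda>_. True) (?E g) (?E g) (fibre_act X \<phi> \<circ> fibre_act X \<psi>) id"
      by (rule inv(4)) simp_all
  qed (rule fibre_act_inverse[OF X f \<phi> \<psi> empty_subsetI empty_subsetI \<psi>\<phi> \<phi>\<psi>, folded g])+
  have partB: "based_homotopy_equivalent (?E f) f (?E g) g"
    and partC: "strictly_unital e Y A \<Longrightarrow> fibre_homotopy_equivalent Y (?E f) f (\<lambda>h. h x\<^sub>0) (?E g) g (\<lambda>h. h x\<^sub>0)"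
    if fin: "finite \<E>\<^sub>X"
  proof -
    have "subcomplex X \<E>\<^sub>X \<E>\<^sub>X"
      using cw_complexD(3)[OF assms(1)] closure_of_subset_topspace[of X] by (simp add: subcomplex_def)
    from finite_subcomplex_compact(1)[OF assms(1) fin this]
    have compact: "compact_space X" by (simp add: cw_complexD(3)[OF assms(1)] compact_space_def)
    have ndr_f: "ndr_pair ?Z (?\<Gamma> f)" and ndr_g: "ndr_pair ?Z (?\<Gamma> g)"
      using ndr_pair_graph[OF assms(5,6) compact] contf contg by auto
    show "based_homotopy_equivalent (?E f) f (?E g) g"
    proof -
      \<comment> \<open>On the graph of \<open>g\<close> the strict inverse of \<open>\<phi>\<close>
        sends \<open>(x, g x)\<close> to \<open>f x\<close>. Hence \<open>\<psi>'\<close> carries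
        \<open>g\<close> to \<open>f\<close>, and homotopies stationary on the graphs keep
        \<open>f\<close> and \<open>g\<close> fixed.\<close>
      obtain \<psi>' where \<psi>': "continuous_map ?Z Y \<psi>'" and \<psi>'g: "\<And>p. p \<in> ?\<Gamma> g \<Longrightarrow> \<psi>' p = f (fst p)"
        and homs: "rel_homotopic ?Z Y (?\<Gamma> f) (\<psi>' \<star> \<phi>) snd" "rel_homotopic ?Z Y (?\<Gamma> g) (\<phi> \<star> \<psi>') snd"
        by (rule inverse_rel[OF ndr_f ndr_g \<phi> \<psi> \<psi>\<phi> \<phi>\<psi> continuous_map_from_subtopology[OF
              continuous_map_comp[OF continuous_map_fst contf]]])
          (use \<phi>f in \<open>auto intro: that\<close>)
      note inv = fibre_act_inverse[OF X f \<phi> \<psi>' \<Gamma>_sub homs, folded g]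
      show ?thesis
        unfolding based_homotopy_equivalent_def based_map_def based_homotopic_def
      proof (intro exI conjI)
        show "fibre_act X \<phi> f = g" by (simp add: g)
        show "fibre_act X \<psi>' g = f" by (rule act_eq[OF f]) (simp add: \<psi>'g)
        show "homotopic_with (\<lambda>k. k f = f) (?E f) (?E f) (fibre_act X \<psi>' \<circ> fibre_act X \<phi>) id"
          by (rule inv(3)) (use fE act_eq[OF f] in auto)
        show "homotopic_with (\<lambda>k. k g = g) (?E g) (?E g) (fibre_act X \<phi> \<circ> fibre_act X \<psi>') id"
          by (rule inv(4)) (use fE act_eq[OF g_cm] in auto)
      qed (rule inv)+
    qed
    show "fibre_homotopy_equivalent Y (?E f) f (\<lambda>h. h x\<^sub>0) (?E g) g (\<lambda>h. h x\<^sub>0)" if unital: "strictly_unital e Y A"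
    proof -
      let ?C = "\<lambda>h. {x\<^sub>0} \<times> topspace Y \<union> ?\<Gamma> h"
      have ndr_x\<^sub>0: "ndr_pair X {x\<^sub>0}" by (rule nondegenerate_imp_ndr_pair[OF assms(4)])
      have ndr: "ndr_pair ?Z (?C f)" "ndr_pair ?Z (?C g)"
        using ndr_pair_axis_graph[OF compact X ndr_x\<^sub>0 Y] contf contg ndr_f ndr_g by auto
      note C_sub = ndr[THEN ndr_pair_subset]
      have \<phi>x\<^sub>0: "\<phi> (x\<^sub>0, y) = y" if "y \<in> topspace Y" for y
        using unital that by (simp add: \<phi>_def \<gamma>(2) strictly_unital_def)
      then have fx\<^sub>0: "g x\<^sub>0 = f x\<^sub>0" using \<phi>f[OF x\<^sub>0] fZ[OF x\<^sub>0] by simp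
      \<comment> \<open>Because the basepoint goes to \<open>e\<close> under \<open>\<gamma>\<close>
        and the action is strictly unital, \<open>\<phi>\<close> is the identity on the fibre over
        the basepoint, so its inverse there is too. The two pieces agree at the common point because
        \<open>f\<close> and \<open>g\<close> have the same value at the basepoint.\<close>
      define \<sigma> where "\<sigma> p = (if fst p = x\<^sub>0 then snd p else f (fst p))" for p
      have \<sigma>g: "\<sigma> (x, g x) = f x" for x using fx\<^sub>0 by (simp add: \<sigma>_def)
      have \<sigma>: "continuous_map (subtopology ?Z (?C g)) Y \<sigma>"
      proof (rule continuous_map_paste_closed[where D = X and q = "\<lambda>x. (x, g x)"
            and C = "{x\<^sub>0} \<times> topspace Y"])
        have "continuous_map X (subtopology ?Z (?C g)) (\<lambda>x. (x, g x))"
          by (rule continuous_map_into_subtopology[OF continuous_map_pairedI[OF continuous_map_ident contg]]) auto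
        then show "closed_map X (subtopology ?Z (?C g)) (\<lambda>x. (x, g x))"
          by (rule continuous_imp_closed_map[OF _ compact])
            (simp add: X Y Hausdorff_space_subtopology Hausdorff_space_prod_topology)
        show "closedin (subtopology ?Z (?C g)) ({x\<^sub>0} \<times> topspace Y)"
          by (rule closedin_subset_topspace[OF ndr_pair_closedin[OF ndr_pair_prod_left[OF ndr_x\<^sub>0]]]) blast
        show "topspace (subtopology ?Z (?C g)) = {x\<^sub>0} \<times> topspace Y \<union> (\<lambda>x. (x, g x)) ` topspace X"
          using C_sub(2) by (simp add: Int_absorb1 del: topspace_prod_topology)
        show "continuous_map X Y (\<lambda>x. \<sigma> (x, g x))" using contf by (simp add: \<sigma>g)
        show "continuous_map (subtopology (subtopology ?Z (?C g)) ({x\<^sub>0} \<times> topspace Y)) Y \<sigma>"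
          by (rule continuous_map_eq[OF continuous_map_from_subtopology[OF continuous_map_from_subtopology[OF
                  continuous_map_snd]]]) (auto simp: \<sigma>_def)
      qed
      obtain \<psi>' where \<psi>': "continuous_map ?Z Y \<psi>'" and \<psi>'g: "\<And>p. p \<in> ?C g \<Longrightarrow> \<psi>' p = \<sigma> p"
        and homs: "rel_homotopic ?Z Y (?C f) (\<psi>' \<star> \<phi>) snd" "rel_homotopic ?Z Y (?C g) (\<phi> \<star> \<psi>') snd"
      proof (rule inverse_rel[OF ndr \<phi> \<psi> \<psi>\<phi> \<phi>\<psi> \<sigma>])
        show "(fst p, \<phi> p) \<in> ?C g" if "p \<in> ?C f" for p using that \<phi>x\<^sub>0 \<phi>f by auto
        show "(fst p, \<sigma> p) \<in> ?C f" if "p \<in> ?C g" for p using that \<sigma>g gY by (auto simp: \<sigma>_def)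
        show "\<sigma> (fst p, \<phi> p) = snd p" if "p \<in> ?C f" for p
          using that \<phi>x\<^sub>0 \<phi>f fx\<^sub>0 by (auto simp: \<sigma>_def)
        show "\<phi> (fst p, \<sigma> p) = snd p" if "p \<in> ?C g" for p
          using that \<phi>x\<^sub>0 \<phi>f fx\<^sub>0 by (auto simp: \<sigma>_def)
      qed (rule that; assumption)
      note inv = fibre_act_inverse[OF X f \<phi> \<psi>' C_sub homs, folded g]
      have ev: "fibre_act X b h x\<^sub>0 = h x\<^sub>0"
        if "h \<in> topspace (?E k)" "\<And>y. y \<in> topspace Y \<Longrightarrow> b (x\<^sub>0, y) = y" for b h k
        using that continuous_mapsD(2)[OF map_component_continuous_maps x\<^sub>0] x\<^sub>0
        by (auto simp: fibre_act_def)
      show ?thesis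
        unfolding fibre_homotopy_equivalent_def based_map_def
      proof (intro exI conjI ballI)
        show "fibre_act X \<phi> f = g" by (simp add: g)
        show "fibre_act X \<psi>' g = f" by (rule act_eq[OF f]) (simp add: \<psi>'g \<sigma>g)
        show "fibre_act X \<phi> h x\<^sub>0 = h x\<^sub>0" if "h \<in> topspace (?E f)" for h
          by (rule ev[OF that \<phi>x\<^sub>0])
        show "fibre_act X \<psi>' h x\<^sub>0 = h x\<^sub>0" if "h \<in> topspace (?E g)" for h
          by (rule ev[OF that]) (simp add: \<psi>'g \<sigma>_def)
        show "homotopic_with (\<lambda>F. F f = f \<and> (\<forall>h\<in>topspace (?E f). F h x\<^sub>0 = h x\<^sub>0)) (?E f) (?E f)
            (fibre_act X \<psi>' \<circ> fibre_act X \<phi>) id"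
        proof (rule inv(3))
          \<comment> \<open>The graph part of the subspace fixes the point \<open>f\<close>; the
            axis part preserves evaluation at the basepoint.\<close>
          show "fibre_act X b f = f \<and> (\<forall>h\<in>topspace (?E f). fibre_act X b h x\<^sub>0 = h x\<^sub>0)"
            if "\<And>p. p \<in> ?C f \<Longrightarrow> b p = snd p" for b
            using that act_eq[OF f, of b f] ev[of _ f b] by simp
        qed (use fE in auto)
        show "homotopic_with (\<lambda>F. F g = g \<and> (\<forall>h\<in>topspace (?E g). F h x\<^sub>0 = h x\<^sub>0)) (?E g) (?E g)
            (fibre_act X \<phi> \<circ> fibre_act X \<psi>') id"
        proof (rule inv(4))
          show "fibre_act X b g = g \<and> (\<forall>h\<in>topspace (?E g). fibre_act X b h x\<^sub>0 = h x\<^sub>0)"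
            if "\<And>p. p \<in> ?C g \<Longrightarrow> b p = snd p" for b
            using that act_eq[OF g_cm, of b g] ev[of _ g b] by simp
        qed (use fE in auto)
      qed (rule inv continuous_map_evaluation[OF x\<^sub>0])+
    qed
  qed
  show ?thesis using partA partB partC unfolding g_def by blast
qed

end
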